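(* Let $(R,\mathfrak m)$ be a regular local domain of characteristic $p>0$ and dimension $d$, and let $0\ne f\in\mathfrak m$. Let the ideal $I\subset R/fR$ be a minimal reduction of $\mathfrak m/fR$ that is a parameter ideal in $R/fR$. Then for all $t\in[0,1]$, $$h_{R,f,I:\mathfrak m}(1-t)=h_{R,f,\mathfrak m}(t)-e(R/fR)(t-1)-1.$$ Moreover, if $f$ is a double point, i.e. $e(R/fR)=2$, then for all $t\in[0,1]$, $$h_{R,f,\mathfrak m}(1-t)=h_{R,f,\mathfrak m}(t)-2t+1,$$ or, in terms of the $F$-signature of pairs (defined for $R$ $F$-finite) and of the $\phi$-function (defined for $t\in[0,1]\cap\mathbb{Z}[1/p]$), $$s(R,f^{1-t})=s(R,f^t)+2t-1\qquad\text{and}\qquad\phi_{\mathfrak m,f}(1-t)=\phi_{\mathfrak m,f}(t)-2t+1.$$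
   Context: $e(\cdot)$ is the Hilbert–Samuel multiplicity at the maximal ideal. For an $\mathfrak m$-primary ideal $J$ of $R$, $J^{[p^e]}$ is the ideal generated by $p^e$-th powers of elements of $J$, and $$h_{R,f,J}(x)=\lim_{e\to\infty}\frac1{p^{ed}}\ell\bigl(R/(f^{\lceil xp^e\rceil}R+J^{[p^e]})\bigr),$$ where non-positive powers of an ideal are the unit ideal. Here $I:\mathfrak m$ denotes the ideal $(\tilde I,f):_R\mathfrak m$ of $R$, where $(\tilde I,f)$ is the preimage of $I$ in $R$ (if it is the unit ideal, the function $h$ is $0$). The $F$-signature of the pair is $s(R,f^t)=\lim_{e\to\infty}\frac1{p^{ed}}\ell\bigl(R/(\mathfrak m^{[p^e]}:f^{\lceil tp^e\rceil})\bigr)$. The $\phi$-function is $\phi_{J,f}(a/p^e)=\frac1{p^{ed}}\ell\bigl(R/(J^{[p^e]}+f^aR)\bigr)$ for integers $0\le a\le p^e$. *)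

theory Defs
  imports
    Complex_Main
    "HOL-Library.Extended_Nat"
    "HOL-Algebra.Algebra"
begin

section \<open>Dimension, characteristic, local rings\<close>

text \<open>The supremum in \<^typ>\<open>enat\<close> is \<open>0\<close> for the zero ring, which does not occur below.\<close>

definition krull_dim :: "('a, 'b) ring_scheme \<Rightarrow> enat" where
  "krull_dim R = Sup {enat n | n. \<exists>P :: nat \<Rightarrow> 'a set.
     (\<forall>i\<le>n. primeideal (P i) R) \<and> (\<forall>i<n. P i \<subset> P (Suc i))}"

text \<open>\<^const>\<open>group.ord\<close> is \<open>0\<close> for elements of infinite order.\<close>

definition ring_char :: "('a, 'b) ring_scheme \<Rightarrow> nat" where
  "ring_char R = group.ord (add_monoid R) \<one>\<^bsub>R\<^esub>"

locale noetherian_local_ring = noetherian_ring R + cring R + maximalideal \<mm> R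
  for R (structure) and \<mm> +
  assumes maximal_unique: "maximalideal N R \<Longrightarrow> N = \<mm>"

locale regular_local_ring = noetherian_local_ring +
  assumes regular: "\<exists>xs. set xs \<subseteq> carrier R \<and> krull_dim R = enat (length xs) \<and> \<mm> = Idl (set xs)"


section \<open>Length\<close>

definition module_length :: "('a, 'c) ring_scheme \<Rightarrow> ('a, 'b, 'd) module_scheme \<Rightarrow> enat" where
  "module_length R M = Sup {enat n | n. \<exists>N :: nat \<Rightarrow> 'b set.
     (\<forall>i\<le>n. submodule (N i) R M) \<and> (\<forall>i<n. N i \<subset> N (Suc i))}"

text \<open>The \<open>R\<close>-module \<open>R/I\<close>.\<close>

definition quot_module :: "('a, 'b) ring_scheme \<Rightarrow> 'a set \<Rightarrow> ('a, 'a set) module" where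
  "quot_module R I =
     ring.extend (R Quot I) (module.fields (\<lambda>a C. (I +>\<^bsub>R\<^esub> a) \<otimes>\<^bsub>R Quot I\<^esub> C))"

lemma quot_module_simps [simp]:
  "carrier (quot_module R I) = carrier (R Quot I)"
  "\<zero>\<^bsub>quot_module R I\<^esub> = \<zero>\<^bsub>R Quot I\<^esub>"
  "C \<oplus>\<^bsub>quot_module R I\<^esub> D = C \<oplus>\<^bsub>R Quot I\<^esub> D"
  "a \<odot>\<^bsub>quot_module R I\<^esub> C = (I +>\<^bsub>R\<^esub> a) \<otimes>\<^bsub>R Quot I\<^esub> C"
  by (simp_all add: quot_module_def ring.defs module.defs)

lemma (in ideal) quot_module_is_module:
  assumes "cring R"
  shows "module R (quot_module R I)"
proof -
  interpret cring R by fact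
  interpret Q: cring "R Quot I"
    by (rule quotient_is_cring) fact
  have hom: "(\<lambda>a. I +> a) \<in> ring_hom R (R Quot I)"
    by (rule rcos_ring_hom)
  have "abelian_group (quot_module R I)"
    by (rule abelian_groupI) (auto simp: Q.a_ac intro: Q.l_neg)
  then show ?thesis
    using hom by (intro moduleI) (auto simp: ring_hom_def Pi_iff Q.l_distr Q.r_distr Q.m_assoc is_cring)
qed

text \<open>\<open>\<ell>(R/I)\<close> as a number. It is used below only for \<open>R/I\<close> of finite length.\<close>

definition colength :: "('a, 'b) ring_scheme \<Rightarrow> 'a set \<Rightarrow> nat" where
  "colength R I = the_enat (module_length R (quot_module R I))"


section \<open>Ideals\<close>

definition colon_ideal :: "('a, 'b) ring_scheme \<Rightarrow> 'a set \<Rightarrow> 'a set \<Rightarrow> 'a set" where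
  "colon_ideal R J S = {r \<in> carrier R. \<forall>x\<in>S. r \<otimes>\<^bsub>R\<^esub> x \<in> J}"

text \<open>\<open>J\<^sup>[\<^sup>q\<^sup>]\<close>\<close>

definition bracket_power :: "('a, 'b) ring_scheme \<Rightarrow> 'a set \<Rightarrow> nat \<Rightarrow> 'a set" where
  "bracket_power R J q = Idl\<^bsub>R\<^esub> {x [^]\<^bsub>R\<^esub> q | x. x \<in> J}"

text \<open>The image in \<open>R/K\<close> of an ideal of \<open>R\<close>, and the preimage in \<open>R\<close> of an ideal of \<open>R/K\<close>.\<close>

definition quot_image :: "('a, 'b) ring_scheme \<Rightarrow> 'a set \<Rightarrow> 'a set \<Rightarrow> 'a set set" where
  "quot_image R K J = (\<lambda>x. K +>\<^bsub>R\<^esub> x) ` J"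

definition quot_preimage :: "('a, 'b) ring_scheme \<Rightarrow> 'a set \<Rightarrow> 'a set set \<Rightarrow> 'a set" where
  "quot_preimage R K I = {r \<in> carrier R. K +>\<^bsub>R\<^esub> r \<in> I}"

definition primary_to :: "('a, 'b) ring_scheme \<Rightarrow> 'a set \<Rightarrow> 'a set \<Rightarrow> bool" where
  "primary_to R \<mm> Q \<longleftrightarrow> ideal Q R \<and> Q \<noteq> carrier R \<and>
     (\<forall>a\<in>carrier R. \<forall>b\<in>carrier R. a \<otimes>\<^bsub>R\<^esub> b \<in> Q \<longrightarrow> a \<in> Q \<or> (\<exists>n::nat. b [^]\<^bsub>R\<^esub> n \<in> Q)) \<and>
     {a \<in> carrier R. \<exists>n::nat. a [^]\<^bsub>R\<^esub> n \<in> Q} = \<mm>"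

text \<open>An ideal generated by a full system of parameters of the local ring \<open>(R, \<mm>)\<close>.\<close>

definition parameter_ideal :: "('a, 'b) ring_scheme \<Rightarrow> 'a set \<Rightarrow> 'a set \<Rightarrow> bool" where
  "parameter_ideal R \<mm> I \<longleftrightarrow> primary_to R \<mm> I \<and>
     (\<exists>xs. set xs \<subseteq> carrier R \<and> krull_dim R = enat (length xs) \<and> I = Idl\<^bsub>R\<^esub> (set xs))"

text \<open>Powers in the monoid \<^term>\<open>ideals_set R\<close> are the usual powers of ideals, with \<open>J\<^sup>0 = R\<close>.\<close>

definition reduction :: "('a, 'b) ring_scheme \<Rightarrow> 'a set \<Rightarrow> 'a set \<Rightarrow> bool" where
  "reduction R J I \<longleftrightarrow> ideal I R \<and> I \<subseteq> J \<and>
     (\<exists>n::nat. I \<cdot>\<^bsub>R\<^esub> (J [^]\<^bsub>ideals_set R\<^esub> n) = J [^]\<^bsub>ideals_set R\<^esub> (Suc n))"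

definition minimal_reduction :: "('a, 'b) ring_scheme \<Rightarrow> 'a set \<Rightarrow> 'a set \<Rightarrow> bool" where
  "minimal_reduction R J I \<longleftrightarrow> reduction R J I \<and> (\<forall>I'. reduction R J I' \<and> I' \<subseteq> I \<longrightarrow> I' = I)"

text \<open>The Hilbert--Samuel multiplicity of the local ring \<open>(R, \<mm>)\<close>:
  \<open>\<delta>! lim\<^sub>k \<ell>(R/\<mm>\<^sup>k)/k\<^sup>\<delta>\<close> with \<open>\<delta> = dim R\<close>.\<close>

definition hs_multiplicity :: "('a, 'b) ring_scheme \<Rightarrow> 'a set \<Rightarrow> real" where
  "hs_multiplicity R \<mm> = fact (the_enat (krull_dim R)) *
     lim (\<lambda>k. real (colength R (\<mm> [^]\<^bsub>ideals_set R\<^esub> k)) / real k ^ the_enat (krull_dim R))"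


section \<open>Invariants in characteristic \<open>p\<close>\<close>

text \<open>\<open>p\<close> is the characteristic and \<open>d\<close> the dimension of \<open>R\<close>. The coercion \<^const>\<open>nat\<close> sends negative
  exponents to \<open>0\<close>, so that \<open>f\<^sup>n R\<close> is the unit ideal for \<open>n \<le> 0\<close>. For \<open>J = R\<close> the function
  \<open>h\<close> is \<open>0\<close>.\<close>

definition h_fun :: "('a, 'b) ring_scheme \<Rightarrow> nat \<Rightarrow> nat \<Rightarrow> 'a \<Rightarrow> 'a set \<Rightarrow> real \<Rightarrow> real" where
  "h_fun R p d f J x = lim (\<lambda>e.
     real (colength R (PIdl\<^bsub>R\<^esub> (f [^]\<^bsub>R\<^esub> nat \<lceil>x * real (p ^ e)\<rceil>) <+>\<^bsub>R\<^esub> bracket_power R J (p ^ e)))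
       / real (p ^ (e * d)))"

definition F_signature :: "('a, 'b) ring_scheme \<Rightarrow> nat \<Rightarrow> nat \<Rightarrow> 'a set \<Rightarrow> 'a \<Rightarrow> real \<Rightarrow> real" where
  "F_signature R p d \<mm> f t = lim (\<lambda>e.
     real (colength R (colon_ideal R (bracket_power R \<mm> (p ^ e)) {f [^]\<^bsub>R\<^esub> nat \<lceil>t * real (p ^ e)\<rceil>}))
       / real (p ^ (e * d)))"

text \<open>\<open>R\<close> is a finite module over its subring of \<open>p\<close>-th powers.\<close>

definition F_finite :: "('a, 'b) ring_scheme \<Rightarrow> nat \<Rightarrow> bool" where
  "F_finite R p \<longleftrightarrow> (\<exists>B \<subseteq> carrier R. finite B \<and>
     (\<forall>x\<in>carrier R. \<exists>c \<in> B \<rightarrow> carrier R. x = (\<Oplus>\<^bsub>R\<^esub>b\<in>B. (c b [^]\<^bsub>R\<^esub> p) \<otimes>\<^bsub>R\<^esub> b)))"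

text \<open>The value at \<open>t\<close> is the one given by the formula for every representation \<open>t = a/p\<^sup>e\<close>.\<close>

definition phi_fun :: "('a, 'b) ring_scheme \<Rightarrow> nat \<Rightarrow> nat \<Rightarrow> 'a set \<Rightarrow> 'a \<Rightarrow> real \<Rightarrow> real" where
  "phi_fun R p d J f t = (THE y. \<forall>a e :: nat. a \<le> p ^ e \<and> t = real a / real (p ^ e) \<longrightarrow>
     y = real (colength R (bracket_power R J (p ^ e) <+>\<^bsub>R\<^esub> PIdl\<^bsub>R\<^esub> (f [^]\<^bsub>R\<^esub> a))) / real (p ^ (e * d)))"

text \<open>The subring \<open>\<int>[1/p]\<close> of the reals.\<close>

definition Z_inv :: "nat \<Rightarrow> real set" where
  "Z_inv p = {of_int a / real (p ^ e) | (a :: int) (e :: nat). True}"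

end

theory Submission
  imports Defs
begin

text \<open>
  Let \<open>q = p\<^sup>e\<close>, let \<open>x\<^sub>1, \<dots>, x\<^sub>d\<^sub>-\<^sub>1\<close> be lifts of generators of \<open>I\<close>, and put
  \<open>J = (x\<^sub>1, \<dots>, x\<^sub>d\<^sub>-\<^sub>1, f)\<close>. Since \<open>I\<close> is a reduction, the \<open>x\<^sub>i\<close> are part of a regular system of
  parameters, so that \<open>R/J\<close> is Gorenstein, and \<open>\<ell>(R/J) = e(R/fR)\<close>. In the Gorenstein ring
  \<open>S = R/J\<^sup>[\<^sup>q\<^sup>]\<close> the annihilator of \<open>f\<^sup>a\<close> is generated by \<open>f\<^sup>q\<^sup>-\<^sup>a\<close>, and that of \<open>\<mm>\<^sup>[\<^sup>q\<^sup>]\<close> is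
  \<open>(J : \<mm>)\<^sup>[\<^sup>q\<^sup>]S\<close>. Duality therefore expresses \<open>\<ell>(R/(f\<^sup>a, (J : \<mm>)\<^sup>[\<^sup>q\<^sup>]))\<close> through
  \<open>\<ell>(R/(f\<^sup>q\<^sup>-\<^sup>a, \<mm>\<^sup>[\<^sup>q\<^sup>]))\<close>; divide by \<open>q\<^sup>d\<close> and let \<open>e\<close> tend to infinity.

  Neither flatness of Frobenius nor regular sequences are used. Instead, inequalities between
  lengths that hold for each step of a filtration are forced to be equalities by the total length.
  The only exact count needed for this is \<open>\<ell>(R/\<mm>\<^sup>[\<^sup>q\<^sup>]) = q\<^sup>d\<close>. Here \<open>\<le>\<close> is clear and
  \<open>q \<mapsto> \<ell>(R/\<mm>\<^sup>[\<^sup>q\<^sup>])\<close> is submultiplicative, so a strict inequality would contradict the growth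
  of order at least \<open>k\<^sup>d\<close> of \<open>\<ell>(R/\<mm>\<^sup>k)\<close>, which Artin--Rees gives along a chain of \<open>d + 1\<close> primes.
\<close>

text \<open>Lengths are counted inside R: a composition series adjoins one element at a time, and
  the sequence 0 -> R/(B : u) -> R/B -> R/(B + uR) -> 0 does all the bookkeeping. With X = (x_1^q,
  ..., x_(d-1)^q) and b = q - a, it is applied to K = J^[q] : \<mm>^[q] and u = f^a. Colons commute,
  so K : f^a = (X, f^b) : \<mm>^[q], which is dual in R/(X, f^b) to \<mm>^[q] + f^b R. The colength
  b q^(d-1) e(R/fR) of (X, f^b) is the source of the linear term in t.

  The multiplicity enters by comparing (f) + \<mm>^k with (f) + (x_1, ..., x_(d-1))^k, whose
  colength is that of J times a binomial coefficient; the reduction property bounds the difference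
  by a fixed shift of k.

  An obstacle is rounding: the ceiling of (1-t)q is q minus the floor of tq, whereas h at t uses the
  ceiling of tq. The exponents differ by at most one, which costs at most q^(d-1) e(R/fR) and
  vanishes after division by q^d. Convergence for J : \<mm> is then inherited from that for \<mm>,
  where the sequence is decreasing.\<close>

no_notation Sum_Type.Plus (infixr "<+>" 65)

section \<open>Ideals and composition series\<close>

lemma seq_mono_upto:
  fixes N :: "nat \<Rightarrow> 'c set"
  assumes "\<And>i. i < k \<Longrightarrow> N i \<subset> N (Suc i)" "i \<le> j" "j \<le> k"
  shows "N i \<subseteq> N j"
  using assms(2,3)
proof (induction j rule: dec_induct)
  case (step n)
  then show ?case using assms(1)[of n] by auto
qed simp

context cring begin

lemma ideal_mem:
  assumes "ideal I R"
  shows "a \<in> I \<Longrightarrow> a \<in> carrier R" "\<zero> \<in> I"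
    "\<lbrakk>a \<in> I; b \<in> I\<rbrakk> \<Longrightarrow> a \<oplus> b \<in> I" "\<lbrakk>a \<in> I; b \<in> I\<rbrakk> \<Longrightarrow> a \<ominus> b \<in> I" "a \<in> I \<Longrightarrow> \<ominus> a \<in> I"
    "\<lbrakk>x \<in> carrier R; a \<in> I\<rbrakk> \<Longrightarrow> x \<otimes> a \<in> I" "\<lbrakk>x \<in> carrier R; a \<in> I\<rbrakk> \<Longrightarrow> a \<otimes> x \<in> I"
proof -
  interpret ideal I R by fact
  show "a \<in> I \<Longrightarrow> a \<in> carrier R" "\<zero> \<in> I"
    "\<lbrakk>a \<in> I; b \<in> I\<rbrakk> \<Longrightarrow> a \<oplus> b \<in> I" "\<lbrakk>a \<in> I; b \<in> I\<rbrakk> \<Longrightarrow> a \<ominus> b \<in> I" "a \<in> I \<Longrightarrow> \<ominus> a \<in> I"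
    "\<lbrakk>x \<in> carrier R; a \<in> I\<rbrakk> \<Longrightarrow> x \<otimes> a \<in> I" "\<lbrakk>x \<in> carrier R; a \<in> I\<rbrakk> \<Longrightarrow> a \<otimes> x \<in> I"
    by (auto simp: a_minus_def I_l_closed I_r_closed)
qed

lemma idealI':
  assumes "I \<subseteq> carrier R" "\<zero> \<in> I" "\<And>a b. \<lbrakk>a \<in> I; b \<in> I\<rbrakk> \<Longrightarrow> a \<oplus> b \<in> I"
    "\<And>x a. \<lbrakk>x \<in> carrier R; a \<in> I\<rbrakk> \<Longrightarrow> x \<otimes> a \<in> I"
  shows "ideal I R"
proof (rule idealI)
  show "ring R" by (rule ring_axioms)
  have "\<ominus> a \<in> I" if "a \<in> I" for a
    using assms(4)[of "\<ominus> \<one>" a] that assms(1) by (simp add: l_minus subset_iff)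
  then show "subgroup I (add_monoid R)"
    using assms by (auto simp: subgroup_def simp flip: a_inv_def)
  show "x \<otimes> a \<in> I" if "a \<in> I" "x \<in> carrier R" for a x using assms(4) that by blast
  then show "a \<otimes> x \<in> I" if "a \<in> I" "x \<in> carrier R" for a x
    using that assms(1) by (metis m_comm subsetD)
qed

lemma mem_add_iff: "x \<in> I <+> J \<longleftrightarrow> (\<exists>i\<in>I. \<exists>j\<in>J. x = i \<oplus> j)"
  by (auto simp: set_add_def')

lemma mem_PIdl_iff: "x \<in> PIdl u \<longleftrightarrow> (\<exists>r\<in>carrier R. x = r \<otimes> u)"
  by (auto simp: cgenideal_def)

lemma mem_adj_iff: "x \<in> B <+> PIdl u \<longleftrightarrow> (\<exists>b\<in>B. \<exists>r\<in>carrier R. x = b \<oplus> r \<otimes> u)"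
  unfolding mem_add_iff Bex_def mem_PIdl_iff by blast

lemma PIdl_self: "u \<in> carrier R \<Longrightarrow> u \<in> PIdl u"
  using cgenideal_self .

lemma add_ideal_upper:
  assumes "ideal I R" "ideal J R"
  shows "I \<subseteq> I <+> J" "J \<subseteq> I <+> J"
proof -
  show "I \<subseteq> I <+> J"
  proof
    fix x assume "x \<in> I"
    then show "x \<in> I <+> J"
      using ideal_mem(1)[OF assms(1)] ideal_mem(2)[OF assms(2)] unfolding mem_add_iff
      by (metis r_zero)
  qed
  show "J \<subseteq> I <+> J"
  proof
    fix x assume "x \<in> J"
    then show "x \<in> I <+> J"
      using ideal_mem(2)[OF assms(1)] ideal_mem(1)[OF assms(2)] unfolding mem_add_iff
      by (metis l_zero)
  qed
qed

lemma add_ideal_least: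
  assumes "ideal K R" "I \<subseteq> K" "J \<subseteq> K"
  shows "I <+> J \<subseteq> K"
proof
  fix x assume "x \<in> I <+> J"
  then obtain i j where "i \<in> I" "j \<in> J" "x = i \<oplus> j" by (auto simp: mem_add_iff)
  then show "x \<in> K" using ideal_mem(3)[OF assms(1)] assms(2,3) by blast
qed

lemma add_ideal_mono:
  assumes "I \<subseteq> I'" "J \<subseteq> J'"
  shows "I <+> J \<subseteq> I' <+> J'"
  using assms by (auto simp: mem_add_iff) blast

lemma PIdl_least:
  assumes "ideal K R" "u \<in> K"
  shows "PIdl u \<subseteq> K"
  using cgenideal_minimal assms .

lemma adj_ideal: "\<lbrakk>ideal B R; u \<in> carrier R\<rbrakk> \<Longrightarrow> ideal (B <+> PIdl u) R"
  by (intro add_ideals cgenideal_ideal)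

lemma adj_upper:
  assumes "ideal B R" "u \<in> carrier R"
  shows "B \<subseteq> B <+> PIdl u" "u \<in> B <+> PIdl u"
  using add_ideal_upper[OF assms(1) cgenideal_ideal[OF assms(2)]] PIdl_self[OF assms(2)] by auto

lemma adj_least: "\<lbrakk>ideal K R; B \<subseteq> K; u \<in> K\<rbrakk> \<Longrightarrow> B <+> PIdl u \<subseteq> K"
  by (intro add_ideal_least PIdl_least)

lemma adj_absorb: "\<lbrakk>ideal B R; u \<in> B\<rbrakk> \<Longrightarrow> B <+> PIdl u = B"
  using adj_least[of B B u] adj_upper(1)[of B u] ideal_mem(1)[of B u] by blast

lemma colon_ideal_ideal:
  assumes "ideal B R" "S \<subseteq> carrier R"
  shows "ideal (colon_ideal R B S) R"
  by (rule idealI') (use assms ideal_mem[OF assms(1)] in \<open>auto simp: colon_ideal_def l_distr m_assoc subset_iff\<close>)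

lemma colon_upper:
  assumes "ideal B R" "S \<subseteq> carrier R"
  shows "B \<subseteq> colon_ideal R B S"
  using assms ideal_mem[OF assms(1)] by (auto simp: colon_ideal_def)

lemma ideal_eq_carrier: "\<lbrakk>ideal I R; \<one> \<in> I\<rbrakk> \<Longrightarrow> I = carrier R"
  by (rule ideal.one_imp_carrier)

lemma ideal_Int: "\<lbrakk>ideal I R; ideal J R\<rbrakk> \<Longrightarrow> ideal (I \<inter> J) R"
  by (rule i_intersect)

lemma scaled_ideal:
  assumes "ideal C R" "u \<in> carrier R"
  shows "ideal ((\<lambda>c. c \<otimes> u) ` C) R"
proof (rule idealI')
  show "(\<lambda>c. c \<otimes> u) ` C \<subseteq> carrier R" using ideal_mem[OF assms(1)] assms(2) by auto
  show "\<zero> \<in> (\<lambda>c. c \<otimes> u) ` C" using ideal_mem[OF assms(1)] assms(2) by (force intro!: image_eqI[of _ _ \<zero>])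
  show "a \<oplus> b \<in> (\<lambda>c. c \<otimes> u) ` C" if "a \<in> (\<lambda>c. c \<otimes> u) ` C" "b \<in> (\<lambda>c. c \<otimes> u) ` C" for a b
    using that ideal_mem[OF assms(1)] assms(2) by (force simp: l_distr[symmetric])
  show "x \<otimes> a \<in> (\<lambda>c. c \<otimes> u) ` C" if "x \<in> carrier R" "a \<in> (\<lambda>c. c \<otimes> u) ` C" for a x
    using that ideal_mem[OF assms(1)] assms(2) by (force simp: m_assoc[symmetric])
qed

end

section \<open>Maximal elements among ideals\<close>

context noetherian_ring begin

lemma ideals_have_maximal:
  assumes "C \<noteq> {}" "\<And>I. I \<in> C \<Longrightarrow> ideal I R"
  shows "\<exists>M\<in>C. \<forall>I\<in>C. M \<subseteq> I \<longrightarrow> I = M"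
proof (rule subset_Zorn)
  fix D assume D: "subset.chain C D"
  show "\<exists>U\<in>C. \<forall>Y\<in>D. Y \<subseteq> U"
  proof (cases "D = {}")
    case True
    then show ?thesis using assms(1) by auto
  next
    case False
    have "subset.chain {I. ideal I R} D"
      using D assms(2) by (auto simp: pred_on.chain_def)
    then have "\<Union>D \<in> D" using ideal_chain_is_trivial False by blast
    then show ?thesis using D by (intro bexI[of _ "\<Union>D"]) (auto simp: pred_on.chain_def)
  qed
qed

lemma ideal_seq_stable:
  fixes A :: "nat \<Rightarrow> 'a set"
  assumes "\<And>i. ideal (A i) R" "\<And>i. A i \<subseteq> A (Suc i)"
  shows "\<exists>n. \<forall>i\<ge>n. A i = A n"
proof -
  have mono: "A i \<subseteq> A j" if "i \<le> j" for i j
    by (rule lift_Suc_mono_le[of A, OF assms(2) that])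
  obtain n where "\<forall>I\<in>range A. A n \<subseteq> I \<longrightarrow> I = A n"
    using ideals_have_maximal[of "range A"] assms(1) by auto
  then have "A i = A n" if "n \<le> i" for i using mono[OF that] by blast
  then show ?thesis by blast
qed

end

section \<open>Local rings and composition series\<close>

context noetherian_local_ring begin

lemma m_ideal: "ideal \<mm> R" by (rule is_ideal)

lemma one_notin_m: "\<one> \<notin> \<mm>"
  using I_notcarr one_imp_carrier by blast

lemma proper_ideal_le_m:
  assumes "ideal I R" "\<one> \<notin> I"
  shows "I \<subseteq> \<mm>"
proof -
  let ?C = "{J. ideal J R \<and> I \<subseteq> J \<and> \<one> \<notin> J}"
  obtain M where M: "M \<in> ?C" "\<And>J. J \<in> ?C \<Longrightarrow> M \<subseteq> J \<Longrightarrow> J = M"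
    using ideals_have_maximal[of ?C] assms by (metis (mono_tags, lifting) empty_iff mem_Collect_eq order_refl)
  have "maximalideal M R"
  proof (rule maximalidealI)
    show "ideal M R" "carrier R \<noteq> M" using M(1) by auto
    fix J assume J: "ideal J R" "M \<subseteq> J" "J \<subseteq> carrier R"
    show "J = M \<or> J = carrier R"
    proof (cases "\<one> \<in> J")
      case True then show ?thesis using ideal_eq_carrier[OF J(1)] by simp
    next
      case False
      then show ?thesis using M(2)[of J] J M(1) by blast
    qed
  qed
  then have "M = \<mm>" by (rule maximal_unique)
  then show ?thesis using M(1) by blast
qed

lemma notin_m_Unit:
  assumes "r \<in> carrier R" "r \<notin> \<mm>"
  shows "\<exists>s\<in>carrier R. s \<otimes> r = \<one>"
proof (rule ccontr)
  assume "\<not> ?thesis"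
  then have "\<one> \<notin> PIdl r" by (auto simp: mem_PIdl_iff)
  then have "PIdl r \<subseteq> \<mm>" using proper_ideal_le_m cgenideal_ideal assms(1) by blast
  then show False using PIdl_self assms by blast
qed

lemma unit_mult_mem:
  assumes "ideal N R" "r \<in> carrier R" "r \<notin> \<mm>" "u \<in> carrier R" "r \<otimes> u \<in> N"
  shows "u \<in> N"
proof -
  obtain s where s: "s \<in> carrier R" "s \<otimes> r = \<one>" using notin_m_Unit assms by blast
  then have "u = s \<otimes> (r \<otimes> u)" using assms by (simp add: m_assoc[symmetric])
  then show ?thesis using ideal_mem(6)[OF assms(1) s(1) assms(5)] by simp
qed

text \<open>A step adjoins one \<open>u\<close> outside \<open>B\<close> with \<mm> u inside
  \<open>B\<close>, so its factor is R/\<mm>. Working with ideals and single generators keeps all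
  length arguments inside R, as inductions on such series.\<close>

inductive comp_series :: "nat \<Rightarrow> 'a set \<Rightarrow> 'a set \<Rightarrow> bool" where
  refl: "ideal A R \<Longrightarrow> comp_series 0 A A"
| step: "\<lbrakk>ideal B R; u \<in> carrier R; u \<notin> B; \<And>x. x \<in> \<mm> \<Longrightarrow> x \<otimes> u \<in> B; comp_series n (B <+> PIdl u) A\<rbrakk>
    \<Longrightarrow> comp_series (Suc n) B A"

lemma comp_series_ideals: "comp_series n B A \<Longrightarrow> ideal B R \<and> ideal A R \<and> B \<subseteq> A"
  by (induction rule: comp_series.induct) (use adj_upper in blast)+

lemma comp_series_trans: "\<lbrakk>comp_series n B A; comp_series k A C\<rbrakk> \<Longrightarrow> comp_series (n + k) B C"
  by (induction rule: comp_series.induct) (auto intro: comp_series.step)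

text \<open>The Jordan--Hoelder bound, by induction on the series: adjoining \<open>u\<close> pushes
  a chain above \<open>B\<close> into the part above \<open>B <+> PIdl u\<close>, and since this
  ideal is simple over \<open>B\<close> at most one inclusion is lost.\<close>

lemma comp_series_chain_bound:
  fixes N :: "nat \<Rightarrow> 'a set"
  assumes "comp_series n B A" "\<And>i. i \<le> k \<Longrightarrow> ideal (N i) R" "\<And>i. i < k \<Longrightarrow> N i \<subset> N (Suc i)" "B \<subseteq> N 0" "N k \<subseteq> A"
  shows "k \<le> n"
  using assms
proof (induction arbitrary: N k rule: comp_series.induct)
  case (refl A)
  show ?case
  proof (rule ccontr)
    assume "\<not> k \<le> 0"
    then have "N 0 \<subset> N (Suc 0)" using refl by blast
    moreover have "N (Suc 0) \<subseteq> N k"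
      by (rule seq_mono_upto[of k N]) (use refl.prems(2) \<open>\<not> k \<le> 0\<close> in auto)
    ultimately show False using refl by blast
  qed
next
  case (step B u n A)
  show ?case
  proof (cases k)
    case 0 then show ?thesis by simp
  next
    case (Suc k')
    have up: "N i \<subseteq> N j" if "i \<le> j" "j \<le> k" for i j
      by (rule seq_mono_upto[of k N]) (use step.prems(2) that in auto)
    have BN: "B \<subseteq> N i" if "i \<le> k" for i using up[of 0 i] that step.prems by auto
    have uA: "u \<in> A" "B <+> PIdl u \<subseteq> A"
      using comp_series_ideals[OF step.hyps(5)] adj_upper[OF step.hyps(1,2)] by auto
    \<comment> \<open>The inclusion that may collapse is the one at which \<open>u\<close> enters
      the chain. From there on \<open>M\<close> uses the next member of \<open>N\<close>, so only
      one link is lost.\<close>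
    define M where "M i = (if u \<in> N (Suc i) then N (Suc i) else N i <+> PIdl u)" for i
    have strict: "N i <+> PIdl u \<subset> N (Suc i) <+> PIdl u" if i: "i < k" "u \<notin> N (Suc i)" for i
    proof -
      have id: "ideal (N i) R" "ideal (N (Suc i)) R" using i step.prems(1) by auto
      have "N i <+> PIdl u \<subseteq> N (Suc i) <+> PIdl u"
        using add_ideal_mono[of "N i" "N (Suc i)"] step.prems(2)[OF i(1)] by blast
      moreover have "\<not> N (Suc i) <+> PIdl u \<subseteq> N i <+> PIdl u"
      proof
        assume sub: "N (Suc i) <+> PIdl u \<subseteq> N i <+> PIdl u"
        have "N (Suc i) \<subseteq> N i"
        proof
          fix v assume v: "v \<in> N (Suc i)"
          then have "v \<in> N i <+> PIdl u" using sub adj_upper[OF id(2) step.hyps(2)] by blast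
          then obtain a r where ar: "a \<in> N i" "r \<in> carrier R" "v = a \<oplus> r \<otimes> u"
            by (auto simp: mem_adj_iff)
          have aS: "a \<in> N (Suc i)" using ar(1) step.prems(2)[OF i(1)] by blast
          have "r \<otimes> u = v \<ominus> a"
            using ar step.hyps(2) ideal_mem(1)[OF id(1)] by (auto, algebra)
          then have ruS: "r \<otimes> u \<in> N (Suc i)" using ideal_mem(4)[OF id(2)] v aS by simp
          \<comment> \<open>A unit coefficient would put \<open>u\<close> itself into
            \<open>N (Suc i)\<close>.\<close>
          have "r \<in> \<mm>" using unit_mult_mem[OF id(2) ar(2) _ step.hyps(2) ruS] i(2) by blast
          then have "r \<otimes> u \<in> N i" using step.hyps(4) BN[of i] i(1) by auto
          then show "v \<in> N i" using ar ideal_mem(3)[OF id(1)] by blast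
        qed
        then show False using step.prems(2)[OF i(1)] by blast
      qed
      ultimately show ?thesis by blast
    qed
    have "k' \<le> n"
    proof (rule step.IH)
      show "ideal (M i) R" if "i \<le> k'" for i
        using that step.prems(1)[of i] step.prems(1)[of "Suc i"] adj_ideal[of "N i" u] step.hyps(2) Suc by (auto simp: M_def)
      show "M i \<subset> M (Suc i)" if "i < k'" for i
      proof (cases "u \<in> N (Suc i)")
        case True
        then have "u \<in> N (Suc (Suc i))" using up[of "Suc i" "Suc (Suc i)"] that Suc by auto
        then show ?thesis using True step.prems(2)[of "Suc i"] that Suc by (auto simp: M_def)
      next
        case False
        have s: "N i <+> PIdl u \<subset> N (Suc i) <+> PIdl u" using strict[of i] False that Suc by auto
        show ?thesis
        proof (cases "u \<in> N (Suc (Suc i))")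
          case True
          have "N (Suc i) <+> PIdl u \<subseteq> N (Suc (Suc i))"
            using adj_least[of "N (Suc (Suc i))" "N (Suc i)" u] True step.prems(1,2) that Suc by auto
          then show ?thesis using s True False by (auto simp: M_def)
        next
          case F2: False
          then show ?thesis using s False by (auto simp: M_def)
        qed
      qed
      show "B <+> PIdl u \<subseteq> M 0"
        using adj_least[of "N (Suc 0)" B u] add_ideal_mono[OF step.prems(3) subset_refl, of "PIdl u"]
          step.prems(1)[of "Suc 0"] BN[of "Suc 0"] Suc by (auto simp: M_def)
      show "M k' \<subseteq> A"
        using adj_least[of A "N k'" u] uA comp_series_ideals[OF step.hyps(5)] step.prems(4) up[of k' k] Suc by (auto simp: M_def)
    qed
    then show ?thesis using Suc by simp
  qed
qed

end

section \<open>Invariance and additivity of length\<close>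

context noetherian_local_ring begin

lemma comp_series_chain:
  "comp_series k B A \<Longrightarrow> \<exists>N. (\<forall>i\<le>k. ideal (N i) R) \<and> (\<forall>i<k. N i \<subset> N (Suc i)) \<and> N 0 = B \<and> N k = A"
proof (induction rule: comp_series.induct)
  case (refl A)
  then show ?case by (intro exI[of _ "\<lambda>_. A"]) auto
next
  case (step B u n A)
  then obtain N where N: "\<forall>i\<le>n. ideal (N i) R" "\<forall>i<n. N i \<subset> N (Suc i)" "N 0 = B <+> PIdl u" "N n = A"
    by blast
  show ?case
  proof (intro exI[of _ "\<lambda>i. case i of 0 \<Rightarrow> B | Suc j \<Rightarrow> N j"] conjI allI impI)
    fix i assume "i < Suc n"
    then show "(case i of 0 \<Rightarrow> B | Suc j \<Rightarrow> N j) \<subset> (case Suc i of 0 \<Rightarrow> B | Suc j \<Rightarrow> N j)"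
      using N step.hyps(3) adj_upper[OF step.hyps(1,2)] by (auto split: nat.split)
  qed (use N step.hyps(1) in \<open>auto split: nat.split\<close>)
qed

lemma comp_series_unique: "\<lbrakk>comp_series n B A; comp_series k B A\<rbrakk> \<Longrightarrow> k = n"
proof -
  have le: "k \<le> n" if nk: "comp_series n B A" "comp_series k B A" for n k
  proof -
    obtain N where "\<forall>i\<le>k. ideal (N i) R" "\<forall>i<k. N i \<subset> N (Suc i)" "N 0 = B" "N k = A"
      using comp_series_chain[OF nk(2)] by blast
    then show ?thesis using comp_series_chain_bound[OF nk(1), of k N] by auto
  qed
  show ?thesis if "comp_series n B A" "comp_series k B A" using le[OF that] le[OF that(2,1)] by simp
qed

text \<open>The modular law: since \<open>M\<close> lies in \<open>L <+> K\<close>, each adjoined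
  \<open>u\<close> may be replaced by an element \<open>k\<close> of \<open>K\<close> congruent to
  it modulo \<open>L\<close>. Then M/L and (M \<inter> K)/(L \<inter> K) have the same
  factors.\<close>

lemma comp_series_Int:
  assumes "comp_series n L M" "ideal K R" "M \<subseteq> L <+> K"
  shows "comp_series n (L \<inter> K) (M \<inter> K)"
  using assms
proof (induction rule: comp_series.induct)
  case (refl A)
  then show ?case by (auto intro: comp_series.refl ideal_Int)
next
  case (step L u n M)
  note L = step.hyps(1) and K = step.prems(1)
  have M: "ideal M R" "L <+> PIdl u \<subseteq> M" using comp_series_ideals[OF step.hyps(5)] by auto
  have "u \<in> L <+> K" using M adj_upper[OF L step.hyps(2)] step.prems(2) by blast
  then obtain l k where lk: "l \<in> L" "k \<in> K" "u = l \<oplus> k" by (auto simp: mem_add_iff)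
  note car = ideal_mem(1)[OF L lk(1)] ideal_mem(1)[OF K lk(2)]
  have kL: "k \<notin> L" using lk step.hyps(3) ideal_mem(3)[OF L] by blast
  have xk: "x \<otimes> k \<in> L" if x: "x \<in> \<mm>" for x
  proof -
    have "x \<otimes> k = x \<otimes> u \<ominus> x \<otimes> l" using ideal_mem(1)[OF m_ideal x] car unfolding lk(3) by algebra
    then show ?thesis using ideal_mem(4)[OF L step.hyps(4)[OF x]] ideal_mem(6)[OF L _ lk(1)] x by simp
  qed
  have "u \<in> L <+> PIdl k"
    unfolding mem_adj_iff using lk car by (metis l_one one_closed)
  moreover have "k \<in> L <+> PIdl u"
  proof -
    have "k = \<ominus> l \<oplus> \<one> \<otimes> u" using car lk(3) by (simp, algebra)
    then show ?thesis using ideal_mem(5)[OF L lk(1)] by (auto simp: mem_adj_iff)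
  qed
  ultimately have eq: "L <+> PIdl u = L <+> PIdl k"
    using adj_least[of "L <+> PIdl k" L u] adj_least[of "L <+> PIdl u" L k] adj_ideal[OF L] adj_upper[OF L]
      car step.hyps(2) by (meson subset_antisym)
  have "(L <+> PIdl u) \<inter> K = (L \<inter> K) <+> PIdl k"
  proof
    show "(L \<inter> K) <+> PIdl k \<subseteq> (L <+> PIdl u) \<inter> K"
      unfolding eq using adj_least[of "(L <+> PIdl k) \<inter> K" "L \<inter> K" k] adj_ideal[OF L] adj_upper[OF L] car lk(2)
        ideal_Int[OF _ K] by auto
    show "(L <+> PIdl u) \<inter> K \<subseteq> (L \<inter> K) <+> PIdl k"
    proof
      fix v assume v: "v \<in> (L <+> PIdl u) \<inter> K"
      then obtain b r where br: "b \<in> L" "r \<in> carrier R" "v = b \<oplus> r \<otimes> k"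
        unfolding eq by (auto simp: mem_adj_iff)
      have "b = v \<ominus> r \<otimes> k" using br car ideal_mem(1)[OF L br(1)] by (simp, algebra)
      then have "b \<in> K" using v ideal_mem(4)[OF K] ideal_mem(6)[OF K br(2) lk(2)] by simp
      then show "v \<in> (L \<inter> K) <+> PIdl k" using br by (auto simp: mem_adj_iff)
    qed
  qed
  moreover have "comp_series n ((L <+> PIdl u) \<inter> K) (M \<inter> K)"
    using step.IH K step.prems(2) add_ideal_mono[OF adj_upper(1)[OF L step.hyps(2)] subset_refl, of K] by blast
  ultimately show ?case
    using kL xk car lk(2) L K by (intro comp_series.step[of _ k]) (auto intro: ideal_Int ideal_mem(6))
qed

text \<open>If \<open>K\<close> misses the first generator \<open>u\<close>, then K + uR is one
  simple step above \<open>K\<close>, and the series from B + uR to K + uR is brought down to one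
  from \<open>B\<close> to \<open>K\<close> by intersecting with \<open>K\<close>.\<close>

lemma comp_series_split:
  assumes "comp_series n B A" "ideal K R" "B \<subseteq> K" "K \<subseteq> A"
  shows "(\<exists>n. comp_series n B K) \<and> (\<exists>n. comp_series n K A)"
  using assms
proof (induction arbitrary: K rule: comp_series.induct)
  case (refl A)
  then show ?case using comp_series.refl by (metis subset_antisym)
next
  case (step B u n A)
  note B = step.hyps(1) and K = step.prems(1)
  show ?case
  proof (cases "u \<in> K")
    case True
    then show ?thesis
      using step.IH[of K] adj_least[of K B u] K step.prems comp_series.step[OF step.hyps(1-4)] by blast
  next
    case False
    have uA: "u \<in> A" "ideal A R" using comp_series_ideals[OF step.hyps(5)] adj_upper[OF B step.hyps(2)] by auto
    have K': "ideal (K <+> PIdl u) R" "B <+> PIdl u \<subseteq> K <+> PIdl u" "K <+> PIdl u \<subseteq> A"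
      using adj_ideal[OF K step.hyps(2)] add_ideal_mono[OF step.prems(2)] adj_least[OF uA(2) step.prems(3) uA(1)] by auto
    obtain n1 n2 where n: "comp_series n1 (B <+> PIdl u) (K <+> PIdl u)" "comp_series n2 (K <+> PIdl u) A"
      using step.IH[OF K'] by blast
    have "comp_series (Suc n2) K A"
      using n(2) False step.hyps K step.prems(2) by (intro comp_series.step[of _ u]) auto
    moreover have "comp_series n1 ((B <+> PIdl u) \<inter> K) ((K <+> PIdl u) \<inter> K)"
    proof (rule comp_series_Int[OF n(1) K])
      show "K <+> PIdl u \<subseteq> (B <+> PIdl u) <+> K"
        using adj_least[of "(B <+> PIdl u) <+> K" K u] add_ideal_upper[OF adj_ideal[OF B step.hyps(2)] K]
          add_ideals[OF adj_ideal[OF B step.hyps(2)] K] adj_upper(2)[OF B step.hyps(2)] by blast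
    qed
    moreover have "(B <+> PIdl u) \<inter> K = B"
    proof
      show "(B <+> PIdl u) \<inter> K \<subseteq> B"
      proof
        fix v assume v: "v \<in> (B <+> PIdl u) \<inter> K"
        then obtain b r where br: "b \<in> B" "r \<in> carrier R" "v = b \<oplus> r \<otimes> u" by (auto simp: mem_adj_iff)
        have "r \<otimes> u = v \<ominus> b" using br step.hyps(2) ideal_mem(1)[OF B br(1)] by (simp, algebra)
        moreover have "v \<in> K" "b \<in> K" using v br(1) step.prems(2) by auto
        ultimately have "r \<otimes> u \<in> K" using ideal_mem(4)[OF K] by metis
        then have "r \<in> \<mm>" using unit_mult_mem[OF K br(2) _ step.hyps(2)] False by blast
        then show "v \<in> B" using br step.hyps(4) ideal_mem(3)[OF B] by blast
      qed
      show "B \<subseteq> (B <+> PIdl u) \<inter> K" using adj_upper(1)[OF B step.hyps(2)] step.prems(2) by blast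
    qed
    moreover have "(K <+> PIdl u) \<inter> K = K" using adj_upper(1)[OF K step.hyps(2)] by blast
    ultimately show ?thesis by metis
  qed
qed

text \<open>Multiplication by \<open>u\<close> induces an isomorphism from R/(B : u) onto (B +
  uR)/B; it carries the factors of a series above the colon ideal to factors above
  \<open>B\<close>.\<close>

lemma comp_series_scale:
  assumes "comp_series n C D" "ideal B R" "u \<in> carrier R" "colon_ideal R B {u} \<subseteq> C"
  shows "comp_series n (B <+> (\<lambda>c. c \<otimes> u) ` C) (B <+> (\<lambda>c. c \<otimes> u) ` D)"
  using assms
proof (induction rule: comp_series.induct)
  case (refl A)
  then show ?case by (intro comp_series.refl add_ideals scaled_ideal)
next
  case (step C v n D)
  note B = step.prems(1) and C = step.hyps(1) and u = step.prems(2) and v = step.hyps(2)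
  let ?S = "\<lambda>C. B <+> (\<lambda>c. c \<otimes> u) ` C"
  have mem: "x \<in> ?S E \<longleftrightarrow> (\<exists>b\<in>B. \<exists>c\<in>E. x = b \<oplus> c \<otimes> u)" for x E by (auto simp: mem_add_iff)
  have SC: "ideal (?S C) R" "ideal (?S (C <+> PIdl v)) R"
    using add_ideals scaled_ideal B C u adj_ideal[OF C v] by auto
  have vu: "v \<otimes> u \<notin> ?S C"
  proof
    assume "v \<otimes> u \<in> ?S C"
    then obtain b c where bc: "b \<in> B" "c \<in> C" "v \<otimes> u = b \<oplus> c \<otimes> u" by (auto simp: mem)
    note car = ideal_mem(1)[OF B bc(1)] ideal_mem(1)[OF C bc(2)]
    have "(v \<ominus> c) \<otimes> u = v \<otimes> u \<ominus> c \<otimes> u" using car u v by algebra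
    also have "\<dots> = b" unfolding bc(3) using car u by algebra
    finally have "v \<ominus> c \<in> C" using bc(1) step.prems(3) car v by (auto simp: colon_ideal_def)
    then have "(v \<ominus> c) \<oplus> c \<in> C" using ideal_mem(3)[OF C _ bc(2)] by blast
    moreover have "(v \<ominus> c) \<oplus> c = v" using car v by algebra
    ultimately show False using step.hyps(3) by simp
  qed
  have xvu: "x \<otimes> (v \<otimes> u) \<in> ?S C" if "x \<in> \<mm>" for x
  proof -
    have "x \<otimes> (v \<otimes> u) = \<zero> \<oplus> (x \<otimes> v) \<otimes> u"
      using ideal_mem(1)[OF m_ideal that] u v by algebra
    then show ?thesis using step.hyps(4)[OF that] ideal_mem(2)[OF B] unfolding mem by blast
  qed
  have eq: "?S C <+> PIdl (v \<otimes> u) = ?S (C <+> PIdl v)"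
  proof
    show "?S C <+> PIdl (v \<otimes> u) \<subseteq> ?S (C <+> PIdl v)"
    proof (rule adj_least[OF SC(2)])
      show "?S C \<subseteq> ?S (C <+> PIdl v)" by (intro add_ideal_mono image_mono adj_upper C v order_refl)
      show "v \<otimes> u \<in> ?S (C <+> PIdl v)"
        using ideal_mem(2)[OF B] adj_upper(2)[OF C v] u v unfolding mem by (intro bexI[of _ \<zero>] bexI[of _ v]) auto
    qed
    show "?S (C <+> PIdl v) \<subseteq> ?S C <+> PIdl (v \<otimes> u)"
    proof
      fix x assume "x \<in> ?S (C <+> PIdl v)"
      then obtain b c where bc: "b \<in> B" "c \<in> C <+> PIdl v" "x = b \<oplus> c \<otimes> u" by (auto simp: mem)
      then obtain d r where dr: "d \<in> C" "r \<in> carrier R" "c = d \<oplus> r \<otimes> v" by (auto simp: mem_adj_iff)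
      have "x = (b \<oplus> d \<otimes> u) \<oplus> r \<otimes> (v \<otimes> u)"
        unfolding bc(3) dr(3) using dr ideal_mem(1)[OF B bc(1)] ideal_mem(1)[OF C dr(1)] u v by algebra
      moreover have "b \<oplus> d \<otimes> u \<in> ?S C" using bc dr by (auto simp: mem)
      ultimately show "x \<in> ?S C <+> PIdl (v \<otimes> u)" using dr(2) by (auto simp: mem_adj_iff)
    qed
  qed
  have "colon_ideal R B {u} \<subseteq> C <+> PIdl v" using step.prems(3) adj_upper(1)[OF C v] by blast
  then have "comp_series n (?S (C <+> PIdl v)) (?S D)" using step.IH B u by blast
  then show ?case using SC(1) vu xvu u v eq by (intro comp_series.step[of _ "v \<otimes> u"]) auto
qed

text \<open>\<open>fin_len J\<close> means that R/J has finite length, and \<open>len J\<close> is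
  this length, well defined by \<open>comp_series_unique\<close>. The unit ideal is included, with
  length 0.\<close>

definition fin_len :: "'a set \<Rightarrow> bool" where "fin_len J \<longleftrightarrow> (\<exists>n. comp_series n J (carrier R))"

definition len :: "'a set \<Rightarrow> nat" where "len J = (THE n. comp_series n J (carrier R))"

lemma len_eqI: "comp_series n J (carrier R) \<Longrightarrow> len J = n"
  unfolding len_def by (rule the_equality) (auto intro: comp_series_unique)

lemma flI: "comp_series n J (carrier R) \<Longrightarrow> fin_len J"
  by (auto simp: fin_len_def)

lemma fin_len_comp_series: "fin_len J \<Longrightarrow> comp_series (len J) J (carrier R)"
  by (auto simp: fin_len_def len_eqI)

lemma fin_len_ideal: "fin_len J \<Longrightarrow> ideal J R"
  using comp_series_ideals fin_len_def by blast

lemma fin_len_carrier: "fin_len (carrier R)" and len_carrier [simp]: "len (carrier R) = 0"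
  using comp_series.refl[OF oneideal] by (auto intro: flI len_eqI)

lemma fin_len_m: "fin_len \<mm>" and len_m [simp]: "len \<mm> = 1"
proof -
  have "\<mm> <+> PIdl \<one> = carrier R"
    by (intro ideal_eq_carrier adj_ideal adj_upper m_ideal) auto
  then have "comp_series (Suc 0) \<mm> (carrier R)"
    using one_notin_m by (intro comp_series.step[of _ \<one>]) (auto intro: comp_series.refl oneideal m_ideal)
  then show "fin_len \<mm>" "len \<mm> = 1" by (auto intro: flI len_eqI)
qed

lemma fin_len_sup: "\<lbrakk>fin_len B; ideal K R; B \<subseteq> K\<rbrakk> \<Longrightarrow> fin_len K"
  using comp_series_split[of _ B "carrier R" K] ideal_mem(1)[of K] by (auto simp: fin_len_def subset_iff)

lemma fin_len_cs_between:
  assumes "fin_len B" "ideal K R" "B \<subseteq> K"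
  shows "len K \<le> len B" "comp_series (len B - len K) B K"
proof -
  obtain n where n: "comp_series n B K"
    using comp_series_split[OF fin_len_comp_series[OF assms(1)], of K] assms ideal_mem(1)[OF assms(2)] by blast
  have "comp_series (n + len K) B (carrier R)" using comp_series_trans[OF n fin_len_comp_series[OF fin_len_sup[OF assms]]] .
  then have "len B = n + len K" by (rule len_eqI)
  then show "len K \<le> len B" "comp_series (len B - len K) B K" using n by auto
qed

lemma len_mono: "\<lbrakk>fin_len B; ideal K R; B \<subseteq> K\<rbrakk> \<Longrightarrow> len K \<le> len B"
  using fin_len_cs_between(1) .

text \<open>The device that turns numerical bounds into equations between ideals: a composition
  series of length 0 has equal ends.\<close>

lemma len_eq_imp_eq: "\<lbrakk>fin_len B; ideal K R; B \<subseteq> K; len B \<le> len K\<rbrakk> \<Longrightarrow> B = K"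
  using fin_len_cs_between(2)[of B K] by (auto elim: comp_series.cases)

lemma len_pos: "\<lbrakk>fin_len B; \<one> \<notin> B\<rbrakk> \<Longrightarrow> 0 < len B"
  using fin_len_comp_series[of B] by (cases "len B") (auto elim: comp_series.cases)

text \<open>Additivity of length on 0 -> R/(B : u) -> R/B -> R/(B + uR) -> 0. Finiteness is assumed
  for the outer terms and obtained for R/B.\<close>

lemma len_adj_colon:
  assumes "ideal B R" "u \<in> carrier R" "fin_len (B <+> PIdl u)" "fin_len (colon_ideal R B {u})"
  shows "fin_len B" "len B = len (B <+> PIdl u) + len (colon_ideal R B {u})"
proof -
  have "B <+> (\<lambda>c. c \<otimes> u) ` colon_ideal R B {u} = B"
  proof
    show "B <+> (\<lambda>c. c \<otimes> u) ` colon_ideal R B {u} \<subseteq> B"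
      by (rule add_ideal_least[OF assms(1)]) (auto simp: colon_ideal_def)
    show "B \<subseteq> B <+> (\<lambda>c. c \<otimes> u) ` colon_ideal R B {u}"
      using assms by (intro add_ideal_upper scaled_ideal colon_ideal_ideal) auto
  qed
  moreover have "(\<lambda>c. c \<otimes> u) ` carrier R = PIdl u" by (auto simp: cgenideal_def)
  ultimately have "comp_series (len (colon_ideal R B {u})) B (B <+> PIdl u)"
    using comp_series_scale[OF fin_len_comp_series[OF assms(4)] assms(1,2)] by simp
  from comp_series_trans[OF this fin_len_comp_series[OF assms(3)]]
  show "fin_len B" "len B = len (B <+> PIdl u) + len (colon_ideal R B {u})"
    by (auto dest: flI len_eqI)
qed

lemma len_adj_colon':
  assumes "fin_len B" "u \<in> carrier R"
  shows "len B = len (B <+> PIdl u) + len (colon_ideal R B {u})"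
  using len_adj_colon(2)[OF fin_len_ideal[OF assms(1)] assms(2)] fin_len_sup[OF assms(1)] fin_len_ideal[OF assms(1)] assms(2)
    adj_ideal adj_upper(1) colon_ideal_ideal[of B "{u}"] colon_upper[of B "{u}"] by auto

lemma module_length_eq:
  assumes "comp_series n J (carrier R)"
  shows "Sup {enat k | k. \<exists>N. (\<forall>i\<le>k. ideal (N i) R \<and> J \<subseteq> N i) \<and> (\<forall>i<k. N i \<subset> N (Suc i))} = enat n"
proof (rule antisym)
  show "Sup {enat k | k. \<exists>N. (\<forall>i\<le>k. ideal (N i) R \<and> J \<subseteq> N i) \<and> (\<forall>i<k. N i \<subset> N (Suc i))} \<le> enat n"
  proof (rule Sup_least, clarsimp)
    fix k N assume N: "\<forall>i\<le>k. ideal (N i) R \<and> J \<subseteq> N i" "\<forall>i<k. N i \<subset> N (Suc i)"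
    have "N k \<subseteq> carrier R" using N(1) ideal_mem(1) by blast
    then show "k \<le> n" using comp_series_chain_bound[OF assms, of k N] N by auto
  qed
  obtain N where N: "\<forall>i\<le>n. ideal (N i) R" "\<forall>i<n. N i \<subset> N (Suc i)" "N 0 = J"
    using comp_series_chain[OF assms] by blast
  have "J \<subseteq> N i" if "i \<le> n" for i
    using seq_mono_upto[of n N 0 i] N(2,3) that by simp
  then show "enat n \<le> Sup {enat k | k. \<exists>N. (\<forall>i\<le>k. ideal (N i) R \<and> J \<subseteq> N i) \<and> (\<forall>i<k. N i \<subset> N (Suc i))}"
    using N by (intro Sup_upper) blast
qed

end

section \<open>Length as a supremum of chains\<close>

text \<open>The common shape of \<open>krull_dim\<close> and \<open>module_length\<close>; strictly
  monotone maps between families of sets compare these suprema.\<close>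

definition chain_sup :: "'a set set \<Rightarrow> enat" where
  "chain_sup \<S> = Sup {enat n | n. \<exists>N. (\<forall>i\<le>n. N i \<in> \<S>) \<and> (\<forall>i<n. N i \<subset> N (Suc i))}"

lemma chain_sup_le:
  assumes "\<And>A. A \<in> \<S> \<Longrightarrow> \<phi> A \<in> \<T>" "\<And>A B. \<lbrakk>A \<in> \<S>; B \<in> \<S>; A \<subset> B\<rbrakk> \<Longrightarrow> \<phi> A \<subset> \<phi> B"
  shows "chain_sup \<S> \<le> chain_sup \<T>"
  unfolding chain_sup_def
proof (rule Sup_subset_mono, clarify)
  fix n N assume N: "\<forall>i\<le>n. N i \<in> \<S>" "\<forall>i<n. N i \<subset> N (Suc i)"
  show "\<exists>m. enat n = enat m \<and> (\<exists>M. (\<forall>i\<le>m. M i \<in> \<T>) \<and> (\<forall>i<m. M i \<subset> M (Suc i)))"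
    using N assms by (intro exI[of _ n] conjI exI[of _ "\<phi> \<circ> N"]) auto
qed

lemma krull_dim_eq_chain_sup: "krull_dim R = chain_sup {P. primeideal P R}"
  by (simp add: krull_dim_def chain_sup_def)

lemma module_length_eq_chain_sup: "module_length R M = chain_sup {N. submodule N R M}"
  by (simp add: module_length_def chain_sup_def)

context cring begin

text \<open>Elements of an ideal of R/K are cosets, hence sets, so its preimage is simply its union.
  Ideals of R/K are handled through this union below.\<close>

lemma quot_preimage_eq_Union:
  assumes "ideal K R" "I \<subseteq> carrier (R Quot K)"
  shows "quot_preimage R K I = \<Union>I"
  using canonical_proj_vimage_in_carrier[OF assms] canonical_proj_vimage_mem_iff[OF assms]
  by (auto simp: quot_preimage_def)

lemma carrier_Quot: "carrier (R Quot K) = (\<lambda>a. K +> a) ` carrier R"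
  by (auto simp: FactRing_def A_RCOSETS_def')

lemma subgroup_quot_module:
  "subgroup N (add_monoid (quot_module R J)) \<longleftrightarrow> subgroup N (add_monoid (R Quot J))"
  by (simp add: subgroup_def m_inv_def)

lemma submodule_quot_iff:
  assumes "ideal J R"
  shows "submodule N R (quot_module R J) \<longleftrightarrow> ideal N (R Quot J)"
proof
  interpret J: ideal J R by fact
  interpret Q: cring "R Quot J" by (rule J.quotient_is_cring) (rule is_cring)
  {
    assume N: "submodule N R (quot_module R J)"
    interpret N: subgroup N "add_monoid (R Quot J)"
      using submodule.axioms(1)[OF N] by (simp only: subgroup_quot_module)
    show "ideal N (R Quot J)"
    proof (rule Q.idealI')
      show "N \<subseteq> carrier (R Quot J)" using N.subset by simp
      show "\<zero>\<^bsub>R Quot J\<^esub> \<in> N" using N.one_closed by simp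
      show "a \<oplus>\<^bsub>R Quot J\<^esub> b \<in> N" if "a \<in> N" "b \<in> N" for a b using N.m_closed that by simp
      show "x \<otimes>\<^bsub>R Quot J\<^esub> a \<in> N" if "x \<in> carrier (R Quot J)" "a \<in> N" for x a
        using submodule.smult_closed[OF N, of _ a] that by (auto simp: carrier_Quot)
    qed
  }
  {
    assume N: "ideal N (R Quot J)"
    interpret N: ideal N "R Quot J" by fact
    show "submodule N R (quot_module R J)"
    proof (intro submodule.intro submodule_axioms.intro)
      show "subgroup N (add_monoid (quot_module R J))"
        using N.a_subgroup by (simp only: subgroup_quot_module)
      show "a \<odot>\<^bsub>quot_module R J\<^esub> x \<in> N" if "a \<in> carrier R" "x \<in> N" for a x
        using Q.ideal_mem(6)[OF N, of "J +> a" x] that by (simp add: carrier_Quot)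
    qed
  }
qed

text \<open>The correspondence theorem in the form needed for lengths: union and image are mutually
  inverse between the two families, hence strictly monotone.\<close>

lemma quot_ideals_chain_sup:
  assumes "ideal K R" "ideal I (R Quot K)"
  shows "chain_sup {N. ideal N (R Quot K) \<and> I \<subseteq> N} = chain_sup {N. ideal N R \<and> \<Union>I \<subseteq> N}"
proof (rule antisym)
  let ?L = "{J. ideal J R \<and> K \<subseteq> J}" and ?f = "\<lambda>J. (+>) K ` J"
  interpret K: ideal K R by fact
  interpret Q: cring "R Quot K" by (rule K.quotient_is_cring) (rule is_cring)
  note bij = quot_ideal_correspondence[OF assms(1)]
  have Un: "ideal (\<Union>N) R" if "ideal N (R Quot K)" for N
    using quot_ideal_imp_ring_ideal[OF assms(1) that] .
  have im: "?f (\<Union>N) = N" if N: "ideal N (R Quot K)" for N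
  proof -
    obtain M where M: "M \<in> ?L" "N = ?f M" using bij N unfolding bij_betw_def by blast
    have "\<Union>N = M" using ideal_incl_iff[OF assms(1), of M] M by auto
    then show ?thesis using M by simp
  qed
  have im': "\<Union>(?f M) = M" if "M \<in> ?L" for M
    using ideal_incl_iff[OF assms(1), of M] that by auto
  have KI: "K \<subseteq> \<Union>I"
    using Q.ideal_mem(2)[OF assms(2)] by (auto simp: FactRing_def)
  show "chain_sup {N. ideal N (R Quot K) \<and> I \<subseteq> N} \<le> chain_sup {N. ideal N R \<and> \<Union>I \<subseteq> N}"
  proof (rule chain_sup_le[where \<phi> = Union])
    fix A B assume "A \<in> {N. ideal N (R Quot K) \<and> I \<subseteq> N}" "B \<in> {N. ideal N (R Quot K) \<and> I \<subseteq> N}" "A \<subset> B"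
    then have AB: "ideal A (R Quot K)" "ideal B (R Quot K)" "A \<subseteq> B" "A \<noteq> B" by simp_all
    have "\<Union>A \<noteq> \<Union>B" using im[OF AB(1)] im[OF AB(2)] AB(4) by metis
    then show "\<Union>A \<subset> \<Union>B" using Union_mono[OF AB(3)] by (simp add: psubset_eq)
  qed (use Un in auto)
  show "chain_sup {N. ideal N R \<and> \<Union>I \<subseteq> N} \<le> chain_sup {N. ideal N (R Quot K) \<and> I \<subseteq> N}"
  proof (rule chain_sup_le[where \<phi> = ?f])
    fix A assume A: "A \<in> {N. ideal N R \<and> \<Union>I \<subseteq> N}"
    then have "?f (\<Union>I) \<subseteq> ?f A" by (intro image_mono) auto
    then show "?f A \<in> {N. ideal N (R Quot K) \<and> I \<subseteq> N}"
      using im[OF assms(2)] ring_ideal_imp_quot_ideal[OF assms(1)] A by auto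
  next
    fix A B assume AB: "A \<in> {N. ideal N R \<and> \<Union>I \<subseteq> N}" "B \<in> {N. ideal N R \<and> \<Union>I \<subseteq> N}" "A \<subset> B"
    have L: "A \<in> ?L" "B \<in> ?L" using KI AB(1,2) by (simp_all add: subset_trans[OF KI])
    have "?f A \<noteq> ?f B" using im'[OF L(1)] im'[OF L(2)] AB(3) by (metis psubset_eq)
    then show "?f A \<subset> ?f B" using AB(3) image_mono[of A B] by (simp add: psubset_eq)
  qed
qed

lemma colength_eq:
  assumes "ideal J R"
  shows "colength R J = the_enat (chain_sup {N. ideal N R \<and> J \<subseteq> N})"
proof -
  have "\<Union>{\<zero>\<^bsub>R Quot J\<^esub>} = J" by (simp add: FactRing_def)
  moreover have "ideal {\<zero>\<^bsub>R Quot J\<^esub>} (R Quot J)"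
    using ideal.quotient_is_ring[OF assms] ring.zeroideal by blast
  moreover have "{\<zero>\<^bsub>R Quot J\<^esub>} \<subseteq> N" if "ideal N (R Quot J)" for N
    using that by (simp add: additive_subgroup.zero_closed ideal.axioms(1))
  ultimately have "{N. ideal N (R Quot J) \<and> {\<zero>\<^bsub>R Quot J\<^esub>} \<subseteq> N} = {N. ideal N (R Quot J)}"
    "chain_sup {N. ideal N (R Quot J) \<and> {\<zero>\<^bsub>R Quot J\<^esub>} \<subseteq> N} = chain_sup {N. ideal N R \<and> J \<subseteq> N}"
    using quot_ideals_chain_sup[OF assms, of "{\<zero>\<^bsub>R Quot J\<^esub>}"] by auto
  then have "chain_sup {N. ideal N (R Quot J)} = chain_sup {N. ideal N R \<and> J \<subseteq> N}" by simp
  then show ?thesis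
    by (simp add: colength_def module_length_eq_chain_sup submodule_quot_iff[OF assms])
qed

lemma colength_quot_eq:
  assumes "ideal K R" "ideal I (R Quot K)"
  shows "colength (R Quot K) I = the_enat (chain_sup {N. ideal N R \<and> \<Union>I \<subseteq> N})"
proof -
  interpret K: ideal K R by fact
  interpret Q: cring "R Quot K" by (rule K.quotient_is_cring) (rule is_cring)
  show ?thesis
    using Q.colength_eq[OF assms(2)] quot_ideals_chain_sup[OF assms] by simp
qed

end

context noetherian_local_ring begin

lemma chain_sup_len: "fin_len J \<Longrightarrow> chain_sup {N. ideal N R \<and> J \<subseteq> N} = enat (len J)"
  using module_length_eq[OF fin_len_comp_series] by (simp add: chain_sup_def)

lemma colength_eq_len: "fin_len J \<Longrightarrow> colength R J = len J"
  by (simp add: colength_eq fin_len_ideal chain_sup_len)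

lemma colength_quot_eq_len:
  assumes "ideal K R" "ideal I (R Quot K)" "fin_len (\<Union>I)"
  shows "colength (R Quot K) I = len (\<Union>I)"
  by (simp add: colength_quot_eq assms chain_sup_len)

end

section \<open>Monomial ideals\<close>

context cring begin

lemma Idl_least: "\<lbrakk>ideal K R; S \<subseteq> K\<rbrakk> \<Longrightarrow> Idl S \<subseteq> K"
  by (rule genideal_minimal)

lemma Idl_mono: "\<lbrakk>T \<subseteq> carrier R; S \<subseteq> T\<rbrakk> \<Longrightarrow> Idl S \<subseteq> Idl T"
  using genideal_self[of T] genideal_ideal[of T] by (intro Idl_least) auto

lemma Idl_insert:
  assumes "S \<subseteq> carrier R" "u \<in> carrier R"
  shows "Idl (insert u S) = Idl S <+> PIdl u"
proof
  have S: "ideal (Idl S) R" using genideal_ideal assms by blast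
  show "Idl (insert u S) \<subseteq> Idl S <+> PIdl u"
    using adj_ideal[OF S] adj_upper[OF S] genideal_self assms by (intro Idl_least) blast+
  have T: "insert u S \<subseteq> carrier R" using assms by blast
  show "Idl S <+> PIdl u \<subseteq> Idl (insert u S)"
    using genideal_self[OF T] Idl_mono[OF T] by (intro adj_least genideal_ideal T) auto
qed

lemma Idl_absorb: "ideal J R \<Longrightarrow> Idl J = J"
  using genideal_self[of J] ideal_mem(1) by (intro subset_antisym Idl_least) auto

lemma Idl_empty: "Idl {} = {\<zero>}"
  using Idl_least[OF zeroideal, of "{}"] ideal_mem(2)[OF genideal_ideal[of "{}"]] by auto

lemma binomial:
  assumes "x \<in> carrier R" "y \<in> carrier R"
  shows "(x \<oplus> y) [^] (n::nat) = (\<Oplus>k\<in>{..n}. add_pow R (n choose k) (x [^] k \<otimes> y [^] (n - k)))"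
proof (induction n)
  case 0
  then show ?case by simp
next
  case (Suc n)
  note xy = assms
  let ?t = "\<lambda>k. x [^] Suc k \<otimes> y [^] (n - k)"
  have "(x \<oplus> y) [^] Suc n = x \<otimes> (\<Oplus>k\<in>{..n}. add_pow R (n choose k) (x [^] k \<otimes> y [^] (n - k)))
      \<oplus> y \<otimes> (\<Oplus>k\<in>{..n}. add_pow R (n choose k) (x [^] k \<otimes> y [^] (n - k)))"
    unfolding Suc[symmetric] using xy by (simp add: l_distr m_comm[of _ "x \<oplus> y"])
  also have "x \<otimes> (\<Oplus>k\<in>{..n}. add_pow R (n choose k) (x [^] k \<otimes> y [^] (n - k))) = (\<Oplus>k\<in>{..n}. add_pow R (n choose k) (?t k))"
    using xy by (subst finsum_rdistr) (auto simp: add_pow_rdistr m_ac intro!: finsum_cong')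
  also have "y \<otimes> (\<Oplus>k\<in>{..n}. add_pow R (n choose k) (x [^] k \<otimes> y [^] (n - k)))
      = (\<Oplus>k\<in>{..n}. add_pow R (n choose k) (x [^] k \<otimes> y [^] (Suc n - k)))"
    using xy by (subst finsum_rdistr) (auto simp: add_pow_rdistr m_ac Suc_diff_le intro!: finsum_cong')
  also have "\<dots> = (\<Oplus>k\<in>{..Suc n}. add_pow R (n choose k) (x [^] k \<otimes> y [^] (Suc n - k)))"
    using xy by (subst finsum_Suc) (auto simp: binomial_eq_0)
  also have "\<dots> = (\<Oplus>k\<in>{..n}. add_pow R (n choose Suc k) (?t k)) \<oplus> y [^] Suc n"
    using xy by (subst finsum_Suc2) auto
  finally have "(x \<oplus> y) [^] Suc n = ((\<Oplus>k\<in>{..n}. add_pow R (n choose k) (?t k)) \<oplus> (\<Oplus>k\<in>{..n}. add_pow R (n choose Suc k) (?t k))) \<oplus> y [^] Suc n"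
    using xy by (simp add: a_assoc Pi_def)
  also have "(\<Oplus>k\<in>{..n}. add_pow R (n choose k) (?t k)) \<oplus> (\<Oplus>k\<in>{..n}. add_pow R (n choose Suc k) (?t k))
      = (\<Oplus>k\<in>{..n}. add_pow R (Suc n choose Suc k) (?t k))"
    using xy by (subst finsum_addf[symmetric]) (auto simp: add.nat_pow_mult intro!: finsum_cong')
  also have "\<dots> \<oplus> y [^] Suc n = (\<Oplus>k\<in>{..Suc n}. add_pow R (Suc n choose k) (x [^] k \<otimes> y [^] (Suc n - k)))"
    using xy by (subst finsum_Suc2) auto
  finally show ?case .
qed

fun monomial :: "'a list \<Rightarrow> nat list \<Rightarrow> 'a" where
  "monomial (x # xs) (a # as) = x [^] a \<otimes> monomial xs as"
| "monomial _ _ = \<one>"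

text \<open>\<open>D\<close> lists the exponents whose monomials are left out of the generators, so
  a smaller \<open>D\<close> gives a larger ideal. For a regular sequence and a finite
  \<open>D\<close> closed under decreasing exponents, each element of \<open>D\<close> accounts for
  one copy of R/(xs).\<close>

definition monomial_ideal :: "'a list \<Rightarrow> nat list set \<Rightarrow> 'a set" where
  "monomial_ideal xs D = Idl (monomial xs ` ({a. length a = length xs} - D))"

lemma monomial_closed [simp, intro]: "set xs \<subseteq> carrier R \<Longrightarrow> monomial xs a \<in> carrier R"
  by (induction xs a rule: monomial.induct) auto

lemma monomial_Suc:
  "\<lbrakk>set xs \<subseteq> carrier R; length a = length xs; i < length xs\<rbrakk> \<Longrightarrow>
    monomial xs (a[i := Suc (a ! i)]) = xs ! i \<otimes> monomial xs a"
proof (induction xs a arbitrary: i rule: monomial.induct)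
  case (1 x xs a as)
  show ?case
  proof (cases i)
    case 0
    then show ?thesis using 1 by (simp add: m_ac)
  next
    case (Suc j)
    have "xs ! j \<in> carrier R" using 1 Suc by (simp add: subset_iff)
    then show ?thesis using 1 Suc by (simp add: m_ac)
  qed
qed auto

lemma monomial_replicate_0: "monomial xs (replicate n 0) = \<one>"
proof (induction xs arbitrary: n)
  case (Cons x xs)
  then show ?case by (cases n) auto
qed simp

lemma monomial_single: "\<lbrakk>set xs \<subseteq> carrier R; i < length xs\<rbrakk> \<Longrightarrow> monomial xs ((replicate (length xs) 0)[i := k]) = xs ! i [^] k"
proof (induction xs arbitrary: i)
  case (Cons x xs)
  then show ?case by (cases i) (auto simp: monomial_replicate_0 subset_iff)
qed simp

lemma monomial_dvd:
  "\<lbrakk>set xs \<subseteq> carrier R; length a = length xs; i < length xs; k \<le> a ! i\<rbrakk> \<Longrightarrow>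
    monomial xs a \<in> PIdl (xs ! i [^] k)"
proof (induction xs a arbitrary: i rule: monomial.induct)
  case (1 x xs a as)
  show ?case
  proof (cases i)
    case 0
    have c: "x \<in> carrier R" "monomial xs as \<in> carrier R" using 1 by auto
    have "x [^] a = x [^] (a - k) \<otimes> x [^] k" using 0 1 by (simp add: nat_pow_mult)
    then have "x [^] a \<otimes> monomial xs as = (x [^] (a - k) \<otimes> monomial xs as) \<otimes> x [^] k"
      using c by (simp add: m_ac)
    then show ?thesis using 0 1 by (auto simp: mem_PIdl_iff)
  next
    case (Suc j)
    then have "monomial xs as \<in> PIdl (xs ! j [^] k)" "xs ! j \<in> carrier R" using 1 by (auto simp: subset_iff)
    then show ?thesis using 1 Suc ideal_mem(6)[OF cgenideal_ideal] by auto
  qed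
qed auto

lemma monomial_set_closed: "set xs \<subseteq> carrier R \<Longrightarrow> monomial xs ` A \<subseteq> carrier R"
  by auto

lemma monomial_ideal_ideal: "set xs \<subseteq> carrier R \<Longrightarrow> ideal (monomial_ideal xs D) R"
  unfolding monomial_ideal_def by (intro genideal_ideal monomial_set_closed)

lemma monomial_ideal_mem: "\<lbrakk>set xs \<subseteq> carrier R; length a = length xs; a \<notin> D\<rbrakk> \<Longrightarrow> monomial xs a \<in> monomial_ideal xs D"
  unfolding monomial_ideal_def using genideal_self[OF monomial_set_closed, of xs "{a. length a = length xs} - D"] by auto

lemma monomial_ideal_least: "\<lbrakk>ideal K R; \<And>a. \<lbrakk>length a = length xs; a \<notin> D\<rbrakk> \<Longrightarrow> monomial xs a \<in> K\<rbrakk> \<Longrightarrow> monomial_ideal xs D \<subseteq> K"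
  unfolding monomial_ideal_def by (rule Idl_least) auto

lemma monomial_ideal_empty: "set xs \<subseteq> carrier R \<Longrightarrow> monomial_ideal xs {} = carrier R"
  using monomial_ideal_mem[of xs "replicate (length xs) 0" "{}"] by (intro ideal_eq_carrier monomial_ideal_ideal) (simp_all add: monomial_replicate_0)

lemma monomial_ideal_antimono: "\<lbrakk>set xs \<subseteq> carrier R; D \<subseteq> D'\<rbrakk> \<Longrightarrow> monomial_ideal xs D' \<subseteq> monomial_ideal xs D"
  by (intro monomial_ideal_least monomial_ideal_ideal monomial_ideal_mem) auto

lemma monomial_ideal_remove:
  assumes "set xs \<subseteq> carrier R" "length a = length xs" "a \<in> D"
  shows "monomial_ideal xs (D - {a}) = monomial_ideal xs D <+> PIdl (monomial xs a)"
proof -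
  have "{b. length b = length xs} - (D - {a}) = insert a ({b. length b = length xs} - D)"
    using assms by auto
  then show ?thesis using assms by (simp add: monomial_ideal_def Idl_insert monomial_set_closed)
qed

text \<open>An exponent vector outside the box has some entry at least \<open>N ! i\<close>, so its
  monomial is a multiple of one of the listed powers.\<close>

lemma monomial_ideal_box:
  assumes "set xs \<subseteq> carrier R" "length N = length xs"
  shows "monomial_ideal xs {a. list_all2 (<) a N} = Idl (set (map2 (\<lambda>x n. x [^] n) xs N))"
proof
  have car: "set (map2 (\<lambda>x n. x [^] n) xs N) \<subseteq> carrier R"
    using assms(1) by (auto dest!: set_zip_leftD)
  have mem: "xs ! i [^] (N ! i) \<in> Idl (set (map2 (\<lambda>x n. x [^] n) xs N))" if "i < length xs" for i
    using that assms genideal_self[OF car] by (force simp: set_conv_nth)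
  show "monomial_ideal xs {a. list_all2 (<) a N} \<subseteq> Idl (set (map2 (\<lambda>x n. x [^] n) xs N))"
  proof (rule monomial_ideal_least[OF genideal_ideal[OF car]])
    fix a assume a: "length a = length xs" "a \<notin> {a. list_all2 (<) a N}"
    then obtain i where i: "i < length xs" "N ! i \<le> a ! i"
      using assms by (auto simp: list_all2_conv_all_nth not_less)
    then show "monomial xs a \<in> Idl (set (map2 (\<lambda>x n. x [^] n) xs N))"
      using monomial_dvd[OF assms(1) a(1) i] PIdl_least[OF genideal_ideal[OF car] mem[OF i(1)]] by blast
  qed
  show "Idl (set (map2 (\<lambda>x n. x [^] n) xs N)) \<subseteq> monomial_ideal xs {a. list_all2 (<) a N}"
  proof (rule Idl_least[OF monomial_ideal_ideal[OF assms(1)]], clarify)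
    fix y assume "y \<in> set (map2 (\<lambda>x n. x [^] n) xs N)"
    then obtain i where i: "i < length xs" "y = xs ! i [^] (N ! i)"
      using assms by (auto simp: set_conv_nth)
    have "\<not> list_all2 (<) ((replicate (length xs) 0)[i := N ! i]) N"
      using i assms by (auto simp: list_all2_conv_all_nth intro!: exI[of _ i])
    then show "y \<in> monomial_ideal xs {a. list_all2 (<) a N}"
      using monomial_ideal_mem[OF assms(1), of "(replicate (length xs) 0)[i := N ! i]"] i monomial_single[OF assms(1) i(1)] by auto
  qed
qed

end

lemma box_Cons: "{a. list_all2 (<) a (n # N)} = (\<lambda>(i, a). i # a) ` ({..<n} \<times> {a. list_all2 (<) a (N::nat list)})"
  by (auto simp: list_all2_Cons2 image_iff)

lemma finite_card_box: "finite {a. list_all2 (<) a (N::nat list)} \<and> card {a. list_all2 (<) a N} = prod_list N"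
proof (induction N)
  case (Cons n N)
  then show ?case
    unfolding box_Cons by (subst card_image) (auto simp: inj_on_def card_cartesian_product)
qed simp

section \<open>Lengths of monomial ideals\<close>

context noetherian_local_ring begin

text \<open>Exponents of \<open>D' - D\<close> are removed in order of decreasing total degree. For
  the removed \<open>a\<close>, raising an entry leaves \<open>D'\<close> by maximality and
  \<open>down\<close>, so the generators \<open>xs\<close> annihilate the new factor, and its length
  is at most that of R/(xs).\<close>

lemma len_monomial_ideal_bound:
  assumes xs: "set xs \<subseteq> carrier R" and J: "fin_len (Idl (set xs))" and D: "fin_len (monomial_ideal xs D)"
    and down: "\<And>a i. \<lbrakk>length a = length xs; i < length xs; a[i := Suc (a ! i)] \<in> D\<rbrakk> \<Longrightarrow> a \<in> D"
    and D': "finite (D' - D)" "D' \<subseteq> {a. length a = length xs}"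
  shows "fin_len (monomial_ideal xs D') \<and> len (monomial_ideal xs D') \<le> len (monomial_ideal xs D) + len (Idl (set xs)) * card (D' - D)"
  using D'
proof (induction "card (D' - D)" arbitrary: D')
  case 0
  then have "monomial_ideal xs D \<subseteq> monomial_ideal xs D'" by (intro monomial_ideal_antimono xs) auto
  then show ?case using len_mono[OF D monomial_ideal_ideal[OF xs]] fin_len_sup[OF D monomial_ideal_ideal[OF xs]] by (simp add: trans_le_add1)
next
  case (Suc n)
  have ne: "D' - D \<noteq> {}" using Suc(2) by (metis card.empty nat.distinct(1))
  define s where "s = Max (sum_list ` (D' - D))"
  have "s \<in> sum_list ` (D' - D)" unfolding s_def using ne Suc(3) by (intro Max_in) auto
  then obtain a where a: "a \<in> D' - D" "sum_list a = s" by auto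
  have max: "sum_list b \<le> s" if "b \<in> D' - D" for b
    unfolding s_def using that Suc(3) by (intro Max_ge) auto
  have la: "length a = length xs" using a Suc(4) by auto
  let ?D = "D' - {a}"
  have Dd: "?D - D = (D' - D) - {a}" by auto
  have n: "card (?D - D) = n" unfolding Dd using a Suc(2,3) by (simp add: card_Diff_singleton)
  have IH: "fin_len (monomial_ideal xs ?D)" "len (monomial_ideal xs ?D) \<le> len (monomial_ideal xs D) + len (Idl (set xs)) * n"
    using Suc(1)[OF n[symmetric]] Suc(3,4) n Dd by auto
  have eq: "monomial_ideal xs ?D = monomial_ideal xs D' <+> PIdl (monomial xs a)" using monomial_ideal_remove[OF xs la] a by simp
  let ?C = "colon_ideal R (monomial_ideal xs D') {monomial xs a}"
  have C: "ideal ?C R" using xs by (intro colon_ideal_ideal monomial_ideal_ideal) auto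
  have "set xs \<subseteq> ?C"
  proof
    fix x assume "x \<in> set xs"
    then obtain i where i: "i < length xs" "x = xs ! i" by (auto simp: in_set_conv_nth)
    let ?b = "a[i := Suc (a ! i)]"
    have "?b \<notin> D'"
    proof
      assume "?b \<in> D'"
      moreover have "?b \<notin> D" using down[OF la i(1)] a by blast
      ultimately have "sum_list ?b \<le> s" by (intro max) auto
      then show False using i la a by (simp add: sum_list_update)
    qed
    then have "monomial xs ?b \<in> monomial_ideal xs D'" using monomial_ideal_mem[OF xs] la by simp
    then show "x \<in> ?C" using monomial_Suc[OF xs la i(1)] i xs by (auto simp: colon_ideal_def)
  qed
  then have "Idl (set xs) \<subseteq> ?C" by (intro Idl_least C)
  then have flC: "fin_len ?C" "len ?C \<le> len (Idl (set xs))" using fin_len_sup[OF J C] len_mono[OF J C] by auto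
  have flE: "fin_len (monomial_ideal xs D' <+> PIdl (monomial xs a))" using IH(1) eq by simp
  have "fin_len (monomial_ideal xs D')" "len (monomial_ideal xs D') = len (monomial_ideal xs ?D) + len ?C"
    using len_adj_colon[OF monomial_ideal_ideal[OF xs] monomial_closed[OF xs] flE flC(1)] eq by auto
  then show ?case using IH(2) flC(2) Suc(2)[symmetric] by (simp add: algebra_simps)
qed

lemma len_monomial_ideal_le:
  assumes "set xs \<subseteq> carrier R" "fin_len (Idl (set xs))" "finite D" "D \<subseteq> {a. length a = length xs}"
  shows "fin_len (monomial_ideal xs D)" "len (monomial_ideal xs D) \<le> len (Idl (set xs)) * card D"
  using len_monomial_ideal_bound[of xs "{}" D] assms by (auto simp: monomial_ideal_empty fin_len_carrier)

text \<open>The bounds for \<open>D\<close> and for the passage from \<open>D\<close> to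
  \<open>B\<close> add up to the bound for \<open>B\<close>. The latter is attained by hypothesis,
  so both must be attained.\<close>

lemma len_monomial_ideal_eq:
  assumes "set xs \<subseteq> carrier R" "fin_len (Idl (set xs))" "finite B" "B \<subseteq> {a. length a = length xs}"
    and "len (monomial_ideal xs B) = len (Idl (set xs)) * card B" "D \<subseteq> B"
    and "\<And>a i. \<lbrakk>length a = length xs; i < length xs; a[i := Suc (a ! i)] \<in> D\<rbrakk> \<Longrightarrow> a \<in> D"
  shows "len (monomial_ideal xs D) = len (Idl (set xs)) * card D"
proof -
  have fin: "finite D" using assms finite_subset by blast
  have D: "fin_len (monomial_ideal xs D)" "len (monomial_ideal xs D) \<le> len (Idl (set xs)) * card D"
    using len_monomial_ideal_le[OF assms(1,2) fin] assms by auto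
  have "len (monomial_ideal xs B) \<le> len (monomial_ideal xs D) + len (Idl (set xs)) * card (B - D)"
    using len_monomial_ideal_bound[OF assms(1,2) D(1) assms(7)] assms(3,4) by auto
  moreover have "card B = card D + card (B - D)"
    using card_Un_disjoint[of D "B - D"] fin assms(3,6) by (simp add: Un_absorb1 finite_subset)
  ultimately show ?thesis using D(2) assms(5) by (simp add: algebra_simps)
qed

end

section \<open>Frobenius powers\<close>

context cring begin

lemma add_pow_eq_mult: "x \<in> carrier R \<Longrightarrow> add_pow R (k::nat) x = add_pow R k \<one> \<otimes> x"
  using add_pow_ldistr[of \<one> x k] by simp

lemma frobenius:
  assumes "Factorial_Ring.prime (p::nat)" "add_pow R p \<one> = \<zero>" "x \<in> carrier R" "y \<in> carrier R"
  shows "(x \<oplus> y) [^] p = x [^] p \<oplus> y [^] p"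
proof -
  have p: "p \<noteq> 0" using assms(1) by (simp add: prime_gt_0_nat)
  then obtain p' where p': "p = Suc p'" by (cases p) auto
  have zero: "add_pow R (p choose k) z = \<zero>" if zk: "z \<in> carrier R" "0 < k" "k < p" for z k
  proof -
    obtain m where m: "p choose k = p * m" using dvd_choose_prime[of k p] zk(2,3) assms(1) p by (auto simp: dvd_def)
    have "add_pow R (p * m) \<one> = add_pow R m (add_pow R p \<one>)"
      by (simp add: add.nat_pow_pow)
    then show ?thesis using zk(1) by (subst add_pow_eq_mult) (auto simp: m assms(2))
  qed
  have "(x \<oplus> y) [^] p = (\<Oplus>k\<in>{..p}. add_pow R (p choose k) (x [^] k \<otimes> y [^] (p - k)))"
    by (rule binomial) fact+
  also have "\<dots> = x [^] p \<oplus> (\<Oplus>k\<in>{..p'}. add_pow R (p choose k) (x [^] k \<otimes> y [^] (p - k)))"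
    unfolding p' using assms(3,4) by (subst finsum_Suc) auto
  also have "(\<Oplus>k\<in>{..p'}. add_pow R (p choose k) (x [^] k \<otimes> y [^] (p - k))) = (\<Oplus>k\<in>{..p'}. if k = 0 then y [^] p else \<zero>)"
    using assms(3,4) zero p' by (intro finsum_cong') auto
  also have "\<dots> = y [^] p"
    using finsum_singleton[of 0 "{..p'}" "\<lambda>_. y [^] p"] assms(4)
    by (simp add: if_distrib cong: if_cong)
  finally show ?thesis .
qed

lemma bracket_ideal: "J \<subseteq> carrier R \<Longrightarrow> ideal (bracket_power R J q) R"
  unfolding bracket_power_def by (intro genideal_ideal) auto

lemma bracket_mem: "\<lbrakk>J \<subseteq> carrier R; x \<in> J\<rbrakk> \<Longrightarrow> x [^] q \<in> bracket_power R J q"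
proof -
  assume J: "J \<subseteq> carrier R" "x \<in> J"
  have "{x [^] q |x. x \<in> J} \<subseteq> carrier R" using J by auto
  from genideal_self[OF this] show ?thesis unfolding bracket_power_def using J by blast
qed

lemma bracket_least: "\<lbrakk>ideal K R; \<And>x. x \<in> J \<Longrightarrow> x [^] q \<in> K\<rbrakk> \<Longrightarrow> bracket_power R J q \<subseteq> K"
  unfolding bracket_power_def by (rule Idl_least) auto

lemma bracket_mono: "\<lbrakk>K \<subseteq> carrier R; J \<subseteq> K\<rbrakk> \<Longrightarrow> bracket_power R J q \<subseteq> bracket_power R K q"
  using bracket_mem[of K] by (intro bracket_least bracket_ideal) auto

lemma bracket_carrier: "bracket_power R (carrier R) q = carrier R"
  using bracket_mem[of "carrier R" \<one> q] by (intro ideal_eq_carrier bracket_ideal) auto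

lemma pow_mem: "\<lbrakk>ideal K R; x \<in> K; 0 < n\<rbrakk> \<Longrightarrow> x [^] (n::nat) \<in> K"
  using ideal_mem(6)[of K "x [^] (n - 1)" x] ideal_mem(1)[of K x] by (cases n) auto

lemma bracket_subset: "\<lbrakk>ideal J R; 0 < q\<rbrakk> \<Longrightarrow> bracket_power R J q \<subseteq> J"
  using pow_mem by (intro bracket_least) auto

end

section \<open>Frobenius powers and lengths in characteristic p\<close>

locale char_p_local_ring = noetherian_local_ring +
  fixes p :: nat
  assumes p_prime: "Factorial_Ring.prime (p::nat)" and p_zero: "add_pow R p \<one> = \<zero>"
begin

lemma p_pos: "0 < p ^ e" using p_prime by (simp add: prime_gt_0_nat)

lemma frob: "\<lbrakk>x \<in> carrier R; y \<in> carrier R\<rbrakk> \<Longrightarrow> (x \<oplus> y) [^] (p ^ e) = x [^] (p ^ e) \<oplus> y [^] (p ^ e)"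
proof (induction e)
  case (Suc e)
  have pow: "z [^] (p ^ Suc e) = (z [^] (p ^ e)) [^] p" if "z \<in> carrier R" for z
    using that by (simp add: nat_pow_pow mult.commute)
  show ?case
    unfolding pow[OF Suc.prems(1)] pow[OF Suc.prems(2)] pow[OF add.m_closed[OF Suc.prems]] Suc.IH[OF Suc.prems]
    using Suc.prems by (intro frobenius[OF p_prime p_zero]) auto
qed simp

lemma frob_preimage_ideal:
  assumes "ideal K R"
  shows "ideal {x \<in> carrier R. x [^] (p ^ e) \<in> K} R"
  using ideal_mem[OF assms] p_pos[of e]
  by (intro idealI') (auto simp: frob nat_pow_distrib nat_pow_zero)

text \<open>The elements whose q-th power lies in a given ideal form an ideal, by additivity of
  Frobenius, so it suffices to raise generators.\<close>

lemma bracket_Idl: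
  assumes "S \<subseteq> carrier R"
  shows "bracket_power R (Idl S) (p ^ e) = Idl ((\<lambda>x. x [^] (p ^ e)) ` S)"
proof
  have car: "(\<lambda>x. x [^] (p ^ e)) ` S \<subseteq> carrier R" using assms by auto
  have "Idl S \<subseteq> {x \<in> carrier R. x [^] (p ^ e) \<in> Idl ((\<lambda>x. x [^] (p ^ e)) ` S)}"
    using assms genideal_self[OF car] by (intro Idl_least frob_preimage_ideal genideal_ideal car) auto
  then show "bracket_power R (Idl S) (p ^ e) \<subseteq> Idl ((\<lambda>x. x [^] (p ^ e)) ` S)"
    by (intro bracket_least genideal_ideal car) auto
  have "Idl S \<subseteq> carrier R" using ideal_mem(1)[OF genideal_ideal[OF assms]] by blast
  then show "Idl ((\<lambda>x. x [^] (p ^ e)) ` S) \<subseteq> bracket_power R (Idl S) (p ^ e)"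
    using bracket_mem[of "Idl S"] genideal_self[OF assms]
    by (intro Idl_least[OF bracket_ideal] image_subsetI) (simp, blast)
qed

lemma bracket_adj:
  assumes "ideal B R" "u \<in> carrier R"
  shows "bracket_power R (B <+> PIdl u) (p ^ e) = bracket_power R B (p ^ e) <+> PIdl (u [^] (p ^ e))"
proof -
  have car: "B \<subseteq> carrier R" using ideal_mem(1)[OF assms(1)] by blast
  have "B <+> PIdl u = Idl (insert u B)" using car assms by (simp add: Idl_insert Idl_absorb)
  moreover have "bracket_power R B (p ^ e) = Idl ((\<lambda>x. x [^] (p ^ e)) ` B)"
    using bracket_Idl[OF car, of e] by (simp add: Idl_absorb assms)
  moreover have "(\<lambda>x. x [^] (p ^ e)) ` B \<subseteq> carrier R" using car by auto
  ultimately show ?thesis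
    using bracket_Idl[of "insert u B" e] car assms(2) by (simp add: Idl_insert)
qed

lemma bracket_bracket:
  assumes "ideal J R"
  shows "bracket_power R (bracket_power R J (p ^ e)) (p ^ e') = bracket_power R J (p ^ (e + e'))"
proof -
  have car: "J \<subseteq> carrier R" using ideal_mem(1)[OF assms] by blast
  have *: "bracket_power R J (p ^ e) = Idl ((\<lambda>x. x [^] (p ^ e)) ` J)" for e
    using bracket_Idl[OF car, of e] by (simp add: Idl_absorb assms)
  have "(\<lambda>x. x [^] (p ^ e)) ` J \<subseteq> carrier R" using car by auto
  then have "bracket_power R (bracket_power R J (p ^ e)) (p ^ e') = Idl ((\<lambda>x. x [^] (p ^ e')) ` (\<lambda>x. x [^] (p ^ e)) ` J)"
    unfolding *[of e] by (rule bracket_Idl)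
  also have "(\<lambda>x. x [^] (p ^ e')) ` (\<lambda>x. x [^] (p ^ e)) ` J = (\<lambda>x. x [^] (p ^ (e + e'))) ` J"
    using car by (force simp: image_image nat_pow_pow power_add subset_iff)
  finally show ?thesis unfolding * .
qed

abbreviation mq :: "nat \<Rightarrow> 'a set" where "mq e \<equiv> bracket_power R \<mm> (p ^ e)"
definition len_mq :: "nat \<Rightarrow> nat" where "len_mq e = len (mq e)"

lemma m_carrier: "\<mm> \<subseteq> carrier R" by (rule a_subset)

lemma mq_ideal: "ideal (mq e) R" using bracket_ideal m_carrier .

text \<open>If \<mm> u lies in \<open>B\<close>, then x^q u^q lies in B^[q] for x in \<mm>. Thus
  B^[q] : u^q contains \<mm>^[q], and a simple factor turns into a factor of length at most that of
  R/\<mm>^[q].\<close>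

lemma len_bracket_comp_series:
  assumes "fin_len (mq e)" "comp_series n B A" "fin_len (bracket_power R A (p ^ e))"
  shows "fin_len (bracket_power R B (p ^ e)) \<and> len (bracket_power R B (p ^ e)) \<le> len (bracket_power R A (p ^ e)) + n * len_mq e"
  using assms(2,3)
proof (induction rule: comp_series.induct)
  case (refl A)
  then show ?case by simp
next
  case (step B u n A)
  note B = step.hyps(1) and u = step.hyps(2)
  let ?B = "bracket_power R B (p ^ e)" and ?u = "u [^] (p ^ e)"
  have Bc: "B \<subseteq> carrier R" using ideal_mem(1)[OF B] by blast
  have idB: "ideal ?B R" using bracket_ideal[OF Bc] .
  have IH: "fin_len (?B <+> PIdl ?u)" "len (?B <+> PIdl ?u) \<le> len (bracket_power R A (p ^ e)) + n * len_mq e"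
    using step.IH[OF step.prems] by (simp_all add: bracket_adj[OF B u])
  have C: "ideal (colon_ideal R ?B {?u}) R" using idB u by (intro colon_ideal_ideal) auto
  have "mq e \<subseteq> colon_ideal R ?B {?u}"
  proof (rule bracket_least[OF C])
    fix x assume x: "x \<in> \<mm>"
    then have "(x \<otimes> u) [^] (p ^ e) \<in> ?B" using bracket_mem[OF Bc step.hyps(4)] by blast
    then show "x [^] (p ^ e) \<in> colon_ideal R ?B {?u}"
      using x m_carrier u by (auto simp: colon_ideal_def nat_pow_distrib subset_iff)
  qed
  then have "fin_len (colon_ideal R ?B {?u})" "len (colon_ideal R ?B {?u}) \<le> len_mq e"
    unfolding len_mq_def using fin_len_sup[OF assms(1) C] len_mono[OF assms(1) C] by auto
  then show ?case using len_adj_colon[OF idB _ IH(1)] IH(2) u by auto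
qed

lemma len_bracket_le:
  assumes "fin_len (mq e)" "fin_len J"
  shows "fin_len (bracket_power R J (p ^ e))" "len (bracket_power R J (p ^ e)) \<le> len J * len_mq e"
  using len_bracket_comp_series[OF assms(1) fin_len_comp_series[OF assms(2)]] by (auto simp: bracket_carrier fin_len_carrier)

lemma bracket_eq_monomial_ideal:
  assumes "set xs \<subseteq> carrier R"
  shows "bracket_power R (Idl (set xs)) (p ^ e) = monomial_ideal xs {a. list_all2 (<) a (replicate (length xs) (p ^ e))}"
proof -
  have "set (map2 (\<lambda>x n. x [^] n) xs (replicate (length xs) (p ^ e))) = (\<lambda>x. x [^] (p ^ e)) ` set xs"
    by (auto simp: zip_replicate2)
  then show ?thesis using assms by (simp add: monomial_ideal_box bracket_Idl)
qed

lemma fin_len_bracket_len: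
  assumes "set xs \<subseteq> carrier R" "fin_len (Idl (set xs))"
  shows "fin_len (bracket_power R (Idl (set xs)) (p ^ e))"
    "len (bracket_power R (Idl (set xs)) (p ^ e)) \<le> len (Idl (set xs)) * (p ^ e) ^ length xs"
proof -
  let ?B = "{a. list_all2 (<) a (replicate (length xs) (p ^ e))}"
  have B: "finite ?B" "card ?B = (p ^ e) ^ length xs" "?B \<subseteq> {a. length a = length xs}"
    using finite_card_box[of "replicate (length xs) (p ^ e)"] by (auto dest: list_all2_lengthD)
  then show "fin_len (bracket_power R (Idl (set xs)) (p ^ e))"
    "len (bracket_power R (Idl (set xs)) (p ^ e)) \<le> len (Idl (set xs)) * (p ^ e) ^ length xs"
    using len_monomial_ideal_le[OF assms B(1,3)] bracket_eq_monomial_ideal[OF assms(1), of e] by auto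
qed

lemma m_gens: "\<exists>xs. set xs \<subseteq> carrier R \<and> \<mm> = Idl (set xs)"
  using finetely_gen[OF m_ideal] finite_list by metis

lemma fin_len_mq: "fin_len (mq e)"
  using m_gens fin_len_bracket_len(1) fin_len_m by metis

lemma len_mq_add: "len_mq (e + e') \<le> len_mq e * len_mq e'"
  using len_bracket_le(2)[OF fin_len_mq[of e'] fin_len_mq[of e]] bracket_bracket[OF m_ideal, of e e']
  by (simp add: len_mq_def)

lemma len_mq_0: "len_mq 0 = 1"
  using bracket_Idl[of \<mm> 0] m_carrier by (simp add: len_mq_def Idl_absorb m_ideal)

lemma len_mq_le: "\<lbrakk>set xs \<subseteq> carrier R; \<mm> = Idl (set xs)\<rbrakk> \<Longrightarrow> len_mq e \<le> (p ^ e) ^ length xs"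
  using fin_len_bracket_len(2)[of xs e] fin_len_m len_m unfolding len_mq_def by (metis mult_1)

end

section \<open>The Artin--Rees lemma\<close>

context cring begin

lemma ideal_prod_least:
  assumes "ideal K R" "\<And>x y. \<lbrakk>x \<in> I; y \<in> J\<rbrakk> \<Longrightarrow> x \<otimes> y \<in> K"
  shows "I \<cdot> J \<subseteq> K"
proof
  fix s assume "s \<in> I \<cdot> J"
  then show "s \<in> K" by (induction rule: ideal_prod.induct) (use assms ideal_mem(3)[OF assms(1)] in auto)
qed

lemma ideal_prod_mono: "\<lbrakk>I \<subseteq> I'; J \<subseteq> J'\<rbrakk> \<Longrightarrow> I \<cdot> J \<subseteq> I' \<cdot> J'"
proof
  fix s assume *: "I \<subseteq> I'" "J \<subseteq> J'" "s \<in> I \<cdot> J"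
  from *(3) show "s \<in> I' \<cdot> J'" by (induction rule: ideal_prod.induct) (use * in \<open>auto intro: ideal_prod.intros\<close>)
qed

primrec ipow :: "'a set \<Rightarrow> nat \<Rightarrow> 'a set" where
  "ipow I 0 = carrier R"
| "ipow I (Suc k) = I \<cdot> ipow I k"

lemma ipow_ideal: "ideal I R \<Longrightarrow> ideal (ipow I k) R"
  by (induction k) (auto intro: oneideal ideal_prod_is_ideal)

lemma ipow_Suc_subset: "ideal I R \<Longrightarrow> ipow I (Suc k) \<subseteq> ipow I k"
  using ideal_prod_inter[OF _ ipow_ideal] by auto

lemma ipow_antimono: "\<lbrakk>ideal I R; j \<le> k\<rbrakk> \<Longrightarrow> ipow I k \<subseteq> ipow I j"
  by (rule lift_Suc_antimono_le[of "ipow I"]) (use ipow_Suc_subset in auto)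

lemma mult_mem_ipow_Suc: "\<lbrakk>x \<in> I; y \<in> ipow I k\<rbrakk> \<Longrightarrow> x \<otimes> y \<in> ipow I (Suc k)"
  by (simp add: ideal_prod.prod)

lemma pow_mem_ipow: "\<lbrakk>x \<in> I; I \<subseteq> carrier R\<rbrakk> \<Longrightarrow> x [^] k \<in> ipow I k"
proof (induction k)
  case (Suc k)
  then have "x \<otimes> x [^] k \<in> ipow I (Suc k)" by (intro mult_mem_ipow_Suc) auto
  then show ?case using Suc.prems by (simp add: m_comm subset_iff)
qed simp

text \<open>The elements of \<open>(b + xR)\<^sup>k\<close> of degree less than \<open>j\<close> in \<open>x\<close>.\<close>

primrec low_part :: "'a set \<Rightarrow> 'a \<Rightarrow> nat \<Rightarrow> nat \<Rightarrow> 'a set" where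
  "low_part b x 0 k = {\<zero>}"
| "low_part b x (Suc j) k = low_part b x j k <+> (if j \<le> k then (\<lambda>c. c \<otimes> x [^] j) ` ipow b (k - j) else {\<zero>})"

lemma low_part_ideal: "\<lbrakk>ideal b R; x \<in> carrier R\<rbrakk> \<Longrightarrow> ideal (low_part b x j k) R"
  by (induction j) (auto intro!: zeroideal add_ideals scaled_ideal ipow_ideal)

lemma low_part_Suc_upper:
  assumes "ideal b R" "x \<in> carrier R"
  shows "low_part b x j k \<subseteq> low_part b x (Suc j) k"
    "j \<le> k \<Longrightarrow> c \<in> ipow b (k - j) \<Longrightarrow> c \<otimes> x [^] j \<in> low_part b x (Suc j) k"
proof -
  have "ideal (if j \<le> k then (\<lambda>c. c \<otimes> x [^] j) ` ipow b (k - j) else {\<zero>}) R"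
    using assms by (auto intro: zeroideal scaled_ideal ipow_ideal)
  from add_ideal_upper[OF low_part_ideal[OF assms, of j k] this]
  show "low_part b x j k \<subseteq> low_part b x (Suc j) k"
    "j \<le> k \<Longrightarrow> c \<in> ipow b (k - j) \<Longrightarrow> c \<otimes> x [^] j \<in> low_part b x (Suc j) k" by auto
qed

lemma low_part_Suc_cases:
  assumes "ideal b R" "x \<in> carrier R" "u \<in> low_part b x (Suc j) k"
  obtains "u \<in> low_part b x j k" | v c where "j \<le> k" "v \<in> low_part b x j k" "c \<in> ipow b (k - j)" "u = v \<oplus> c \<otimes> x [^] j"
proof (cases "j \<le> k")
  case True
  then show ?thesis using assms that(2) by (auto simp: mem_add_iff)
next
  case False
  then have "u \<in> low_part b x j k"
    using assms ideal_mem(1)[OF low_part_ideal[OF assms(1,2)]] by (auto simp: mem_add_iff)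
  then show ?thesis by (rule that(1))
qed

lemma low_part_mult_b:
  assumes "ideal b R" "x \<in> carrier R" "r \<in> b" "u \<in> low_part b x j k"
  shows "r \<otimes> u \<in> low_part b x j (Suc k)"
  using assms(4)
proof (induction j arbitrary: u)
  case 0
  then show ?case using ideal_mem(1)[OF assms(1,3)] by simp
next
  case (Suc j)
  note r = ideal_mem(1)[OF assms(1,3)]
  from assms(1,2) Suc.prems show ?case
  proof (cases rule: low_part_Suc_cases)
    case 1
    then show ?thesis using Suc.IH low_part_Suc_upper(1)[OF assms(1,2)] by blast
  next
    case (2 v c)
    note car = ideal_mem(1)[OF low_part_ideal[OF assms(1,2)] 2(2)] ideal_mem(1)[OF ipow_ideal[OF assms(1)] 2(3)]
    have "r \<otimes> c \<in> ipow b (Suc k - j)" using mult_mem_ipow_Suc[OF assms(3) 2(3)] 2(1) by (simp add: Suc_diff_le)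
    then have "(r \<otimes> c) \<otimes> x [^] j \<in> low_part b x (Suc j) (Suc k)"
      using low_part_Suc_upper(2)[OF assms(1,2), of j "Suc k"] 2(1) by simp
    moreover have "r \<otimes> v \<in> low_part b x (Suc j) (Suc k)"
      using Suc.IH[OF 2(2)] low_part_Suc_upper(1)[OF assms(1,2)] by blast
    moreover have "r \<otimes> u = r \<otimes> v \<oplus> (r \<otimes> c) \<otimes> x [^] j"
      using 2(4) car r assms(2) by (simp add: r_distr m_assoc)
    ultimately show ?thesis using ideal_mem(3)[OF low_part_ideal[OF assms(1,2)]] by metis
  qed
qed

lemma low_part_mult_x:
  assumes "ideal b R" "x \<in> carrier R" "u \<in> low_part b x j k"
  shows "x \<otimes> u \<in> low_part b x (Suc j) (Suc k)"
  using assms(3)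
proof (induction j arbitrary: u)
  case 0
  then show ?case using ideal_mem(2)[OF low_part_ideal[OF assms(1,2), of "Suc 0" "Suc k"]] assms(2) by (simp del: low_part.simps(2))
next
  case (Suc j)
  from assms(1,2) Suc.prems show ?case
  proof (cases rule: low_part_Suc_cases)
    case 1
    then show ?thesis using Suc.IH low_part_Suc_upper(1)[OF assms(1,2)] by blast
  next
    case (2 v c)
    note car = ideal_mem(1)[OF low_part_ideal[OF assms(1,2)] 2(2)] ideal_mem(1)[OF ipow_ideal[OF assms(1)] 2(3)]
    have "c \<otimes> x [^] Suc j \<in> low_part b x (Suc (Suc j)) (Suc k)"
      using low_part_Suc_upper(2)[OF assms(1,2), of "Suc j" "Suc k"] 2(1,3) by simp
    moreover have "x \<otimes> v \<in> low_part b x (Suc (Suc j)) (Suc k)"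
      using Suc.IH[OF 2(2)] low_part_Suc_upper(1)[OF assms(1,2)] by blast
    moreover have "x \<otimes> u = x \<otimes> v \<oplus> c \<otimes> x [^] Suc j"
      using 2(4) car assms(2) by (simp add: r_distr m_ac)
    ultimately show ?thesis using ideal_mem(3)[OF low_part_ideal[OF assms(1,2)]] by metis
  qed
qed

lemma ipow_subset_low_part:
  assumes "ideal b R" "x \<in> carrier R"
  shows "ipow (b <+> PIdl x) k \<subseteq> low_part b x (Suc k) k"
proof (induction k)
  case 0
  have "c \<in> low_part b x 1 0" if "c \<in> carrier R" for c
    using low_part_Suc_upper(2)[OF assms, of 0 0 c] that by simp
  then show ?case by auto
next
  case (Suc k)
  note lo = low_part_ideal[OF assms, of "Suc (Suc k)" "Suc k"]
  have "(b <+> PIdl x) \<cdot> ipow (b <+> PIdl x) k \<subseteq> low_part b x (Suc (Suc k)) (Suc k)"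
  proof (rule ideal_prod_least[OF lo])
    fix y z assume "y \<in> b <+> PIdl x" "z \<in> ipow (b <+> PIdl x) k"
    then obtain r s where y: "r \<in> b" "s \<in> carrier R" "y = r \<oplus> s \<otimes> x" and z: "z \<in> low_part b x (Suc k) k"
      using Suc by (auto simp: mem_adj_iff)
    note car = ideal_mem(1)[OF assms(1) y(1)] ideal_mem(1)[OF low_part_ideal[OF assms] z]
    have "r \<otimes> z \<in> low_part b x (Suc (Suc k)) (Suc k)"
      using low_part_mult_b[OF assms y(1) z] low_part_Suc_upper(1)[OF assms] by blast
    moreover have "s \<otimes> (x \<otimes> z) \<in> low_part b x (Suc (Suc k)) (Suc k)"
      using ideal_mem(6)[OF lo y(2)] low_part_mult_x[OF assms z] by blast
    moreover have "y \<otimes> z = r \<otimes> z \<oplus> s \<otimes> (x \<otimes> z)" using y car assms(2) by (simp add: l_distr m_assoc)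
    ultimately show "y \<otimes> z \<in> low_part b x (Suc (Suc k)) (Suc k)" using ideal_mem(3)[OF lo] by metis
  qed
  then show ?case by simp
qed

end

context noetherian_local_ring begin

text \<open>Noetherianity of the Rees algebra of \<open>I\<close>: the sequences \<open>a\<close> below are its homogeneous ideals.
  As in Hilbert's basis theorem, the induction step compares ideals of leading coefficients.\<close>

definition rees_ideal :: "'a set \<Rightarrow> (nat \<Rightarrow> 'a set) \<Rightarrow> bool" where
  "rees_ideal I a \<longleftrightarrow> (\<forall>k. ideal (a k) R \<and> a k \<subseteq> ipow I k \<and> I \<cdot> a k \<subseteq> a (Suc k))"

lemma rees_ideal_stable:
  assumes "set xs \<subseteq> carrier R" "rees_ideal (Idl (set xs)) a"
  shows "\<exists>c. \<forall>k\<ge>c. a (Suc k) \<subseteq> (Idl (set xs)) \<cdot> a k"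
  using assms
proof (induction xs arbitrary: a)
  case Nil
  have b: "Idl (set []) = {\<zero>}" by (simp add: Idl_empty)
  have "a (Suc k) \<subseteq> {\<zero>}" for k
  proof -
    have "{\<zero>} \<cdot> ipow {\<zero>} k \<subseteq> {\<zero>}"
      using ideal_mem(1)[OF ipow_ideal[OF zeroideal]] by (intro ideal_prod_least zeroideal) auto
    then show ?thesis using Nil(2) unfolding rees_ideal_def b by (metis ipow.simps(2) subset_trans)
  qed
  moreover have "\<zero> \<in> (Idl (set [])) \<cdot> a k" for k
    by (rule ideal_mem(2)[OF ideal_prod_is_ideal[OF genideal_ideal]]) (use Nil(2) in \<open>auto simp: rees_ideal_def\<close>)
  ultimately show ?case by blast
next
  case (Cons x xs)
  define b where "b = Idl (set xs)"
  define I where "I = Idl (set (x # xs))"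
  have x: "x \<in> carrier R" and xs: "set xs \<subseteq> carrier R" using Cons(2) by auto
  have b: "ideal b R" unfolding b_def using xs by (rule genideal_ideal)
  have I: "ideal I R" unfolding I_def using Cons(2) by (rule genideal_ideal)
  have Ieq: "I = b <+> PIdl x" unfolding I_def b_def using x xs by (simp add: Idl_insert)
  have bI: "b \<subseteq> I" "x \<in> I" using adj_upper[OF b x] by (auto simp: Ieq)
  have a: "ideal (a k) R" "a k \<subseteq> ipow I k" "I \<cdot> a k \<subseteq> a (Suc k)" for k
    using Cons(3) unfolding rees_ideal_def I_def by auto
  have aI: "r \<otimes> u \<in> a (Suc k)" if "r \<in> I" "u \<in> a k" for r u k
    using a(3) ideal_prod.prod[OF that, of R] by blast
  have Ia: "ideal (I \<cdot> a k) R" for k by (intro ideal_prod_is_ideal I a)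
  let ?low = "low_part b x"
  note lo = low_part_ideal[OF b x]
  \<comment> \<open>\<open>Lc j i\<close> collects the coefficients \<open>c\<close>, of degree
    \<open>i\<close> in \<open>b\<close>, of the top term c x^j of elements of
    \<open>a (i + j)\<close>.\<close>
  define Lc where "Lc j i = {c \<in> ipow b i. \<exists>v\<in>?low j (i + j). v \<oplus> c \<otimes> x [^] j \<in> a (i + j)}" for j i
  have xj: "x [^] j \<in> carrier R" for j :: nat using x by simp
  have bcar: "c \<in> carrier R" if "c \<in> ipow b i" for c i using ideal_mem(1)[OF ipow_ideal[OF b] that] .
  have lcar: "v \<in> carrier R" if "v \<in> ?low j k" for v j k using ideal_mem(1)[OF lo that] .
  have Lideal: "ideal (Lc j i) R" for j i
  proof (rule idealI')
    show "Lc j i \<subseteq> carrier R" using bcar by (auto simp: Lc_def)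
    show "\<zero> \<in> Lc j i"
      using ideal_mem(2)[OF ipow_ideal[OF b]] ideal_mem(2)[OF lo] ideal_mem(2)[OF a(1)] xj
      by (auto simp: Lc_def intro!: bexI[of _ \<zero>])
    fix c d assume "c \<in> Lc j i" "d \<in> Lc j i"
    then obtain v w where vw: "c \<in> ipow b i" "v \<in> ?low j (i + j)" "v \<oplus> c \<otimes> x [^] j \<in> a (i + j)"
      "d \<in> ipow b i" "w \<in> ?low j (i + j)" "w \<oplus> d \<otimes> x [^] j \<in> a (i + j)" by (auto simp: Lc_def)
    have "(v \<oplus> w) \<oplus> (c \<oplus> d) \<otimes> x [^] j = (v \<oplus> c \<otimes> x [^] j) \<oplus> (w \<oplus> d \<otimes> x [^] j)"
      using bcar[OF vw(1)] bcar[OF vw(4)] lcar[OF vw(2)] lcar[OF vw(5)] xj[of j] by algebra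
    then show "c \<oplus> d \<in> Lc j i"
      using ideal_mem(3)[OF ipow_ideal[OF b]] ideal_mem(3)[OF lo] ideal_mem(3)[OF a(1)] vw
      by (auto simp: Lc_def intro!: bexI[of _ "v \<oplus> w"])
  next
    fix r c assume r: "r \<in> carrier R" and "c \<in> Lc j i"
    then obtain v where v: "c \<in> ipow b i" "v \<in> ?low j (i + j)" "v \<oplus> c \<otimes> x [^] j \<in> a (i + j)"
      by (auto simp: Lc_def)
    have "r \<otimes> v \<oplus> (r \<otimes> c) \<otimes> x [^] j = r \<otimes> (v \<oplus> c \<otimes> x [^] j)"
      using bcar[OF v(1)] lcar[OF v(2)] xj[of j] r by algebra
    then show "r \<otimes> c \<in> Lc j i"
      using ideal_mem(6)[OF ipow_ideal[OF b] r] ideal_mem(6)[OF lo r] ideal_mem(6)[OF a(1) r] v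
      by (auto simp: Lc_def intro!: bexI[of _ "r \<otimes> v"])
  qed
  have Lmult: "r \<otimes> c \<in> Lc j (Suc i)" if r: "r \<in> b" and c: "c \<in> Lc j i" for r c i j
  proof -
    obtain v where v: "c \<in> ipow b i" "v \<in> ?low j (i + j)" "v \<oplus> c \<otimes> x [^] j \<in> a (i + j)"
      using c by (auto simp: Lc_def)
    have "r \<otimes> v \<oplus> (r \<otimes> c) \<otimes> x [^] j = r \<otimes> (v \<oplus> c \<otimes> x [^] j)"
      using bcar[OF v(1)] lcar[OF v(2)] xj[of j] ideal_mem(1)[OF b r] by algebra
    then show ?thesis
      using mult_mem_ipow_Suc[OF r v(1)] low_part_mult_b[OF b x r v(2)] aI[OF _ v(3), of r] r bI(1)
      by (auto simp: Lc_def intro!: bexI[of _ "r \<otimes> v"])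
  qed
  have Lprod: "b \<cdot> Lc j i \<subseteq> Lc j (Suc i)" for j i
    by (intro ideal_prod_least Lideal Lmult)
  have Lmono: "Lc j i \<subseteq> Lc (Suc j) i" for j i
  proof
    fix c assume "c \<in> Lc j i"
    then obtain v where v: "c \<in> ipow b i" "v \<in> ?low j (i + j)" "v \<oplus> c \<otimes> x [^] j \<in> a (i + j)"
      by (auto simp: Lc_def)
    have "x \<otimes> v \<oplus> c \<otimes> x [^] Suc j = x \<otimes> (v \<oplus> c \<otimes> x [^] j)"
      using bcar[OF v(1)] lcar[OF v(2)] xj[of j] x by (simp add: r_distr m_ac)
    then show "c \<in> Lc (Suc j) i"
      using v(1) low_part_mult_x[OF b x v(2)] aI[OF bI(2) v(3)]
      by (auto simp: Lc_def simp del: nat_pow_Suc low_part.simps intro!: bexI[of _ "x \<otimes> v"])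
  qed
  have Lmono': "Lc j i \<subseteq> Lc j' i" if "j \<le> j'" for j j' i
    by (rule lift_Suc_mono_le[of "\<lambda>j. Lc j i", OF Lmono that])
  have Lrees: "rees_ideal b (Lc j)" for j
    using Lideal Lprod by (auto simp: rees_ideal_def Lc_def)
  \<comment> \<open>Multiplication by \<open>x\<close> makes \<open>Lc j i\<close> grow with
    \<open>j\<close>. The union over \<open>j\<close> is again a homogeneous ideal over
    \<open>b\<close>, so the induction hypothesis applies to it as well.\<close>
  define Li where "Li i = (\<Union>j. Lc j i)" for i
  have Li_in: "Lc j i \<subseteq> Li i" for j i by (auto simp: Li_def)
  have stab: "\<exists>n. Li i = Lc n i" for i
  proof -
    obtain n where n: "\<And>j. j \<ge> n \<Longrightarrow> Lc j i = Lc n i"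
      using ideal_seq_stable[of "\<lambda>j. Lc j i", OF Lideal Lmono] by blast
    have "Lc j i \<subseteq> Lc n i" for j
      using n[of j] Lmono'[of j n i] by (cases "n \<le> j") auto
    then show ?thesis using Li_in by (intro exI[of _ n]) (auto simp: Li_def)
  qed
  then obtain st where st: "\<And>i. Li i = Lc (st i) i" by metis
  have "rees_ideal b Li"
    unfolding rees_ideal_def
  proof (intro allI conjI)
    fix k
    show "ideal (Li k) R" "Li k \<subseteq> ipow b k" using st Lideal by (auto simp: Lc_def)
    show "b \<cdot> Li k \<subseteq> Li (Suc k)" unfolding st[of k] using Lprod Li_in by blast
  qed
  then obtain c0 where c0: "\<And>k. k \<ge> c0 \<Longrightarrow> Li (Suc k) \<subseteq> b \<cdot> Li k"
    using Cons.IH[OF xs, of Li] b_def by blast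
  \<comment> \<open>From x-degree \<open>J\<close> on no new coefficients appear, in any degree
    \<open>i\<close>: up to \<open>c0\<close> by the choice of \<open>J\<close>, and beyond it
    because \<open>Li\<close> is generated there by multiplication by \<open>b\<close>.\<close>
  define J where "J = Max (st ` {..c0})"
  have LiJ: "Li i \<subseteq> Lc J i" for i
  proof (cases "i \<le> c0")
    case True
    then show ?thesis using Lmono'[of "st i" J i] st[of i] by (auto simp: J_def)
  next
    case False
    then have "c0 \<le> i" by simp
    then show ?thesis
    proof (induction i rule: dec_induct)
      case base
      then show ?case using Lmono'[of "st c0" J c0] st[of c0] by (auto simp: J_def)
    next
      case (step i)
      then show ?case using c0[of i] ideal_prod_mono[OF subset_refl step.IH, of b] Lprod by fastforce
    qed
  qed
  have "\<exists>c. \<forall>k\<ge>c. Lc j (Suc k) \<subseteq> b \<cdot> Lc j k" for j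
    using Cons.IH[OF xs, of "Lc j"] Lrees b_def by blast
  then obtain cj where cj: "\<And>j k. k \<ge> cj j \<Longrightarrow> Lc j (Suc k) \<subseteq> b \<cdot> Lc j k" by metis
  \<comment> \<open>A bound that works for the finitely many coefficient ideals of x-degree up to
    \<open>J\<close>.\<close>
  define C where "C = Max (cj ` {..J})"
  have C: "cj j \<le> C" if "j \<le> J" for j using that by (auto simp: C_def)
  have lift: "\<exists>v\<in>?low j (Suc i + j). v \<oplus> c \<otimes> x [^] j \<in> I \<cdot> a (i + j)" if "c \<in> b \<cdot> Lc j i" for c i j
    using that
  proof (induction rule: ideal_prod.induct)
    case (prod r c)
    then obtain v where v: "c \<in> ipow b i" "v \<in> ?low j (i + j)" "v \<oplus> c \<otimes> x [^] j \<in> a (i + j)"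
      by (auto simp: Lc_def)
    have "r \<otimes> v \<oplus> (r \<otimes> c) \<otimes> x [^] j = r \<otimes> (v \<oplus> c \<otimes> x [^] j)"
      using bcar[OF v(1)] lcar[OF v(2)] xj[of j] ideal_mem(1)[OF b prod(1)] by algebra
    then show ?case
      using ideal_prod.prod[of r I "v \<oplus> c \<otimes> x [^] j" "a (i + j)" R] low_part_mult_b[OF b x prod(1) v(2)] v(3) prod(1) bI(1)
      by (auto intro!: bexI[of _ "r \<otimes> v"])
  next
    case (sum c d)
    then obtain v w where vw: "v \<in> ?low j (Suc i + j)" "v \<oplus> c \<otimes> x [^] j \<in> I \<cdot> a (i + j)"
      "w \<in> ?low j (Suc i + j)" "w \<oplus> d \<otimes> x [^] j \<in> I \<cdot> a (i + j)" by auto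
    have "c \<in> carrier R" "d \<in> carrier R"
      using sum ideal_mem(1)[OF ideal_prod_is_ideal[OF b Lideal]] by auto
    then have "(v \<oplus> w) \<oplus> (c \<oplus> d) \<otimes> x [^] j = (v \<oplus> c \<otimes> x [^] j) \<oplus> (w \<oplus> d \<otimes> x [^] j)"
      using lcar[OF vw(1)] lcar[OF vw(3)] xj[of j] by algebra
    then show ?case
      using ideal_mem(3)[OF lo vw(1,3)] ideal_prod.sum[OF vw(2,4)] by (intro bexI[of _ "v \<oplus> w"]) simp_all
  qed
  \<comment> \<open>Induction on the x-degree: it suffices to find an element of
    \<open>I \<cdot> a k\<close> with the same top term c x^j as \<open>u\<close>, since the
    difference has smaller degree.\<close>
  have main: "u \<in> I \<cdot> a k" if k: "C + J \<le> k" and u: "u \<in> a (Suc k)" "u \<in> ?low j (Suc k)" for u j k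
    using u
  proof (induction j arbitrary: u)
    case 0
    then show ?case using ideal_mem(2)[OF Ia] by simp
  next
    case (Suc j)
    from b x Suc.prems(2) show ?case
    proof (cases rule: low_part_Suc_cases)
      case 1
      then show ?thesis using Suc by blast
    next
      case (2 v c)
      have red: ?thesis if w: "w \<in> ?low j (Suc k)" "w \<oplus> c \<otimes> x [^] j \<in> I \<cdot> a k" for w
      proof -
        have car: "c \<in> carrier R" "v \<in> carrier R" "w \<in> carrier R" using bcar[OF 2(3)] lcar w(1) 2(2) by auto
        have diff: "u \<ominus> (w \<oplus> c \<otimes> x [^] j) = v \<ominus> w" unfolding 2(4) using car xj[of j] by algebra
        have "v \<ominus> w \<in> a (Suc k)" using ideal_mem(4)[OF a(1) Suc.prems(1)] w(2) a(3) diff by (metis subsetD)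
        then have "v \<ominus> w \<in> I \<cdot> a k" using Suc.IH ideal_mem(4)[OF lo 2(2) w(1)] by blast
        then have "(v \<ominus> w) \<oplus> (w \<oplus> c \<otimes> x [^] j) \<in> I \<cdot> a k" using w(2) by (rule ideal_prod.sum)
        moreover have "(v \<ominus> w) \<oplus> (w \<oplus> c \<otimes> x [^] j) = u" unfolding 2(4) using car xj[of j] by algebra
        ultimately show ?thesis by simp
      qed
      have cL: "c \<in> Lc j (Suc k - j)" using 2 Suc.prems(1) by (auto simp: Lc_def)
      show ?thesis
      proof (cases "j \<le> J")
        case True
        \<comment> \<open>In x-degree at most \<open>J\<close> the coefficient lies in the product
          of \<open>b\<close> with the coefficient ideal one degree lower.\<close>
        define i where "i = k - j"
        have i: "Suc k - j = Suc i" "i + j = k" "cj j \<le> i"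
          unfolding i_def using k C[OF True] True by linarith+
        have "c \<in> b \<cdot> Lc j i" using cj[OF i(3)] cL unfolding i(1) by blast
        from lift[OF this] show ?thesis using red i(2) by auto
      next
        \<comment> \<open>In larger x-degree the coefficient already occurs in x-degree
          \<open>j'\<close>, one lower, and multiplication by \<open>x\<close> restores the top
          term.\<close>
        case False
        then obtain j' where j': "j = Suc j'" "J \<le> j'" by (cases j) auto
        then have i: "Suc k - j + j' = k" using 2(1) by simp
        have "c \<in> Lc j' (Suc k - j)" using cL LiJ Li_in Lmono'[OF j'(2)] by blast
        then obtain w where w: "w \<in> ?low j' k" "w \<oplus> c \<otimes> x [^] j' \<in> a k"
          unfolding Lc_def i by blast
        have "x \<otimes> w \<oplus> c \<otimes> x [^] j = x \<otimes> (w \<oplus> c \<otimes> x [^] j')"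
          using bcar[OF 2(3)] lcar[OF w(1)] xj[of j'] x j'(1) by (simp add: r_distr m_ac)
        then have "x \<otimes> w \<oplus> c \<otimes> x [^] j \<in> I \<cdot> a k" using ideal_prod.prod[OF bI(2) w(2), of R] by simp
        moreover have "x \<otimes> w \<in> ?low j (Suc k)" using low_part_mult_x[OF b x w(1)] j'(1) by simp
        ultimately show ?thesis by (intro red)
      qed
    qed
  qed
  have "a (Suc k) \<subseteq> I \<cdot> a k" if "k \<ge> C + J" for k
  proof
    fix u assume u: "u \<in> a (Suc k)"
    then have "u \<in> ?low (Suc (Suc k)) (Suc k)"
      using a(2) ipow_subset_low_part[OF b x, of "Suc k"] Ieq by blast
    then show "u \<in> I \<cdot> a k" by (rule main[OF that u])
  qed
  then show ?case unfolding I_def by blast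
qed

end

section \<open>Growth along chains of primes and Kunz's theorem\<close>

text \<open>For positive \<open>n\<close> the set of chain lengths is nonempty and bounded, so its
  supremum is one of its members. For \<open>n = 0\<close> this may fail, as the empty set also has
  supremum 0.\<close>

lemma chain_sup_attained:
  assumes "chain_sup S = enat n" "0 < n"
  shows "\<exists>N. (\<forall>i\<le>n. N i \<in> S) \<and> (\<forall>i<n. N i \<subset> N (Suc i))"
proof -
  define A where "A = {enat n | n. \<exists>N. (\<forall>i\<le>n. N i \<in> S) \<and> (\<forall>i<n. N i \<subset> N (Suc i))}"
  have Sup: "Sup A = enat n" using assms(1) by (simp add: chain_sup_def A_def)
  then have ne: "A \<noteq> {}" using assms(2) by (auto simp: Sup_enat_def zero_enat_def)
  have "finite A" using Sup ne by (auto simp: Sup_enat_def split: if_splits)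
  then have "Max A \<in> A" "Sup A = Max A" using ne by (auto simp: Sup_enat_def)
  then have "enat n \<in> A" using Sup by simp
  then show ?thesis by (auto simp: A_def)
qed

context noetherian_local_ring begin

text \<open>Stability of Rees ideals for A = P + yR gives A \<inter> \<mm>^(k+c) \<subseteq> P + y
  \<mm>^k. If z y lies in P + \<mm>^(k+c), then modulo \<open>P\<close> it equals w y with w in
  \<mm>^k, and \<open>y\<close> cancels because R/P is a domain.\<close>

lemma artin_rees_colon:
  assumes P: "primeideal P R" and y: "y \<in> carrier R" "y \<notin> P"
  shows "\<exists>c. \<forall>k. colon_ideal R (P <+> ipow \<mm> (k + c)) {y} \<subseteq> P <+> ipow \<mm> k"
proof -
  interpret P: primeideal P R by fact
  have Pi: "ideal P R" by (rule P.is_ideal)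
  define A where "A = P <+> PIdl y"
  have A: "ideal A R" unfolding A_def by (intro adj_ideal Pi y)
  note pw = ipow_ideal[OF m_ideal]
  have rees: "rees_ideal \<mm> (\<lambda>k. A \<inter> ipow \<mm> k)"
    unfolding rees_ideal_def
  proof (intro allI conjI)
    fix k
    show "ideal (A \<inter> ipow \<mm> k) R" by (intro ideal_Int A pw)
    show "\<mm> \<cdot> (A \<inter> ipow \<mm> k) \<subseteq> A \<inter> ipow \<mm> (Suc k)"
    proof (rule ideal_prod_least[OF ideal_Int[OF A pw]])
      fix r z assume "r \<in> \<mm>" "z \<in> A \<inter> ipow \<mm> k"
      then show "r \<otimes> z \<in> A \<inter> ipow \<mm> (Suc k)"
        using ideal_mem(6)[OF A ideal_mem(1)[OF m_ideal]] mult_mem_ipow_Suc by simp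
    qed
  qed auto
  obtain xs where "set xs \<subseteq> carrier R" "\<mm> = Idl (set xs)"
    using finetely_gen[OF m_ideal] finite_list by metis
  then obtain c where c: "\<And>k. k \<ge> c \<Longrightarrow> A \<inter> ipow \<mm> (Suc k) \<subseteq> \<mm> \<cdot> (A \<inter> ipow \<mm> k)"
    using rees_ideal_stable[of xs "\<lambda>k. A \<inter> ipow \<mm> k"] rees by auto
  define T where "T j = P <+> (\<lambda>z. z \<otimes> y) ` ipow \<mm> j" for j
  have T: "ideal (T j) R" for j unfolding T_def by (intro add_ideals Pi scaled_ideal pw y)
  have AT: "A \<inter> ipow \<mm> (c + j) \<subseteq> T j" for j
  proof (induction j)
    case 0
    have "(\<lambda>z. z \<otimes> y) ` carrier R = PIdl y" by (auto simp: cgenideal_def)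
    then show ?case by (simp add: T_def A_def)
  next
    case (Suc j)
    have "A \<inter> ipow \<mm> (c + Suc j) \<subseteq> \<mm> \<cdot> T j"
      using c[of "c + j"] ideal_prod_mono[OF subset_refl Suc, of \<mm>] by simp
    also have "\<mm> \<cdot> T j \<subseteq> T (Suc j)"
    proof (rule ideal_prod_least[OF T])
      fix r t assume r: "r \<in> \<mm>" and "t \<in> T j"
      then obtain a z where az: "a \<in> P" "z \<in> ipow \<mm> j" "t = a \<oplus> z \<otimes> y" by (auto simp: T_def mem_add_iff)
      have "r \<otimes> t = r \<otimes> a \<oplus> (r \<otimes> z) \<otimes> y"
        using az ideal_mem(1)[OF m_ideal r] ideal_mem(1)[OF Pi az(1)] ideal_mem(1)[OF pw az(2)] y
        by (simp add: r_distr m_assoc)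
      then show "r \<otimes> t \<in> T (Suc j)"
        using ideal_mem(6)[OF Pi ideal_mem(1)[OF m_ideal r] az(1)] mult_mem_ipow_Suc[OF r az(2)]
        unfolding T_def mem_add_iff by blast
    qed
    finally show ?case .
  qed
  have "colon_ideal R (P <+> ipow \<mm> (k + c)) {y} \<subseteq> P <+> ipow \<mm> k" for k
  proof
    fix z assume "z \<in> colon_ideal R (P <+> ipow \<mm> (k + c)) {y}"
    then obtain a u where z: "z \<in> carrier R" and au: "a \<in> P" "u \<in> ipow \<mm> (k + c)" "z \<otimes> y = a \<oplus> u"
      by (auto simp: colon_ideal_def mem_add_iff)
    note car = ideal_mem(1)[OF Pi au(1)] ideal_mem(1)[OF pw au(2)]
    have "u = \<ominus> a \<oplus> z \<otimes> y" unfolding au(3) using car by algebra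
    then have "u \<in> A" unfolding A_def mem_adj_iff using z ideal_mem(5)[OF Pi au(1)] by blast
    then have "u \<in> T k" using AT[of k] au(2) by (auto simp: add.commute)
    then obtain a' w where w: "a' \<in> P" "w \<in> ipow \<mm> k" "u = a' \<oplus> w \<otimes> y" by (auto simp: T_def mem_add_iff)
    note car' = ideal_mem(1)[OF Pi w(1)] ideal_mem(1)[OF pw w(2)]
    have "(z \<ominus> w) \<otimes> y = z \<otimes> y \<ominus> w \<otimes> y" using z car' y by algebra
    also have "\<dots> = a \<oplus> a'" unfolding au(3) w(3) using car car' y by algebra
    finally have "(z \<ominus> w) \<otimes> y \<in> P" using ideal_mem(3)[OF Pi au(1) w(1)] by simp
    then have "z \<ominus> w \<in> P" using P.I_prime[of "z \<ominus> w" y] y z car' by auto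
    moreover have "z = (z \<ominus> w) \<oplus> w" using z car' by algebra
    ultimately show "z \<in> P <+> ipow \<mm> k" using w(2) unfolding mem_add_iff by blast
  qed
  then show ?thesis by blast
qed

end

context char_p_local_ring begin

lemma le_p_power: "k \<le> p ^ k"
proof -
  have "k \<le> 2 ^ k" by (rule less_imp_le[OF less_exp])
  also have "\<dots> \<le> p ^ k" using prime_ge_2_nat[OF p_prime] by (rule power_mono) simp
  finally show ?thesis .
qed

lemma mq_subset_ipow: "k \<le> p ^ e \<Longrightarrow> mq e \<subseteq> ipow \<mm> k"
  by (rule bracket_least[OF ipow_ideal[OF m_ideal]])
    (rule subsetD[OF ipow_antimono[OF m_ideal] pow_mem_ipow[OF _ m_carrier]])

lemma fin_len_ipow: "fin_len (ipow \<mm> k)"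
  using fin_len_sup[OF fin_len_mq ipow_ideal[OF m_ideal] mq_subset_ipow[OF le_p_power]] .

lemma fin_len_add_ipow: "ideal P R \<Longrightarrow> fin_len (P <+> ipow \<mm> k)"
  using add_ideal_upper(2)[OF _ ipow_ideal[OF m_ideal]] add_ideals[OF _ ipow_ideal[OF m_ideal]] fin_len_sup[OF fin_len_ipow] by blast

text \<open>For k \<ge> K the colength of P + \<mm>^(k+c) is at least that of P' + \<mm>^K plus that
  of P + \<mm>^k: adjoining \<open>y\<close> stays inside P' + \<mm>^K, and the colon by
  \<open>y\<close> is controlled by \<open>artin_rees_colon\<close>. Iterating \<open>K\<close>
  times gains a factor \<open>K\<close>.\<close>

lemma prime_growth_step:
  assumes "primeideal P R" "ideal P' R" "P \<subset> P'"
  shows "\<exists>c. \<forall>K. K * len (P' <+> ipow \<mm> K) \<le> len (P <+> ipow \<mm> (c * K))"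
proof -
  have Pi: "ideal P R" using assms(1) primeideal.axioms(1) by blast
  obtain y where y: "y \<in> P'" "y \<notin> P" using assms(3) by blast
  have yc: "y \<in> carrier R" using ideal_mem(1)[OF assms(2) y(1)] .
  obtain c where c: "\<And>k. colon_ideal R (P <+> ipow \<mm> (k + c)) {y} \<subseteq> P <+> ipow \<mm> k"
    using artin_rees_colon[OF assms(1) yc y(2)] by blast
  have step: "len (P' <+> ipow \<mm> K) + len (P <+> ipow \<mm> k) \<le> len (P <+> ipow \<mm> (k + c))" if "K \<le> k" for K k
  proof -
    let ?B = "P <+> ipow \<mm> (k + c)"
    have B: "fin_len ?B" by (rule fin_len_add_ipow[OF Pi])
    have id: "ideal (P' <+> ipow \<mm> K) R" "ideal (P <+> ipow \<mm> k) R"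
      by (intro add_ideals assms(2) Pi ipow_ideal m_ideal)+
    have C: "ideal (colon_ideal R ?B {y}) R" using fin_len_ideal[OF B] yc by (intro colon_ideal_ideal) auto
    have flC: "fin_len (colon_ideal R ?B {y})" using fin_len_sup[OF B C] colon_upper[OF fin_len_ideal[OF B]] yc by blast
    have flBy: "fin_len (?B <+> PIdl y)" using fin_len_sup[OF B adj_ideal] adj_upper(1) fin_len_ideal[OF B] yc by blast
    have "?B \<subseteq> P' <+> ipow \<mm> K"
      using assms(3) that by (intro add_ideal_mono ipow_antimono m_ideal) auto
    moreover have "y \<in> P' <+> ipow \<mm> K" using y(1) add_ideal_upper(1)[OF assms(2) ipow_ideal[OF m_ideal]] by blast
    ultimately have "?B <+> PIdl y \<subseteq> P' <+> ipow \<mm> K" by (intro adj_least id)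
    then have "len (P' <+> ipow \<mm> K) \<le> len (?B <+> PIdl y)" by (intro len_mono flBy id)
    moreover have "len (P <+> ipow \<mm> k) \<le> len (colon_ideal R ?B {y})" by (intro len_mono flC id c)
    ultimately show ?thesis using len_adj_colon'[OF B yc] by simp
  qed
  have "j * len (P' <+> ipow \<mm> K) \<le> len (P <+> ipow \<mm> (K + j * c))" for j K
  proof (induction j)
    case (Suc j)
    then show ?case using step[of K "K + j * c"] by (simp add: algebra_simps)
  qed simp
  \<comment> \<open>The exponent K + j c with j = K explains the witness c + 1.\<close>
  then have "K * len (P' <+> ipow \<mm> K) \<le> len (P <+> ipow \<mm> ((c + 1) * K))" for K
    by (metis add.commute distrib_right mult.commute mult_1)
  then show ?thesis by blast
qed

text \<open>Each strict inclusion of primes contributes one factor \<open>K\<close>, at the price of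
  multiplying the exponent by a constant.\<close>

lemma prime_chain_growth:
  assumes "\<And>i. i \<le> n \<Longrightarrow> primeideal (P i) R" "\<And>i. i < n \<Longrightarrow> P i \<subset> P (Suc i)"
  shows "\<exists>C. \<forall>K. K ^ n * len (P n <+> ipow \<mm> K) \<le> len (P 0 <+> ipow \<mm> (C * K))"
  using assms
proof (induction n)
  case 0
  then show ?case by (intro exI[of _ 1]) simp
next
  case (Suc n)
  have "\<exists>C. \<forall>K. K ^ n * len (P n <+> ipow \<mm> K) \<le> len (P 0 <+> ipow \<mm> (C * K))"
    by (rule Suc.IH) (use Suc.prems in auto)
  then obtain C where C: "\<And>K. K ^ n * len (P n <+> ipow \<mm> K) \<le> len (P 0 <+> ipow \<mm> (C * K))"
    by blast
  obtain c where c: "\<And>K. K * len (P (Suc n) <+> ipow \<mm> K) \<le> len (P n <+> ipow \<mm> (c * K))"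
    using prime_growth_step[of "P n" "P (Suc n)", OF Suc.prems(1) primeideal.axioms(1)[OF Suc.prems(1)] Suc.prems(2)]
    by auto
  have P0: "ideal (P 0) R" using Suc.prems(1)[of 0] primeideal.axioms(1) by blast
  have "K ^ Suc n * len (P (Suc n) <+> ipow \<mm> K) \<le> len (P 0 <+> ipow \<mm> ((C * (c + 1)) * K))" for K
  proof -
    have "K ^ Suc n * len (P (Suc n) <+> ipow \<mm> K) \<le> K ^ n * len (P n <+> ipow \<mm> (c * K))"
      using c[of K] by (simp add: mult_ac mult_le_mono2)
    \<comment> \<open>Both factors are enlarged so that they are evaluated at the common argument (c
      + 1) K, where the bound for \<open>n\<close> applies.\<close>
    also have "\<dots> \<le> ((c + 1) * K) ^ n * len (P n <+> ipow \<mm> ((c + 1) * K))"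
      using Suc.prems(1)[of n] by (intro mult_le_mono power_mono len_mono fin_len_add_ipow add_ideals ipow_ideal m_ideal
          add_ideal_mono ipow_antimono) (auto dest: primeideal.axioms(1))
    also have "\<dots> \<le> len (P 0 <+> ipow \<mm> (C * ((c + 1) * K)))" by (rule C)
    finally show ?thesis by (simp only: mult.assoc)
  qed
  then show ?case by blast
qed

lemma len_mq_power: "len_mq (n * e) \<le> len_mq e ^ n"
proof (induction n)
  case (Suc n)
  have "len_mq (Suc n * e) \<le> len_mq e * len_mq (n * e)" using len_mq_add[of e "n * e"] by simp
  also have "\<dots> \<le> len_mq e ^ Suc n" using Suc by simp
  finally show ?case .
qed (simp add: len_mq_0)

lemma len_mq_pos: "1 \<le> len_mq e"
proof -
  have "\<one> \<notin> mq e" using bracket_subset[OF m_ideal p_pos] one_notin_m by blast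
  then show ?thesis using len_pos[OF fin_len_mq] by (simp add: len_mq_def Suc_le_eq)
qed

lemma len_mq_ge:
  assumes "krull_dim R = enat d"
  shows "(p ^ e) ^ d \<le> len_mq e"
proof (cases "d = 0")
  \<comment> \<open>\<open>chain_sup_attained\<close> needs positive dimension; here the claim is
    only that the length is at least 1.\<close>
  case True
  then show ?thesis using len_mq_pos by simp
next
  case False
  obtain P where P: "\<forall>i\<le>d. primeideal (P i) R" "\<forall>i<d. P i \<subset> P (Suc i)"
    using chain_sup_attained[of "{P. primeideal P R}" d] assms False by (auto simp: krull_dim_eq_chain_sup)
  obtain C where C: "\<And>K. K ^ d * len (P d <+> ipow \<mm> K) \<le> len (P 0 <+> ipow \<mm> (C * K))"
    using prime_chain_growth[of d P] P by blast
  have Pi: "ideal (P i) R" if "i \<le> d" for i using P(1) that primeideal.axioms(1) by blast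
  have "\<one> \<notin> P d"
    using primeideal.I_notcarr[of "P d" R] P(1) ideal_eq_carrier[OF Pi[of d]] by fastforce
  then have Pd: "P d \<subseteq> \<mm>" using proper_ideal_le_m Pi by blast
  have lower: "K ^ d \<le> len (ipow \<mm> (C * K))" if "K \<noteq> 0" for K
  proof -
    have "ipow \<mm> K \<subseteq> ipow \<mm> 1" using that by (intro ipow_antimono m_ideal) simp
    also have "\<dots> = \<mm>" using ideal_prod_one[OF m_ideal] by simp
    finally have "P d <+> ipow \<mm> K \<subseteq> \<mm>" using Pd by (intro add_ideal_least m_ideal)
    then have "1 \<le> len (P d <+> ipow \<mm> K)"
      using len_pos[OF fin_len_add_ipow[OF Pi[of d]]] one_notin_m by (metis One_nat_def Suc_leI order_refl subsetD)
    then have "K ^ d \<le> K ^ d * len (P d <+> ipow \<mm> K)" by simp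
    also have "\<dots> \<le> len (P 0 <+> ipow \<mm> (C * K))" by (rule C)
    also have "\<dots> \<le> len (ipow \<mm> (C * K))"
      using Pi[of 0] by (intro len_mono fin_len_ipow add_ideals add_ideal_upper ipow_ideal m_ideal) auto
    finally show ?thesis .
  qed
  \<comment> \<open>The constant \<open>C\<close> of the chain of primes is absorbed into
    \<open>C\<close> extra Frobenius steps, since C \<le> p^C. This costs only the factor
    \<open>len_mq C\<close>, which does not depend on \<open>n\<close>.\<close>
  have key: "((p ^ e) ^ d) ^ n \<le> len_mq C * len_mq e ^ n" for n
  proof -
    have "C * p ^ (n * e) \<le> p ^ (C + n * e)" using le_p_power[of C] by (simp add: power_add)
    then have "mq (C + n * e) \<subseteq> ipow \<mm> (C * p ^ (n * e))" by (rule mq_subset_ipow)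
    then have "len (ipow \<mm> (C * p ^ (n * e))) \<le> len_mq (C + n * e)"
      unfolding len_mq_def by (intro len_mono fin_len_mq ipow_ideal m_ideal)
    moreover have "((p ^ e) ^ d) ^ n = (p ^ (n * e)) ^ d" by (simp add: power_mult[symmetric] mult_ac)
    moreover have "p ^ (n * e) \<noteq> 0" using p_pos[of "n * e"] by simp
    ultimately have "((p ^ e) ^ d) ^ n \<le> len_mq (C + n * e)" using lower[of "p ^ (n * e)"] by simp
    also have "\<dots> \<le> len_mq C * len_mq (n * e)" by (rule len_mq_add)
    also have "\<dots> \<le> len_mq C * len_mq e ^ n" using len_mq_power[of n e] by simp
    finally show ?thesis .
  qed
  show ?thesis
  proof (rule ccontr)
    assume "\<not> ?thesis"
    then have lt: "len_mq e < (p ^ e) ^ d" by simp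
    have Lp: "0 < real (len_mq e)" using len_mq_pos[of e] by simp
    then have "1 < real ((p ^ e) ^ d) / real (len_mq e)" using lt by (simp add: less_divide_eq flip: of_nat_power)
    then obtain n where n: "real (len_mq C) < (real ((p ^ e) ^ d) / real (len_mq e)) ^ n"
      using real_arch_pow by blast
    then have "real (len_mq C) * real (len_mq e) ^ n < real ((p ^ e) ^ d) ^ n"
      using Lp by (simp add: power_divide less_divide_eq)
    then have "real (len_mq C * len_mq e ^ n) < real (((p ^ e) ^ d) ^ n)" by simp
    then show False using key[of n] by (metis of_nat_less_iff not_le)
  qed
qed

end

section \<open>Regular rings: exact lengths of Frobenius powers\<close>

locale regular_char_p_ring = regular_local_ring + char_p_local_ring +
  fixes d :: nat
  assumes dim: "krull_dim R = enat d"
begin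

lemma m_gens_d: "\<exists>xs. set xs \<subseteq> carrier R \<and> length xs = d \<and> \<mm> = Idl (set xs)"
  using regular dim by auto

lemma len_mq_eq: "len_mq e = (p ^ e) ^ d"
  using m_gens_d len_mq_le len_mq_ge[OF dim] by (metis le_antisym)

lemma comp_series_m_ipow: "comp_series n B A \<Longrightarrow> A = carrier R \<Longrightarrow> ipow \<mm> n \<subseteq> B"
proof (induction rule: comp_series.induct)
  case (step B u n A)
  have "\<mm> \<cdot> ipow \<mm> n \<subseteq> B"
  proof (rule ideal_prod_least[OF step.hyps(1)])
    fix x y assume x: "x \<in> \<mm>" and "y \<in> ipow \<mm> n"
    then have "y \<in> B <+> PIdl u" using step.IH[OF step.prems] by blast
    then obtain b r where br: "b \<in> B" "r \<in> carrier R" "y = b \<oplus> r \<otimes> u" by (auto simp: mem_adj_iff)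
    have "x \<otimes> y = x \<otimes> b \<oplus> r \<otimes> (x \<otimes> u)"
      using br ideal_mem(1)[OF m_ideal x] ideal_mem(1)[OF step.hyps(1) br(1)] step.hyps(2) by (simp add: r_distr m_ac)
    then show "x \<otimes> y \<in> B"
      using br ideal_mem(3,6)[OF step.hyps(1)] step.hyps(4)[OF x] ideal_mem(1)[OF m_ideal x] by metis
  qed
  then show ?case by simp
qed auto

lemma fin_len_contains_mq: "fin_len J \<Longrightarrow> \<exists>e. mq e \<subseteq> J"
  using comp_series_m_ipow[OF fin_len_comp_series HOL.refl] mq_subset_ipow[OF le_p_power] by blast

text \<open>Kunz: along a composition series from \<open>\<mm>\<^sup>[\<^sup>Q\<^sup>] \<subseteq> J\<close> to \<open>R\<close> every step contributes at most
  \<open>q\<^sup>d\<close> to \<open>\<ell>(R/\<mm>\<^sup>[\<^sup>Q\<^sup>q\<^sup>]) = Q\<^sup>d q\<^sup>d\<close>, hence exactly \<open>q\<^sup>d\<close>.\<close>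

lemma len_bracket:
  assumes J: "fin_len J"
  shows "len (bracket_power R J (p ^ e)) = len J * (p ^ e) ^ d"
proof (rule antisym)
  show "len (bracket_power R J (p ^ e)) \<le> len J * (p ^ e) ^ d"
    using len_bracket_le(2)[OF fin_len_mq J] by (simp add: len_mq_eq)
  obtain e' where e': "mq e' \<subseteq> J" using fin_len_contains_mq[OF J] by blast
  have comp_series: "comp_series (len_mq e' - len J) (mq e') J" "len J \<le> len_mq e'"
    using fin_len_cs_between[OF fin_len_mq fin_len_ideal[OF J] e'] by (auto simp: len_mq_def)
  have "len_mq (e' + e) \<le> len (bracket_power R J (p ^ e)) + (len_mq e' - len J) * len_mq e"
    using len_bracket_comp_series[OF fin_len_mq comp_series(1) len_bracket_le(1)[OF fin_len_mq J]] bracket_bracket[OF m_ideal, of e' e]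
    unfolding len_mq_def by metis
  moreover have "len_mq (e' + e) = len_mq e' * len_mq e" by (simp add: len_mq_eq power_add power_mult_distrib)
  moreover have "len_mq e' * len_mq e = len J * len_mq e + (len_mq e' - len J) * len_mq e"
    using comp_series(2) by (simp add: add_mult_distrib[symmetric])
  ultimately show "len J * (p ^ e) ^ d \<le> len (bracket_power R J (p ^ e))" by (simp add: len_mq_eq)
qed

lemma fin_len_bracket: "fin_len J \<Longrightarrow> fin_len (bracket_power R J (p ^ e))"
  using len_bracket_le(1)[OF fin_len_mq] .

text \<open>A form of Krull's height theorem obtained from Frobenius: by Kunz the length is
  multiplied by p^d, while \<open>length ys\<close> generators allow at most the factor
  \<open>p ^ length ys\<close>.\<close>

lemma length_gens_ge:
  assumes "set ys \<subseteq> carrier R" "fin_len (Idl (set ys))" "\<one> \<notin> Idl (set ys)"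
  shows "d \<le> length ys"
proof -
  have "len (Idl (set ys)) * p ^ d \<le> len (Idl (set ys)) * p ^ length ys"
    using len_bracket[OF assms(2), of 1] fin_len_bracket_len(2)[OF assms(1,2), of 1] by simp
  then have "p ^ d \<le> p ^ length ys" using len_pos[OF assms(2,3)] by simp
  then show ?thesis using power_le_imp_le_exp[of p] p_prime prime_gt_1_nat by blast
qed

end

section \<open>Powers of an element and Gorenstein duality\<close>

context cring begin

lemma pow_in_PIdl: "\<lbrakk>y \<in> carrier R; i \<le> n\<rbrakk> \<Longrightarrow> y [^] (n::nat) \<in> PIdl (y [^] (i::nat))"
  unfolding mem_PIdl_iff by (rule bexI[of _ "y [^] (n - i)"]) (auto simp: nat_pow_mult)

lemma colon_iff: "r \<in> colon_ideal R B S \<longleftrightarrow> r \<in> carrier R \<and> (\<forall>x\<in>S. r \<otimes> x \<in> B)"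
  by (auto simp: colon_ideal_def)

lemma colon_antimono: "S \<subseteq> T \<Longrightarrow> colon_ideal R B T \<subseteq> colon_ideal R B S"
  by (auto simp: colon_ideal_def)

lemma colon_Idl:
  assumes "ideal B R" "S \<subseteq> carrier R"
  shows "colon_ideal R B (Idl S) = colon_ideal R B S"
proof
  show "colon_ideal R B (Idl S) \<subseteq> colon_ideal R B S" by (rule colon_antimono[OF genideal_self[OF assms(2)]])
  show "colon_ideal R B S \<subseteq> colon_ideal R B (Idl S)"
  proof
    fix r assume r: "r \<in> colon_ideal R B S"
    then have rc: "r \<in> carrier R" by (simp add: colon_iff)
    have "Idl S \<subseteq> colon_ideal R B {r}"
      using r assms rc by (intro Idl_least colon_ideal_ideal) (auto simp: colon_iff m_comm subset_iff)
    then show "r \<in> colon_ideal R B (Idl S)" using rc ideal_mem(1)[OF genideal_ideal[OF assms(2)]]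
      by (auto simp: colon_iff m_comm subset_iff)
  qed
qed

end

context noetherian_local_ring begin

lemma adj_pow_adj:
  assumes "ideal B R" "y \<in> carrier R" "i \<le> n"
  shows "(B <+> PIdl (y [^] n)) <+> PIdl (y [^] i) = B <+> PIdl (y [^] (i::nat))"
proof
  have c: "y [^] n \<in> carrier R" "y [^] i \<in> carrier R" using assms by auto
  note i = adj_ideal[OF assms(1) c(2)] adj_ideal[OF assms(1) c(1)]
  note up = adj_upper[OF assms(1) c(2)] adj_upper[OF i(2) c(2)] adj_upper(1)[OF assms(1) c(1)]
  show "(B <+> PIdl (y [^] n)) <+> PIdl (y [^] i) \<subseteq> B <+> PIdl (y [^] i)"
    using up pow_in_PIdl[OF assms(2,3)] PIdl_least[OF i(1) up(2)] by (intro adj_least i) auto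
  show "B <+> PIdl (y [^] i) \<subseteq> (B <+> PIdl (y [^] n)) <+> PIdl (y [^] i)"
    using up by (intro adj_least adj_ideal i c) auto
qed

lemma adj_colon_pow:
  assumes "ideal B R" "y \<in> carrier R" "i \<le> n"
  shows "B <+> PIdl (y [^] (n - i)) \<subseteq> colon_ideal R (B <+> PIdl (y [^] n)) {y [^] (i::nat)}"
proof -
  have c: "y [^] n \<in> carrier R" "y [^] i \<in> carrier R" "y [^] (n - i) \<in> carrier R" using assms by auto
  have X: "ideal (B <+> PIdl (y [^] n)) R" by (intro adj_ideal assms c)
  have "B \<subseteq> colon_ideal R (B <+> PIdl (y [^] n)) {y [^] i}"
    using adj_upper(1)[OF assms(1) c(1)] colon_upper[OF X, of "{y [^] i}"] c by auto
  moreover have "y [^] (n - i) \<otimes> y [^] i = y [^] n" using assms by (simp add: nat_pow_mult)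
  then have "y [^] (n - i) \<in> colon_ideal R (B <+> PIdl (y [^] n)) {y [^] i}"
    using adj_upper(2)[OF assms(1) c(1)] c by (simp add: colon_iff)
  ultimately show ?thesis using c by (intro adj_least colon_ideal_ideal X) auto
qed

text \<open>Filter R/(B + y^n R) by powers of \<open>y\<close>: each factor is cyclic and killed by
  \<open>B\<close> and \<open>y\<close>.\<close>

lemma len_adj_pow_le:
  assumes "ideal B R" "y \<in> carrier R" "fin_len (B <+> PIdl y)"
  shows "fin_len (B <+> PIdl (y [^] n)) \<and> len (B <+> PIdl (y [^] n)) \<le> n * len (B <+> PIdl y)"
proof (induction n)
  case 0
  have "B <+> PIdl \<one> = carrier R" by (intro ideal_eq_carrier adj_ideal adj_upper assms) auto
  then show ?case by (simp add: fin_len_carrier)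
next
  case (Suc n)
  let ?X = "B <+> PIdl (y [^] Suc n)"
  have yn: "y [^] n \<in> carrier R" "y [^] Suc n \<in> carrier R" using assms by auto
  have X: "ideal ?X R" by (rule adj_ideal[OF assms(1) yn(2)])
  have C: "ideal (colon_ideal R ?X {y [^] n}) R" using X yn by (intro colon_ideal_ideal) auto
  have sub: "B <+> PIdl y \<subseteq> colon_ideal R ?X {y [^] n}"
    using adj_colon_pow[OF assms(1,2), of n "Suc n"] assms(2) by simp
  have eq: "?X <+> PIdl (y [^] n) = B <+> PIdl (y [^] n)" by (rule adj_pow_adj[OF assms(1,2)]) simp
  show ?case
    using len_adj_colon[OF X yn(1), unfolded eq] Suc fin_len_sup[OF assms(3) C sub] len_mono[OF assms(3) C sub] by simp
qed

text \<open>Extremal total length forces every factor of the filtration by powers of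
  \<open>y\<close> to be as large as possible. The annihilator formula then holds as it would for a
  nonzerodivisor \<open>y\<close> modulo \<open>B\<close>.\<close>

lemma adj_pow_extremal:
  assumes "ideal B R" "y \<in> carrier R" "fin_len (B <+> PIdl y)"
    and eq: "len (B <+> PIdl (y [^] n)) = n * len (B <+> PIdl y)" and i: "i \<le> n"
  shows "len (B <+> PIdl (y [^] i)) = i * len (B <+> PIdl y)"
    "colon_ideal R (B <+> PIdl (y [^] n)) {y [^] i} = B <+> PIdl (y [^] (n - i))"
proof -
  let ?X = "B <+> PIdl (y [^] n)"
  note bound = len_adj_pow_le[OF assms(1-3)]
  have yi: "y [^] i \<in> carrier R" using assms by auto
  have X: "fin_len ?X" using bound by blast
  have C: "ideal (colon_ideal R ?X {y [^] i}) R" using fin_len_ideal[OF X] yi by (intro colon_ideal_ideal) auto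
  note sub = adj_colon_pow[OF assms(1,2) i]
  have 1: "len ?X = len (B <+> PIdl (y [^] i)) + len (colon_ideal R ?X {y [^] i})"
    using len_adj_colon'[OF X yi] adj_pow_adj[OF assms(1,2) i] by simp
  have fin_len: "fin_len (B <+> PIdl (y [^] (n - i)))" using bound by blast
  have 2: "len (colon_ideal R ?X {y [^] i}) \<le> len (B <+> PIdl (y [^] (n - i)))" by (rule len_mono[OF fin_len C sub])
  have 3: "n * len (B <+> PIdl y) = i * len (B <+> PIdl y) + (n - i) * len (B <+> PIdl y)"
    using i by (simp add: add_mult_distrib[symmetric])
  have 4: "len (B <+> PIdl (y [^] i)) \<le> i * len (B <+> PIdl y)"
    "len (B <+> PIdl (y [^] (n - i))) \<le> (n - i) * len (B <+> PIdl y)" using bound by blast+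
  show "len (B <+> PIdl (y [^] i)) = i * len (B <+> PIdl y)" using 1 2 3 4 eq by linarith
  have "len (B <+> PIdl (y [^] (n - i))) \<le> len (colon_ideal R ?X {y [^] i})" using 1 2 3 4 eq by linarith
  then show "colon_ideal R ?X {y [^] i} = B <+> PIdl (y [^] (n - i))"
    using len_eq_imp_eq[OF fin_len C sub] by simp
qed

text \<open>For \<open>B\<close> of finite colength, \<open>R/B\<close> is Gorenstein iff its socle is one-dimensional.\<close>

definition gorenstein :: "'a set \<Rightarrow> bool" where
  "gorenstein B \<longleftrightarrow> (\<exists>s\<in>carrier R. s \<notin> B \<and> colon_ideal R B \<mm> = B <+> PIdl s)"

lemma gorenstein_m: "gorenstein \<mm>"
proof -
  have "colon_ideal R \<mm> \<mm> = carrier R" using ideal_mem(6)[OF m_ideal] by (auto simp: colon_iff)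
  moreover have "\<mm> <+> PIdl \<one> = carrier R"
    by (intro ideal_eq_carrier adj_ideal adj_upper m_ideal) auto
  ultimately show ?thesis using one_notin_m unfolding gorenstein_def by (intro bexI[of _ \<one>]) auto
qed

text \<open>The socle of R/(B + y^n R) is killed by \<open>y\<close>, hence lies in the multiples of
  y^(n-1). These form a copy of R/(B + yR) by \<open>adj_pow_extremal\<close>, so the socle of the
  latter is carried onto it.\<close>

lemma gorenstein_adj_pow:
  assumes B: "ideal B R" and y: "y \<in> \<mm>" and flY: "fin_len (B <+> PIdl y)"
    and eq: "len (B <+> PIdl (y [^] n)) = n * len (B <+> PIdl y)" and n: "0 < n"
    and g: "gorenstein (B <+> PIdl y)"
  shows "gorenstein (B <+> PIdl (y [^] n))"
proof -
  let ?X = "B <+> PIdl (y [^] n)" and ?Y = "B <+> PIdl y" and ?z = "y [^] (n - 1)"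
  obtain s where s: "s \<in> carrier R" "s \<notin> ?Y" "colon_ideal R ?Y \<mm> = ?Y <+> PIdl s"
    using g by (auto simp: gorenstein_def)
  have yc: "y \<in> carrier R" using ideal_mem(1)[OF m_ideal y] .
  then have zc: "?z \<in> carrier R" "y [^] n \<in> carrier R" by auto
  have X: "ideal ?X R" by (rule adj_ideal[OF B zc(2)])
  have Y: "ideal ?Y R" by (rule adj_ideal[OF B yc])
  have cz: "colon_ideal R ?X {?z} = ?Y"
    using adj_pow_extremal(2)[OF B yc flY eq, of "n - 1"] n yc by simp
  have cy: "colon_ideal R ?X {y} = B <+> PIdl ?z"
    using adj_pow_extremal(2)[OF B yc flY eq, of 1] n yc by simp
  have memY: "w \<in> ?Y \<longleftrightarrow> w \<in> carrier R \<and> w \<otimes> ?z \<in> ?X" for w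
    unfolding cz[symmetric] by (simp add: colon_iff)
  have "s \<otimes> ?z \<notin> ?X" using memY[of s] s by blast
  moreover have "colon_ideal R ?X \<mm> = ?X <+> PIdl (s \<otimes> ?z)"
  proof
    show "?X <+> PIdl (s \<otimes> ?z) \<subseteq> colon_ideal R ?X \<mm>"
    proof (rule adj_least[OF colon_ideal_ideal[OF X a_subset] colon_upper[OF X a_subset]])
      have "(s \<otimes> ?z) \<otimes> x \<in> ?X" if "x \<in> \<mm>" for x
      proof -
        have xc: "x \<in> carrier R" using that ideal_mem(1)[OF m_ideal] by blast
        have "s \<in> colon_ideal R ?Y \<mm>" using adj_upper(2)[OF Y s(1)] s(3) by simp
        then have "s \<otimes> x \<in> ?Y" using that by (simp add: colon_iff)
        then have "(s \<otimes> x) \<otimes> ?z \<in> ?X" using memY by blast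
        then show ?thesis using s(1) xc zc by (simp add: m_ac)
      qed
      then show "s \<otimes> ?z \<in> colon_ideal R ?X \<mm>" using s(1) zc by (simp add: colon_iff)
    qed
    show "colon_ideal R ?X \<mm> \<subseteq> ?X <+> PIdl (s \<otimes> ?z)"
    proof
      fix v assume v: "v \<in> colon_ideal R ?X \<mm>"
      then have "v \<in> colon_ideal R ?X {y}" using y by (simp add: colon_iff)
      then obtain b w where bw: "b \<in> B" "w \<in> carrier R" "v = b \<oplus> w \<otimes> ?z" unfolding cy by (auto simp: mem_adj_iff)
      have bX: "b \<in> ?X" using bw(1) adj_upper(1)[OF B zc(2)] by blast
      have bc: "b \<in> carrier R" using ideal_mem(1)[OF B bw(1)] .
      have "w \<in> colon_ideal R ?Y \<mm>"
      proof -
        have "w \<otimes> x \<in> ?Y" if x: "x \<in> \<mm>" for x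
        proof -
          have xc: "x \<in> carrier R" using x ideal_mem(1)[OF m_ideal] by blast
          have "(w \<otimes> x) \<otimes> ?z = v \<otimes> x \<ominus> b \<otimes> x" unfolding bw(3) using bw(2) bc xc zc by algebra
          moreover have "v \<otimes> x \<in> ?X" using v x by (simp add: colon_iff)
          ultimately have "(w \<otimes> x) \<otimes> ?z \<in> ?X" using ideal_mem(4,7)[OF X] bX xc by simp
          then show ?thesis using memY bw(2) xc by simp
        qed
        then show ?thesis using bw(2) by (simp add: colon_iff)
      qed
      then obtain y0 r where yr: "y0 \<in> ?Y" "r \<in> carrier R" "w = y0 \<oplus> r \<otimes> s"
        unfolding s(3) mem_adj_iff[of w ?Y] by blast
      have y0: "y0 \<in> carrier R" "y0 \<otimes> ?z \<in> ?X" using yr(1) memY by auto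
      have "v = (b \<oplus> y0 \<otimes> ?z) \<oplus> r \<otimes> (s \<otimes> ?z)"
        unfolding bw(3) yr(3) using y0 yr(2) s(1) zc(1) bc by algebra
      then show "v \<in> ?X <+> PIdl (s \<otimes> ?z)"
        using ideal_mem(3)[OF X bX y0(2)] yr(2) unfolding mem_adj_iff[of _ ?X] by blast
    qed
  qed
  ultimately show ?thesis using s(1) zc unfolding gorenstein_def by (intro bexI[of _ "s \<otimes> ?z"]) auto
qed

abbreviation pows :: "'a list \<Rightarrow> nat list \<Rightarrow> 'a set" where
  "pows ys N \<equiv> set (map2 (\<lambda>y n. y [^] n) ys N)"

lemma pows_carrier: "set ys \<subseteq> carrier R \<Longrightarrow> pows ys N \<subseteq> carrier R"
  by (auto dest!: set_zip_leftD)

text \<open>\<open>S\<close> collects the elements already raised to their powers, so the generators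
  can be treated one at a time.\<close>

lemma len_pows_le:
  assumes "S \<subseteq> carrier R" "set ys \<subseteq> carrier R" "length N = length ys" "fin_len (Idl (S \<union> set ys))"
  shows "fin_len (Idl (S \<union> pows ys N)) \<and> len (Idl (S \<union> pows ys N)) \<le> prod_list N * len (Idl (S \<union> set ys))"
  using assms
proof (induction ys arbitrary: S N)
  case Nil
  then show ?case by simp
next
  case (Cons y ys)
  then obtain n N' where N: "N = n # N'" "length N' = length ys" by (cases N) auto
  have y: "y \<in> carrier R" "y [^] n \<in> carrier R" using Cons.prems by auto
  have c: "S \<union> set ys \<subseteq> carrier R" using Cons.prems by auto
  have Sy: "S \<union> set (y # ys) = insert y (S \<union> set ys)" "insert (y [^] n) S \<union> set ys = insert (y [^] n) (S \<union> set ys)"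
    "S \<union> pows (y # ys) N = insert (y [^] n) S \<union> pows ys N'" by (auto simp: N)
  have "fin_len (Idl (insert (y [^] n) S \<union> set ys)) \<and> len (Idl (insert (y [^] n) S \<union> set ys)) \<le> n * len (Idl (S \<union> set (y # ys)))"
    using len_adj_pow_le[OF genideal_ideal[OF c] y(1), of n] Cons.prems(4)
    unfolding Sy Idl_insert[OF c y(1)] Idl_insert[OF c y(2)] by blast
  moreover have "fin_len (Idl (insert (y [^] n) S \<union> pows ys N')) \<and> len (Idl (insert (y [^] n) S \<union> pows ys N'))
      \<le> prod_list N' * len (Idl (insert (y [^] n) S \<union> set ys))"
    using calculation y(2) Cons.prems by (intro Cons.IH N(2)) auto
  ultimately show ?case
    unfolding Sy(3) using mult_le_mono2[of _ _ "prod_list N'"] by (fastforce simp: N(1) mult_ac intro: order_trans)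
qed

text \<open>The total length is extremal, so every intermediate exchange of \<open>y\<close> for its
  power must be extremal too, and \<open>gorenstein_adj_pow\<close> applies at each stage.\<close>

lemma gorenstein_pows:
  assumes "S \<subseteq> carrier R" "set ys \<subseteq> \<mm>" "length N = length ys" "0 \<notin> set N" "fin_len (Idl (S \<union> set ys))"
    and "len (Idl (S \<union> pows ys N)) = prod_list N * len (Idl (S \<union> set ys))"
    and "gorenstein (Idl (S \<union> set ys))"
  shows "gorenstein (Idl (S \<union> pows ys N))"
  using assms
proof (induction ys arbitrary: S N)
  case Nil
  then show ?case by simp
next
  case (Cons y ys)
  then obtain n N' where N: "N = n # N'" "length N' = length ys" by (cases N) auto
  have ys: "set ys \<subseteq> carrier R" using Cons.prems(2) a_subset by auto
  have y: "y \<in> \<mm>" "y \<in> carrier R" "y [^] n \<in> carrier R" using Cons.prems by auto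
  have c: "S \<union> set ys \<subseteq> carrier R" "insert (y [^] n) S \<subseteq> carrier R" using Cons.prems ys y by auto
  have Sy: "S \<union> set (y # ys) = insert y (S \<union> set ys)" "insert (y [^] n) S \<union> set ys = insert (y [^] n) (S \<union> set ys)"
    "S \<union> pows (y # ys) N = insert (y [^] n) S \<union> pows ys N'" by (auto simp: N)
  define e where "e = len (Idl (S \<union> set (y # ys)))"
  define e1 where "e1 = len (Idl (insert (y [^] n) S \<union> set ys))"
  note adj = Idl_insert[OF c(1) y(2)] Idl_insert[OF c(1) y(3)]
  have fly: "fin_len (Idl (S \<union> set ys) <+> PIdl y)" using Cons.prems(5) unfolding Sy adj .
  have 1: "fin_len (Idl (insert (y [^] n) S \<union> set ys))" "e1 \<le> n * e"
    using len_adj_pow_le[OF genideal_ideal[OF c(1)] y(2) fly, of n] unfolding e_def e1_def Sy adj by auto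
  have 2: "len (Idl (insert (y [^] n) S \<union> pows ys N')) \<le> prod_list N' * e1"
    unfolding e1_def using len_pows_le[OF c(2) ys N(2) 1(1)] by blast
  have 3: "len (Idl (insert (y [^] n) S \<union> pows ys N')) = prod_list N' * (n * e)"
    using Cons.prems(6) unfolding Sy(3) e_def by (simp add: N mult_ac)
  have "prod_list N' \<noteq> 0" "0 < n" using Cons.prems(4) by (auto simp: N prod_list_zero_iff)
  then have 4: "e1 = n * e" using 1(2) 2 unfolding 3 by simp
  have "gorenstein (Idl (insert (y [^] n) S \<union> set ys))"
    using gorenstein_adj_pow[OF genideal_ideal[OF c(1)] y(1) fly _ \<open>0 < n\<close>] Cons.prems(7) 4
    unfolding e_def e1_def Sy adj by blast
  then show ?case
    unfolding Sy(3) using Cons.prems N 1(1) c(2) 3 4 unfolding e1_def by (intro Cons.IH) auto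
qed

text \<open>Enlarging \<open>K\<close> by a simple step costs the annihilator at most one: v
  \<mapsto> v u embeds (B : K)/(B : (K + uR)) into the socle of R/B, which is
  one-dimensional.\<close>

lemma gorenstein_dual_comp_series:
  assumes "comp_series n K A" "fin_len B" "gorenstein B" "B \<subseteq> K"
  shows "len (colon_ideal R B A) \<le> len (colon_ideal R B K) + n"
  using assms
proof (induction rule: comp_series.induct)
  case (refl A)
  then show ?case by simp
next
  case (step K u n A)
  note K = step.hyps(1) and u = step.hyps(2)
  have B: "ideal B R" using fin_len_ideal step.prems(1) .
  have Kc: "K \<subseteq> carrier R" "K <+> PIdl u \<subseteq> carrier R" using ideal_mem(1)[OF K] ideal_mem(1)[OF adj_ideal[OF K u]] by auto
  note up = adj_upper[OF K u]
  let ?C0 = "colon_ideal R B K" and ?C1 = "colon_ideal R B (K <+> PIdl u)"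
  have C: "ideal ?C0 R" "ideal ?C1 R" using colon_ideal_ideal B Kc by auto
  have C10: "?C1 \<subseteq> ?C0" by (rule colon_antimono[OF up(1)])
  have memC1: "v \<in> ?C1 \<longleftrightarrow> v \<in> ?C0 \<and> v \<otimes> u \<in> B" for v
  proof
    assume "v \<in> ?C1"
    then show "v \<in> ?C0 \<and> v \<otimes> u \<in> B" using C10 up(2) by (simp add: colon_iff[of v _ "K <+> PIdl u"] subset_iff)
  next
    assume v: "v \<in> ?C0 \<and> v \<otimes> u \<in> B"
    then have vc: "v \<in> carrier R" by (simp add: colon_iff)
    have "K <+> PIdl u \<subseteq> colon_ideal R B {v}"
      using v vc Kc u by (intro adj_least colon_ideal_ideal B) (auto simp: colon_iff m_comm subset_iff)
    then show "v \<in> ?C1" using vc Kc(2) by (auto simp: colon_iff m_comm subset_iff)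
  qed
  have flC1: "fin_len ?C1" using fin_len_sup[OF step.prems(1) C(2) colon_upper[OF B Kc(2)]] .
  have "len ?C1 \<le> len ?C0 + 1"
  proof (cases "?C0 \<subseteq> ?C1")
    case True
    then show ?thesis using C10 by simp
  next
    case False
    then obtain v where v: "v \<in> ?C0" "v \<notin> ?C1" by blast
    have vc: "v \<in> carrier R" using v by (simp add: colon_iff)
    have soc: "w \<otimes> u \<in> colon_ideal R B \<mm>" if w: "w \<in> ?C0" for w
    proof -
      have wc: "w \<in> carrier R" using w by (simp add: colon_iff)
      have "(w \<otimes> u) \<otimes> x \<in> B" if x: "x \<in> \<mm>" for x
      proof -
        have "w \<otimes> (x \<otimes> u) \<in> B" using w step.hyps(4)[OF x] by (simp add: colon_iff)
        then show ?thesis using wc u ideal_mem(1)[OF m_ideal x] by (simp add: m_ac)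
      qed
      then show ?thesis using wc u by (simp add: colon_iff)
    qed
    obtain s where s: "s \<in> carrier R" "s \<notin> B" "colon_ideal R B \<mm> = B <+> PIdl s"
      using step.prems(2) by (auto simp: gorenstein_def)
    have ms: "x \<otimes> s \<in> B" if "x \<in> \<mm>" for x
    proof -
      have "s \<in> colon_ideal R B \<mm>" using adj_upper(2)[OF B s(1)] s(3) by simp
      then have "s \<otimes> x \<in> B" using that by (simp add: colon_iff)
      then show ?thesis using s(1) ideal_mem(1)[OF m_ideal that] by (simp add: m_comm)
    qed
    obtain b r where br: "b \<in> B" "r \<in> carrier R" "v \<otimes> u = b \<oplus> r \<otimes> s"
      using soc[OF v(1)] unfolding s(3) mem_adj_iff by blast
    have "r \<notin> \<mm>"
    proof
      assume "r \<in> \<mm>"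
      then have "v \<otimes> u \<in> B" using br ms ideal_mem(3)[OF B] by simp
      then show False using memC1 v by blast
    qed
    then obtain t where t: "t \<in> carrier R" "t \<otimes> r = \<one>" using notin_m_Unit br(2) by blast
    \<comment> \<open>As \<open>r\<close> is a unit, a multiple of \<open>v\<close> matches the
      socle coordinate of w u for any \<open>w\<close> in \<open>?C0\<close>; the difference sends
      \<open>u\<close> into \<open>B\<close>.\<close>
    have C0eq: "?C1 <+> PIdl v = ?C0"
    proof
      show "?C1 <+> PIdl v \<subseteq> ?C0" by (rule adj_least[OF C(1) C10 v(1)])
      show "?C0 \<subseteq> ?C1 <+> PIdl v"
      proof
        fix w assume w: "w \<in> ?C0"
        then have wc: "w \<in> carrier R" by (simp add: colon_iff)
        obtain b' r' where br': "b' \<in> B" "r' \<in> carrier R" "w \<otimes> u = b' \<oplus> r' \<otimes> s"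
          using soc[OF w] unfolding s(3) mem_adj_iff by blast
        define k where "k = r' \<otimes> t"
        have k: "k \<in> carrier R" using br'(2) t(1) by (simp add: k_def)
        have bc: "b \<in> carrier R" "b' \<in> carrier R" using ideal_mem(1)[OF B] br br' by auto
        have kr: "k \<otimes> r = r'" using t br(2) br'(2) by (simp add: k_def m_assoc)
        have "(w \<ominus> k \<otimes> v) \<otimes> u = w \<otimes> u \<ominus> k \<otimes> (v \<otimes> u)" using wc k vc u by algebra
        also have "\<dots> = (b' \<ominus> k \<otimes> b) \<oplus> (r' \<ominus> k \<otimes> r) \<otimes> s"
          unfolding br(3) br'(3) using bc k br(2) br'(2) s(1) by algebra
        also have "\<dots> = b' \<ominus> k \<otimes> b" unfolding kr using bc k br'(2) s(1) by algebra
        finally have "(w \<ominus> k \<otimes> v) \<otimes> u \<in> B" using ideal_mem(4)[OF B br'(1) ideal_mem(6)[OF B k br(1)]] by simp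
        then have "w \<ominus> k \<otimes> v \<in> ?C1"
          using memC1 ideal_mem(4)[OF C(1) w ideal_mem(6)[OF C(1) k v(1)]] by blast
        moreover have "w = (w \<ominus> k \<otimes> v) \<oplus> k \<otimes> v" using wc k vc by algebra
        ultimately show "w \<in> ?C1 <+> PIdl v" using k unfolding mem_adj_iff by blast
      qed
    qed
    have "comp_series (Suc 0) ?C1 ?C0"
    proof (rule comp_series.step[OF C(2) vc v(2)])
      fix x assume x: "x \<in> \<mm>"
      have xc: "x \<in> carrier R" using ideal_mem(1)[OF m_ideal x] .
      have "(v \<otimes> u) \<otimes> x \<in> B" using soc[OF v(1)] x by (simp add: colon_iff)
      then have "(x \<otimes> v) \<otimes> u \<in> B" using xc vc u by (simp add: m_ac)
      then show "x \<otimes> v \<in> ?C1" using memC1 ideal_mem(6)[OF C(1) xc v(1)] by blast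
    next
      show "comp_series 0 (?C1 <+> PIdl v) ?C0" unfolding C0eq by (rule comp_series.refl[OF C(1)])
    qed
    then have "len ?C1 - len ?C0 = Suc 0"
      using comp_series_unique[OF _ fin_len_cs_between(2)[OF flC1 C(1) C10]] by blast
    then show ?thesis by simp
  qed
  moreover have "len (colon_ideal R B A) \<le> len ?C1 + n" using step.IH step.prems up(1) by blast
  ultimately show ?case by simp
qed

text \<open>The bound of the previous lemma applied to \<open>B \<subseteq> K\<close> and to \<open>K \<subseteq> R\<close>; the two bounds add up to
  \<open>\<ell>(R/B)\<close>, so both are equalities.\<close>

lemma gorenstein_duality:
  assumes "fin_len B" "gorenstein B" "ideal K R" "B \<subseteq> K"
  shows "len (colon_ideal R B K) + len K = len B"
proof -
  have B: "ideal B R" using fin_len_ideal assms(1) .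
  have Bc: "B \<subseteq> carrier R" using ideal_mem(1)[OF B] by blast
  have "colon_ideal R B B = carrier R" using ideal_mem(6)[OF B] by (auto simp: colon_iff)
  moreover have "colon_ideal R B (carrier R) = B"
  proof
    show "colon_ideal R B (carrier R) \<subseteq> B" by (force simp: colon_iff dest: bspec[of _ _ \<one>])
    show "B \<subseteq> colon_ideal R B (carrier R)" by (rule colon_upper[OF B]) simp
  qed
  ultimately have 1: "len (colon_ideal R B K) \<le> len B - len K" "len B \<le> len (colon_ideal R B K) + len K"
    using gorenstein_dual_comp_series[OF fin_len_cs_between(2)[OF assms(1,3,4)] assms(1,2)]
      gorenstein_dual_comp_series[OF fin_len_comp_series[OF fin_len_sup[OF assms(1,3,4)]] assms(1,2,4)] by auto
  then show ?thesis using len_mono[OF assms(1,3,4)] by simp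
qed

end

section \<open>Systems of parameters\<close>

context cring begin

lemma PIdl_ideal: "u \<in> carrier R \<Longrightarrow> ideal (PIdl u) R"
  by (rule cgenideal_ideal)

lemma PIdl_add_comm: "\<lbrakk>ideal B R; u \<in> carrier R\<rbrakk> \<Longrightarrow> PIdl u <+> B = B <+> PIdl u"
  using set_add_comm[of "PIdl u" B] ideal_mem(1)[OF PIdl_ideal] ideal_mem(1)[of B] by blast

lemma colon_colon:
  assumes "ideal B R" "S \<subseteq> carrier R" "u \<in> carrier R"
  shows "colon_ideal R (colon_ideal R B S) {u} = colon_ideal R (colon_ideal R B {u}) S"
  using assms by (auto simp: colon_iff m_ac subset_iff)

end

context regular_char_p_ring begin

text \<open>The cube with side q is extremal by \<open>len_bracket\<close>, and the box
  \<open>N\<close> fits into it, so \<open>len_monomial_ideal_eq\<close> passes extremality to the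
  smaller box.\<close>

lemma len_box:
  assumes "set ys \<subseteq> carrier R" "length ys = d" "fin_len (Idl (set ys))" "length N = d" "\<And>n. n \<in> set N \<Longrightarrow> n \<le> p ^ e"
  shows "len (Idl (pows ys N)) = len (Idl (set ys)) * prod_list N"
proof -
  let ?B = "{a. list_all2 (<) a (replicate d (p ^ e))}" and ?D = "{a. list_all2 (<) a N}"
  have B: "finite ?B" "card ?B = (p ^ e) ^ d" "?B \<subseteq> {a. length a = length ys}"
    using finite_card_box[of "replicate d (p ^ e)"] assms(2) by (auto dest: list_all2_lengthD)
  have "len (monomial_ideal ys ?D) = len (Idl (set ys)) * card ?D"
  proof (rule len_monomial_ideal_eq[OF assms(1,3) B(1,3)])
    show "len (monomial_ideal ys ?B) = len (Idl (set ys)) * card ?B"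
      using bracket_eq_monomial_ideal[OF assms(1), of e] len_bracket[OF assms(3), of e] assms(2) B(2) by simp
    show "?D \<subseteq> ?B" using assms(4,5) by (auto simp: list_all2_conv_all_nth intro: less_le_trans)
    fix a i assume ai: "length a = length ys" "i < length ys" "a[i := Suc (a ! i)] \<in> ?D"
    then have "a ! j < N ! j" if "j < d" for j
      using that assms(2) by (cases "j = i") (auto simp: list_all2_conv_all_nth dest!: spec[of _ j])
    then show "a \<in> ?D" using ai(1) assms(2,4) by (simp add: list_all2_conv_all_nth)
  qed
  then show ?thesis using monomial_ideal_box[OF assms(1), of N] finite_card_box[of N] assms(2,4) by simp
qed

lemma bracket_Idl_list:
  assumes "set ys \<subseteq> carrier R"
  shows "bracket_power R (Idl (set ys)) (p ^ e) = Idl (pows ys (replicate (length ys) (p ^ e)))"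
proof -
  have "pows ys (replicate (length ys) (p ^ e)) = (\<lambda>x. x [^] (p ^ e)) ` set ys"
    by (auto simp: zip_replicate2)
  then show ?thesis using assms by (simp add: bracket_Idl)
qed

end

section \<open>Duality for a system of parameters containing f\<close>

locale parameter_system = regular_char_p_ring +
  fixes f :: 'a and xs :: "'a list"
  assumes in_m: "set (f # xs) \<subseteq> \<mm>" and length_xs: "length (f # xs) = d"
    and fin_len_J: "fin_len (Idl (set (f # xs)))"
begin

definition J where "J = Idl (set (f # xs))"

lemma carr: "f \<in> carrier R" "set xs \<subseteq> carrier R" "set (f # xs) \<subseteq> carrier R"
  using in_m m_carrier by auto

lemma J_ideal: "ideal J R" and flJ: "fin_len J" and J_le_m: "J \<subseteq> \<mm>"
  using fin_len_ideal[OF fin_len_J] fin_len_J Idl_least[OF m_ideal in_m] unfolding J_def by blast+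

text \<open>The Frobenius power of (xs), given by explicit generators so that the exponent of
  \<open>f\<close> can vary independently of q.\<close>

definition XB :: "nat \<Rightarrow> 'a set" where
  "XB e = Idl (pows xs (replicate (length xs) (p ^ e)))"

lemma XB_ideal: "ideal (XB e) R"
  unfolding XB_def by (intro genideal_ideal pows_carrier carr)

lemma XB_adj: "XB e <+> PIdl (f [^] (n::nat)) = Idl (pows (f # xs) (n # replicate (length xs) (p ^ e)))"
  unfolding XB_def using Idl_insert[OF pows_carrier[OF carr(2)], of "f [^] n"] carr(1) by simp

lemma len_XB: "n \<le> p ^ e \<Longrightarrow> len (XB e <+> PIdl (f [^] n)) = n * ((p ^ e) ^ length xs * len J)"
  unfolding XB_adj J_def using length_xs carr(3) fin_len_J
  by (subst len_box[where e = e]) (auto simp: in_set_replicate)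

lemma fin_len_XB: "fin_len (XB e <+> PIdl (f [^] (n::nat)))"
  unfolding XB_adj using len_pows_le[of "{}" "f # xs" "n # replicate (length xs) (p ^ e)"] carr(3) fin_len_J by simp

lemma bracket_J: "bracket_power R J (p ^ e) = XB e <+> PIdl (f [^] (p ^ e))"
  unfolding XB_adj J_def using bracket_Idl_list[OF carr(3), of e] by simp

text \<open>The length of R/J^[q] is extremal for powers of \<open>f\<close> modulo
  \<open>XB e\<close>, so \<open>adj_pow_extremal\<close> yields the annihilators.\<close>

lemma XB_colon:
  assumes "i \<le> p ^ e"
  shows "colon_ideal R (bracket_power R J (p ^ e)) {f [^] i} = XB e <+> PIdl (f [^] (p ^ e - i))"
proof -
  have one: "f [^] (1::nat) = f" using carr by simp
  have fin_len: "fin_len (XB e <+> PIdl f)" using fin_len_XB[of e 1] unfolding one .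
  have "len (XB e <+> PIdl f) = (p ^ e) ^ length xs * len J" using len_XB[of 1 e] p_pos[of e] unfolding one by simp
  then have eq: "len (XB e <+> PIdl (f [^] (p ^ e))) = p ^ e * len (XB e <+> PIdl f)" by (simp add: len_XB)
  show ?thesis unfolding bracket_J by (rule adj_pow_extremal(2)[OF XB_ideal carr(1) fin_len eq assms])
qed

lemma gorenstein_XB:
  assumes "gorenstein J" "0 < n" "n \<le> p ^ e"
  shows "gorenstein (XB e <+> PIdl (f [^] n))"
proof -
  have "gorenstein (Idl ({} \<union> pows (f # xs) (n # replicate (length xs) (p ^ e))))"
  proof (rule gorenstein_pows)
    show "len (Idl ({} \<union> pows (f # xs) (n # replicate (length xs) (p ^ e))))
        = prod_list (n # replicate (length xs) (p ^ e)) * len (Idl ({} \<union> set (f # xs)))"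
      using len_XB[OF assms(3)] unfolding XB_adj J_def by simp
    show "0 \<notin> set (n # replicate (length xs) (p ^ e))" using assms(2) p_pos[of e] by (auto simp: in_set_replicate)
  qed (use in_m fin_len_J assms(1) in \<open>auto simp: J_def\<close>)
  then show ?thesis unfolding XB_adj by simp
qed

lemma XB_le_mq: "XB e \<subseteq> mq e"
proof -
  have "pows xs (replicate (length xs) (p ^ e)) \<subseteq> mq e"
    using bracket_mem[OF m_carrier, of _ "p ^ e"] in_m by (auto simp: zip_replicate2)
  then show ?thesis unfolding XB_def by (intro Idl_least mq_ideal)
qed

lemma len_colon_J: "gorenstein J \<Longrightarrow> len (colon_ideal R J \<mm>) + 1 = len J"
  using gorenstein_duality[OF flJ _ m_ideal J_le_m] by simp

lemma fin_len_colon_J: "fin_len (colon_ideal R J \<mm>)"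
  using fin_len_sup[OF flJ colon_ideal_ideal colon_upper] J_ideal m_carrier by blast

text \<open>One inclusion comes from multiplying q-th powers. Both ideals have colength (len J - 1)
  q^d, the left one by Kunz and the right one by duality in R/J^[q], so they coincide.\<close>

lemma bracket_colon:
  assumes g: "gorenstein J"
  shows "bracket_power R (colon_ideal R J \<mm>) (p ^ e) = colon_ideal R (bracket_power R J (p ^ e)) (mq e)"
    "len (colon_ideal R (bracket_power R J (p ^ e)) (mq e)) + (p ^ e) ^ d = len J * (p ^ e) ^ d"
proof -
  let ?q = "p ^ e"
  let ?B = "bracket_power R J ?q"
  have Jc: "J \<subseteq> carrier R" using ideal_mem(1)[OF J_ideal] by blast
  have flB: "fin_len ?B" by (rule fin_len_bracket[OF flJ])
  note B = fin_len_ideal[OF flB]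
  have mqc: "mq e \<subseteq> carrier R" using ideal_mem(1)[OF mq_ideal] by blast
  have K: "ideal (colon_ideal R ?B (mq e)) R" by (rule colon_ideal_ideal[OF B mqc])
  have gB: "gorenstein ?B" unfolding bracket_J by (intro gorenstein_XB g p_pos order_refl)
  have Bmq: "?B \<subseteq> mq e" by (rule bracket_mono[OF m_carrier J_le_m])
  have "len (colon_ideal R ?B (mq e)) + len (mq e) = len ?B"
    by (rule gorenstein_duality[OF flB gB mq_ideal Bmq])
  then show *: "len (colon_ideal R ?B (mq e)) + ?q ^ d = len J * ?q ^ d"
    using len_mq_eq[of e] len_bracket[OF flJ, of e] by (simp add: len_mq_def)
  let ?C = "bracket_power R (colon_ideal R J \<mm>) ?q"
  have Cc: "colon_ideal R J \<mm> \<subseteq> carrier R" by (auto simp: colon_iff)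
  have sub: "?C \<subseteq> colon_ideal R ?B (mq e)"
  proof (rule bracket_least[OF K])
    fix x assume x: "x \<in> colon_ideal R J \<mm>"
    then have xc: "x \<in> carrier R" by (simp add: colon_iff)
    have "x [^] ?q \<otimes> z [^] ?q \<in> ?B" if "z \<in> \<mm>" for z
      using x that bracket_mem[OF Jc, of "x \<otimes> z" ?q] xc m_carrier
      by (auto simp: colon_iff nat_pow_distrib[symmetric] subset_iff)
    moreover have "{z [^] ?q |z. z \<in> \<mm>} \<subseteq> carrier R" using m_carrier by auto
    ultimately show "x [^] ?q \<in> colon_ideal R ?B (mq e)"
      unfolding bracket_power_def[of R \<mm>] using colon_Idl[OF B] xc by (auto simp: colon_iff)
  qed
  have "len ?C = len (colon_ideal R J \<mm>) * ?q ^ d" by (rule len_bracket[OF fin_len_colon_J])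
  then have "len ?C + ?q ^ d = len J * ?q ^ d" using len_colon_J[OF g] by (metis add_mult_distrib mult_1)
  then show "?C = colon_ideal R ?B (mq e)"
    using len_eq_imp_eq[OF fin_len_bracket[OF fin_len_colon_J] K sub] * by simp
qed

lemma colength_reflection:
  assumes g: "gorenstein J" and a: "a \<le> p ^ e"
  shows "len (PIdl (f [^] a) <+> bracket_power R (colon_ideal R J \<mm>) (p ^ e))
      + (p ^ e - a) * ((p ^ e) ^ length xs * len J) + (p ^ e) ^ d
    = len J * (p ^ e) ^ d + len (PIdl (f [^] (p ^ e - a)) <+> mq e)"
proof -
  define b where "b = p ^ e - a"
  let ?B = "bracket_power R J (p ^ e)"
  let ?K = "colon_ideal R ?B (mq e)"
  let ?Y = "XB e <+> PIdl (f [^] b)"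
  have fp: "f [^] n \<in> carrier R" for n :: nat using carr by simp
  have flB: "fin_len ?B" by (rule fin_len_bracket[OF flJ])
  note B = fin_len_ideal[OF flB]
  have mqc: "mq e \<subseteq> carrier R" using ideal_mem(1)[OF mq_ideal] by blast
  have K: "ideal ?K R" "fin_len ?K" using colon_ideal_ideal[OF B mqc] fin_len_sup[OF flB _ colon_upper[OF B mqc]] by auto
  have Y: "fin_len ?Y" "ideal ?Y R" using fin_len_XB fin_len_ideal by auto
  have Z: "ideal (mq e <+> PIdl (f [^] b)) R" by (intro adj_ideal mq_ideal fp)
  have YZ: "?Y \<subseteq> mq e <+> PIdl (f [^] b)" by (intro add_ideal_mono XB_le_mq order_refl)
  have lenK: "len ?K = len (?K <+> PIdl (f [^] a)) + len (colon_ideal R ?Y (mq e))"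
    using len_adj_colon'[OF K(2) fp[of a]] unfolding colon_colon[OF B mqc fp] XB_colon[OF a] b_def .
  \<comment> \<open>Since f^b already lies in \<open>?Y\<close>, adding it to \<mm>^[q] does not
    change the colon; it makes \<open>?Y\<close> a subideal, as duality requires.\<close>
  have "colon_ideal R ?Y (mq e <+> PIdl (f [^] b)) = colon_ideal R ?Y (mq e)"
  proof
    show "colon_ideal R ?Y (mq e <+> PIdl (f [^] b)) \<subseteq> colon_ideal R ?Y (mq e)"
      by (intro colon_antimono adj_upper mq_ideal fp)
    show "colon_ideal R ?Y (mq e) \<subseteq> colon_ideal R ?Y (mq e <+> PIdl (f [^] b))"
    proof
      fix r assume r: "r \<in> colon_ideal R ?Y (mq e)"
      then have rc: "r \<in> carrier R" by (simp add: colon_iff)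
      have "r \<otimes> z \<in> ?Y" if z: "z \<in> mq e <+> PIdl (f [^] b)" for z
      proof -
        obtain u s where us: "u \<in> mq e" "s \<in> carrier R" "z = u \<oplus> s \<otimes> f [^] b"
          using z unfolding mem_adj_iff by blast
        have "r \<otimes> z = r \<otimes> u \<oplus> (r \<otimes> s) \<otimes> f [^] b"
          using us rc fp[of b] mqc by (simp add: r_distr m_assoc subset_iff)
        moreover have "r \<otimes> u \<in> ?Y" using r us(1) by (simp add: colon_iff)
        moreover have "(r \<otimes> s) \<otimes> f [^] b \<in> ?Y"
          using ideal_mem(6)[OF Y(2) _ adj_upper(2)[OF XB_ideal fp]] rc us(2) by simp
        ultimately show ?thesis using ideal_mem(3)[OF Y(2)] by simp
      qed
      then show "r \<in> colon_ideal R ?Y (mq e <+> PIdl (f [^] b))" using rc by (simp add: colon_iff)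
    qed
  qed
  moreover have "len (colon_ideal R ?Y (mq e <+> PIdl (f [^] b))) + len (mq e <+> PIdl (f [^] b)) = len ?Y"
  proof (cases "b = 0")
    \<comment> \<open>For b = 0 every ideal involved is the unit ideal, which is not
      \<open>gorenstein\<close>; the equation reads 0 + 0 = 0.\<close>
    case True
    have "?Y = carrier R" using adj_upper(2)[OF XB_ideal fp, of b e] Y(2) True by (intro ideal_eq_carrier) simp_all
    moreover have "mq e <+> PIdl (f [^] b) = carrier R"
      using adj_upper(2)[OF mq_ideal fp, of b e] Z True by (intro ideal_eq_carrier) simp_all
    moreover have "colon_ideal R (carrier R) (carrier R) = carrier R" by (auto simp: colon_iff)
    ultimately show ?thesis by simp
  next
    case False
    then have "gorenstein ?Y" by (intro gorenstein_XB g) (auto simp: b_def)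
    then show ?thesis by (rule gorenstein_duality[OF Y(1) _ Z YZ])
  qed
  moreover have "len ?Y = b * ((p ^ e) ^ length xs * len J)" by (rule len_XB) (simp add: b_def)
  ultimately have "len (?K <+> PIdl (f [^] a)) + b * ((p ^ e) ^ length xs * len J) + (p ^ e) ^ d
      = len J * (p ^ e) ^ d + len (mq e <+> PIdl (f [^] b))"
    using lenK bracket_colon(2)[OF g, of e] by simp
  then show ?thesis
    unfolding bracket_colon(1)[OF g] PIdl_add_comm[OF K(1) fp] PIdl_add_comm[OF mq_ideal fp] b_def .
qed

lemma len_f_mq_le: "len (PIdl f <+> mq e) \<le> (p ^ e) ^ length xs * len J"
proof -
  have fin_len: "fin_len (XB e <+> PIdl f)" using fin_len_XB[of e 1] carr by simp
  have "len (mq e <+> PIdl f) \<le> len (XB e <+> PIdl f)"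
    by (intro len_mono fin_len adj_ideal mq_ideal carr add_ideal_mono XB_le_mq order_refl)
  then show ?thesis using len_XB[of 1 e] p_pos[of e] carr PIdl_add_comm[OF mq_ideal carr(1)] by simp
qed

end

section \<open>Reductions generated by parameters\<close>

context noetherian_local_ring begin

text \<open>Choose \<open>K\<close> maximal among the ideals that contain \<open>D\<close> but not
  \<open>M\<close>, and \<open>g\<close> in \<open>M\<close> outside \<open>K\<close>. Then M
  \<subseteq> K + gR, so the hypothesis gives g = k + c g with k in \<open>K\<close> and c in \<mm>,
  and 1 - c is a unit.\<close>

lemma nakayama:
  assumes D: "ideal D R" and M: "ideal M R" and sub: "M \<subseteq> D <+> \<mm> \<cdot> M"
  shows "M \<subseteq> D"
proof (rule ccontr)
  assume nsub: "\<not> M \<subseteq> D"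
  let ?C = "{K. ideal K R \<and> D \<subseteq> K \<and> \<not> M \<subseteq> K}"
  have "\<exists>K\<in>?C. \<forall>I\<in>?C. K \<subseteq> I \<longrightarrow> I = K"
  proof (rule ideals_have_maximal)
    have "D \<in> ?C" using D nsub by simp
    then show "?C \<noteq> {}" by blast
    show "ideal I R" if "I \<in> ?C" for I using that by simp
  qed
  then obtain K where KC: "K \<in> ?C" and max: "\<forall>I\<in>?C. K \<subseteq> I \<longrightarrow> I = K" by (rule bexE)
  have K: "ideal K R" "D \<subseteq> K" "\<not> M \<subseteq> K" using KC by simp_all
  obtain g where g: "g \<in> M" "g \<notin> K" using K(3) by blast
  have gc: "g \<in> carrier R" using ideal_mem(1)[OF M g(1)] .
  note up = adj_upper[OF K(1) gc]
  have Kg: "ideal (K <+> PIdl g) R" by (rule adj_ideal[OF K(1) gc])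
  have MKg: "M \<subseteq> K <+> PIdl g"
  proof (rule ccontr)
    assume "\<not> M \<subseteq> K <+> PIdl g"
    then have "K <+> PIdl g \<in> ?C" using Kg K(2) up(1) by auto
    then have "K <+> PIdl g = K" using bspec[OF max] up(1) by blast
    then show False using up(2) g(2) by simp
  qed
  let ?T = "K <+> (\<lambda>c. c \<otimes> g) ` \<mm>"
  have S: "ideal ((\<lambda>c. c \<otimes> g) ` \<mm>) R" by (rule scaled_ideal[OF m_ideal gc])
  have T: "ideal ?T R" by (rule add_ideals[OF K(1) S])
  have "\<mm> \<cdot> M \<subseteq> ?T"
  proof (rule ideal_prod_least[OF T])
    fix x y assume x: "x \<in> \<mm>" and "y \<in> M"
    then have "y \<in> K <+> PIdl g" using MKg by blast
    then obtain k r where kr: "k \<in> K" "r \<in> carrier R" "y = k \<oplus> r \<otimes> g" unfolding mem_adj_iff by blast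
    have xc: "x \<in> carrier R" using ideal_mem(1)[OF m_ideal x] .
    have "x \<otimes> y = x \<otimes> k \<oplus> (x \<otimes> r) \<otimes> g"
      using kr xc gc ideal_mem(1)[OF K(1) kr(1)] by (simp add: r_distr m_assoc)
    then show "x \<otimes> y \<in> ?T"
      using ideal_mem(6)[OF K(1) xc kr(1)] ideal_mem(7)[OF m_ideal kr(2) x] unfolding mem_add_iff by blast
  qed
  then have "D <+> \<mm> \<cdot> M \<subseteq> ?T" using K(2) add_ideal_upper(1)[OF K(1) S] by (intro add_ideal_least T) auto
  then have "g \<in> ?T" using sub g(1) by blast
  then obtain k c where kc: "k \<in> K" "c \<in> \<mm>" "g = k \<oplus> c \<otimes> g" unfolding mem_add_iff by blast
  have cc: "c \<in> carrier R" "k \<in> carrier R" using ideal_mem(1)[OF m_ideal kc(2)] ideal_mem(1)[OF K(1) kc(1)] by auto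
  have "(\<one> \<ominus> c) \<otimes> g = g \<ominus> c \<otimes> g" using cc gc by algebra
  also have "\<dots> = (k \<oplus> c \<otimes> g) \<ominus> c \<otimes> g" using kc(3) by simp
  also have "\<dots> = k" using cc gc by algebra
  finally have 1: "(\<one> \<ominus> c) \<otimes> g \<in> K" using kc(1) by simp
  have "\<one> \<ominus> c \<notin> \<mm>"
  proof
    assume "\<one> \<ominus> c \<in> \<mm>"
    then have "(\<one> \<ominus> c) \<oplus> c \<in> \<mm>" using kc(2) ideal_mem(3)[OF m_ideal] by blast
    moreover have "(\<one> \<ominus> c) \<oplus> c = \<one>" using cc by algebra
    ultimately show False using one_notin_m by simp
  qed
  then show False using unit_mult_mem[OF K(1) _ _ gc 1] cc g(2) by auto
qed

text \<open>Steinitz exchange: an \<open>x\<close> outside Idl Y + \<mm>^2 has a unit coefficient at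
  some generator, which it can replace. A term with coefficient in \<mm> lies in \<mm>^2, so
  subtracting it preserves the hypothesis.\<close>

lemma generator_exchange:
  assumes "Y \<subseteq> carrier R" "set zs \<subseteq> \<mm>" "x \<in> Idl (Y \<union> set zs)" "x \<notin> Idl Y <+> \<mm> \<cdot> \<mm>"
  shows "\<exists>zs'. Suc (length zs') = length zs \<and> set zs' \<subseteq> \<mm> \<and> Idl (insert x (Y \<union> set zs')) = Idl (Y \<union> set zs)"
  using assms(2-4)
proof (induction zs arbitrary: x)
  case Nil
  then show ?case
    using add_ideal_upper(1)[OF genideal_ideal[OF assms(1)] ideal_prod_is_ideal[OF m_ideal m_ideal]] by auto
next
  case (Cons z zs)
  have z: "z \<in> \<mm>" "z \<in> carrier R" and zs: "set zs \<subseteq> \<mm>" "set zs \<subseteq> carrier R"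
    using Cons.prems(1) m_ideal ideal_mem(1)[OF m_ideal] by auto
  have c: "Y \<union> set zs \<subseteq> carrier R" using assms(1) zs by auto
  have cz: "Y \<union> set (z # zs) \<subseteq> carrier R" using assms(1) zs z by auto
  have eq: "Y \<union> set (z # zs) = insert z (Y \<union> set zs)" by auto
  note Iz = genideal_ideal[OF cz] and self = genideal_self[OF cz]
  have xc: "x \<in> carrier R" using ideal_mem(1)[OF Iz Cons.prems(2)] .
  have "x \<in> Idl (Y \<union> set zs) <+> PIdl z" using Cons.prems(2) unfolding eq Idl_insert[OF c z(2)] .
  then obtain v r where vr: "v \<in> Idl (Y \<union> set zs)" "r \<in> carrier R" "x = v \<oplus> r \<otimes> z"
    unfolding mem_adj_iff by blast
  have vc: "v \<in> carrier R" using ideal_mem(1)[OF genideal_ideal[OF c] vr(1)] .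
  show ?case
  proof (cases "r \<in> \<mm>")
    case False
    have ic: "insert x (Y \<union> set zs) \<subseteq> carrier R" using c xc by blast
    note I = genideal_ideal[OF ic] and s = genideal_self[OF ic]
    have "r \<otimes> z = x \<ominus> v" unfolding vr(3) using vc vr(2) z(2) by algebra
    moreover have "v \<in> Idl (insert x (Y \<union> set zs))" using vr(1) Idl_mono[OF ic, of "Y \<union> set zs"] by blast
    ultimately have "r \<otimes> z \<in> Idl (insert x (Y \<union> set zs))" using ideal_mem(4)[OF I] s by auto
    then have "z \<in> Idl (insert x (Y \<union> set zs))" using unit_mult_mem[OF I vr(2) False z(2)] by blast
    then have "Idl (Y \<union> set (z # zs)) \<subseteq> Idl (insert x (Y \<union> set zs))" using s by (intro Idl_least I) auto
    moreover have "Idl (insert x (Y \<union> set zs)) \<subseteq> Idl (Y \<union> set (z # zs))"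
      using self Cons.prems(2) by (intro Idl_least Iz) auto
    ultimately show ?thesis using zs(1) by (intro exI[of _ zs]) auto
  next
    case True
    have W: "ideal (Idl Y <+> \<mm> \<cdot> \<mm>) R"
      by (intro add_ideals genideal_ideal assms(1) ideal_prod_is_ideal m_ideal)
    have "r \<otimes> z \<in> Idl Y <+> \<mm> \<cdot> \<mm>"
      using ideal_prod.prod[OF True z(1), of R]
        add_ideal_upper(2)[OF genideal_ideal[OF assms(1)] ideal_prod_is_ideal[OF m_ideal m_ideal]] by blast
    then have "v \<notin> Idl Y <+> \<mm> \<cdot> \<mm>" using Cons.prems(3) ideal_mem(3)[OF W] unfolding vr(3) by blast
    then obtain zs1 where zs1: "Suc (length zs1) = length zs" "set zs1 \<subseteq> \<mm>"
      "Idl (insert v (Y \<union> set zs1)) = Idl (Y \<union> set zs)"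
      using Cons.IH[OF zs(1) vr(1)] by blast
    have z1c: "set zs1 \<subseteq> carrier R" using zs1(2) ideal_mem(1)[OF m_ideal] by blast
    have ic: "insert x (Y \<union> set (z # zs1)) \<subseteq> carrier R" "insert v (Y \<union> set zs1) \<subseteq> carrier R"
      using assms(1) z1c xc vc z by auto
    note I = genideal_ideal[OF ic(1)] and s = genideal_self[OF ic(1)]
    have "v = x \<ominus> r \<otimes> z" unfolding vr(3) using vc vr(2) z(2) by algebra
    moreover have "r \<otimes> z \<in> Idl (insert x (Y \<union> set (z # zs1)))" using s by (intro ideal_mem(6)[OF I vr(2)]) auto
    ultimately have "v \<in> Idl (insert x (Y \<union> set (z # zs1)))" using ideal_mem(4)[OF I] s by auto
    then have "Idl (Y \<union> set zs) \<subseteq> Idl (insert x (Y \<union> set (z # zs1)))"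
      unfolding zs1(3)[symmetric] using s by (intro Idl_least I) auto
    then have "Idl (Y \<union> set (z # zs)) \<subseteq> Idl (insert x (Y \<union> set (z # zs1)))"
      using s genideal_self[OF c] by (intro Idl_least I) auto
    moreover have "set zs1 \<subseteq> Idl (Y \<union> set zs)" using genideal_self[OF ic(2)] zs1(3) by auto
    then have "set zs1 \<subseteq> Idl (Y \<union> set (z # zs))" using Idl_mono[OF cz, of "Y \<union> set zs"] by auto
    then have "Idl (insert x (Y \<union> set (z # zs1))) \<subseteq> Idl (Y \<union> set (z # zs))"
      using self Cons.prems(2) by (intro Idl_least Iz) auto
    ultimately show ?thesis using zs1 z by (intro exI[of _ "z # zs1"]) auto
  qed
qed

lemma monomial_ipow: "set xs \<subseteq> \<mm> \<Longrightarrow> length a = length xs \<Longrightarrow> monomial xs a \<in> ipow \<mm> (sum_list a)"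
proof (induction xs a rule: monomial.induct)
  case (1 x xs a as)
  have IH: "monomial xs as \<in> ipow \<mm> (sum_list as)" using 1 by simp
  have "x [^] n \<otimes> monomial xs as \<in> ipow \<mm> (n + sum_list as)" for n
  proof (induction n)
    case 0
    then show ?case using IH ideal_mem(1)[OF ipow_ideal[OF m_ideal] IH] by simp
  next
    case (Suc n)
    have c: "x \<in> carrier R" "monomial xs as \<in> carrier R"
      using 1(2) ideal_mem(1)[OF m_ideal] ideal_mem(1)[OF ipow_ideal[OF m_ideal] IH] by auto
    have "x \<otimes> (x [^] n \<otimes> monomial xs as) \<in> ipow \<mm> (Suc (n + sum_list as))"
      using mult_mem_ipow_Suc[OF _ Suc] 1(2) by auto
    moreover have "x [^] Suc n \<otimes> monomial xs as = x \<otimes> (x [^] n \<otimes> monomial xs as)" using c by (simp add: m_ac)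
    ultimately show ?case by simp
  qed
  then show ?case by simp
qed auto

end

text \<open>\<open>red\<close> is the nontrivial half of the reduction equation I \<mm>^n =
  \<mm>^(n+1) of R/fR, pulled back to R.\<close>

locale reduction_system = parameter_system +
  fixes n :: nat
  assumes red: "ipow \<mm> (Suc n) \<subseteq> PIdl f <+> (Idl (set xs)) \<cdot> ipow \<mm> n"
begin

lemma Idl_xs: "ideal (Idl (set xs)) R"
  by (intro genideal_ideal carr)

text \<open>If the exchange process stopped at \<open>r < d - 1\<close> elements, the reduction property and Nakayama would
  make \<open>(f, ys)\<close> an \<open>\<mm>\<close>-primary ideal with fewer than \<open>d\<close> generators.\<close>

lemma gens_extend:
  "r \<le> length xs \<Longrightarrow> \<exists>ys zs. set ys \<subseteq> set xs \<and> length ys = r \<and> length zs = d - r \<and> set zs \<subseteq> \<mm>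
    \<and> Idl (set ys \<union> set zs) = \<mm>"
proof (induction r)
  case 0
  obtain zs where zs: "set zs \<subseteq> carrier R" "length zs = d" "\<mm> = Idl (set zs)" using m_gens_d by blast
  then show ?case using genideal_self[OF zs(1)] by (intro exI[of _ "[]"] exI[of _ zs]) auto
next
  case (Suc r)
  then obtain ys zs where yz: "set ys \<subseteq> set xs" "length ys = r" "length zs = d - r" "set zs \<subseteq> \<mm>"
    "Idl (set ys \<union> set zs) = \<mm>" by auto
  have ysc: "set ys \<subseteq> carrier R" using yz(1) carr by blast
  let ?W = "Idl (set ys) <+> \<mm> \<cdot> \<mm>"
  note mm = ideal_prod_is_ideal[OF m_ideal m_ideal]
  have "\<exists>x\<in>set xs. x \<notin> ?W"
  proof (rule ccontr)
    assume "\<not> ?thesis"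
    then have "Idl (set xs) \<subseteq> ?W" by (intro Idl_least add_ideals genideal_ideal ysc mm) auto
    let ?D = "Idl (set (f # ys))" and ?M = "ipow \<mm> (Suc n)"
    have fyc: "set (f # ys) \<subseteq> carrier R" using carr ysc by auto
    note D = genideal_ideal[OF fyc] and M = ipow_ideal[OF m_ideal, of "Suc n"]
    note mM = ideal_prod_is_ideal[OF m_ideal M]
    note T = add_ideals[OF D mM] and up = add_ideal_upper[OF D mM]
    have fD: "f \<in> ?D" using genideal_self[OF fyc] by auto
    \<comment> \<open>Elements of (xs) are split along (ys) + \<mm>^2. The first part stays in
      \<open>?D\<close>; the second, times \<mm>^n, lies in \<mm> \<mm>^(n+1), the error that
      Nakayama absorbs.\<close>
    have "(Idl (set xs)) \<cdot> ipow \<mm> n \<subseteq> ?D <+> \<mm> \<cdot> ?M"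
    proof (rule ideal_prod_least[OF T])
      fix w u assume "w \<in> Idl (set xs)" and u: "u \<in> ipow \<mm> n"
      then have "w \<in> ?W" using \<open>Idl (set xs) \<subseteq> ?W\<close> by blast
      then obtain a b where ab: "a \<in> Idl (set ys)" "b \<in> \<mm> \<cdot> \<mm>" "w = a \<oplus> b" unfolding mem_add_iff by blast
      have uc: "u \<in> carrier R" using ideal_mem(1)[OF ipow_ideal[OF m_ideal] u] .
      have ac: "a \<in> carrier R" "b \<in> carrier R"
        using ideal_mem(1)[OF genideal_ideal[OF ysc] ab(1)] ideal_mem(1)[OF mm ab(2)] by auto
      have "a \<in> ?D" using ab(1) Idl_mono[OF fyc, of "set ys"] by auto
      then have 1: "a \<otimes> u \<in> ?D" using ideal_mem(7)[OF D uc] by blast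
      have 2: "b \<otimes> u \<in> \<mm> \<cdot> ?M" using ab(2)
      proof (induction rule: ideal_prod.induct)
        case (prod i j)
        have "i \<otimes> (j \<otimes> u) \<in> \<mm> \<cdot> ?M"
          by (intro ideal_prod.prod prod(1) mult_mem_ipow_Suc prod(2) u)
        then show ?case using ideal_mem(1)[OF m_ideal prod(1)] ideal_mem(1)[OF m_ideal prod(2)] uc by (simp add: m_assoc)
      next
        case (sum s t)
        then show ?case
          using ideal_mem(3)[OF mM sum(3,4)] ideal_mem(1)[OF mm] uc by (simp add: l_distr)
      qed
      show "w \<otimes> u \<in> ?D <+> \<mm> \<cdot> ?M"
        using 1 2 ab(3) ac uc unfolding mem_add_iff by (auto simp: l_distr)
    qed
    moreover have "PIdl f \<subseteq> ?D <+> \<mm> \<cdot> ?M" using fD up(1) by (intro PIdl_least T) blast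
    ultimately have "PIdl f <+> (Idl (set xs)) \<cdot> ipow \<mm> n \<subseteq> ?D <+> \<mm> \<cdot> ?M" by (intro add_ideal_least T)
    then have "?M \<subseteq> ?D <+> \<mm> \<cdot> ?M" using red by (rule subset_trans[rotated])
    then have "?M \<subseteq> ?D" by (rule nakayama[OF D M])
    then have fin_len: "fin_len ?D" using fin_len_sup[OF fin_len_ipow D] by blast
    have "set (f # ys) \<subseteq> \<mm>" using in_m yz(1) by auto
    then have "?D \<subseteq> \<mm>" by (intro Idl_least m_ideal)
    then have "\<one> \<notin> ?D" using one_notin_m by blast
    then have "d \<le> length (f # ys)" using length_gens_ge[OF fyc fin_len] by blast
    then show False using yz(2) Suc.prems length_xs by simp
  qed
  then obtain x where x: "x \<in> set xs" "x \<notin> ?W" by blast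
  have "x \<in> Idl (set ys \<union> set zs)" using x(1) yz(5) in_m by auto
  then obtain zs' where zs': "Suc (length zs') = length zs" "set zs' \<subseteq> \<mm>" "Idl (insert x (set ys \<union> set zs')) = \<mm>"
    using generator_exchange[OF ysc yz(4) _ x(2)] yz(5) by auto
  then show ?case using yz x(1) by (intro exI[of _ "x # ys"] exI[of _ zs']) auto
qed

lemma uniformizer: "\<exists>\<pi>. \<pi> \<in> \<mm> \<and> Idl (set (\<pi> # xs)) = \<mm>"
proof -
  obtain ys zs where yz: "set ys \<subseteq> set xs" "length zs = d - length xs" "set zs \<subseteq> \<mm>" "Idl (set ys \<union> set zs) = \<mm>"
    using gens_extend[of "length xs"] by auto
  then have "length zs = 1" using length_xs by auto
  then obtain \<pi> where \<pi>: "zs = [\<pi>]" by (auto simp: length_Suc_conv)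
  have c: "set (\<pi> # xs) \<subseteq> \<mm>" using yz(3) \<pi> in_m by auto
  have "set ys \<union> set zs \<subseteq> set (\<pi> # xs)" using yz(1) \<pi> by auto
  then have "\<mm> \<subseteq> Idl (set (\<pi> # xs))"
    unfolding yz(4)[symmetric] using c m_carrier by (intro Idl_mono) auto
  moreover have "Idl (set (\<pi> # xs)) \<subseteq> \<mm>" by (rule Idl_least[OF m_ideal c])
  ultimately show ?thesis using yz(3) \<pi> by auto
qed

text \<open>\<open>R/(xs)\<close> is a discrete valuation ring with uniformizer \<open>\<pi>\<close>, so \<open>J = (xs, \<pi>\<^sup>N)\<close>.\<close>

lemma gorenstein_J: "gorenstein J"
proof -
  obtain \<pi> where \<pi>: "\<pi> \<in> \<mm>" "Idl (set (\<pi> # xs)) = \<mm>" using uniformizer by blast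
  let ?X = "Idl (set xs)"
  note X = Idl_xs
  have \<pi>c: "\<pi> \<in> carrier R" "\<pi> [^] k \<in> carrier R" for k :: nat using \<pi>(1) m_carrier by auto
  have m: "\<mm> = ?X <+> PIdl \<pi>" using \<pi>(2) Idl_insert[OF carr(2) \<pi>c(1)] by simp
  have J: "J = ?X <+> PIdl f" unfolding J_def using Idl_insert[OF carr(2,1)] by simp
  have adj: "ideal (?X <+> PIdl (\<pi> [^] k)) R" for k :: nat by (intro adj_ideal X \<pi>c)
  obtain M where "ipow \<mm> M \<subseteq> J" using comp_series_m_ipow[OF fin_len_comp_series[OF flJ] HOL.refl] by blast
  then have \<pi>M: "\<pi> [^] M \<in> J" using pow_mem_ipow[OF \<pi>(1) m_carrier] by blast
  \<comment> \<open>The largest member of \<open>S\<close> is the valuation of \<open>f\<close> in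
    R/(xs).\<close>
  define S where "S = {k::nat. f \<in> ?X <+> PIdl (\<pi> [^] k)}"
  \<comment> \<open>If f lay in (xs, \<pi>^(M+1)), then so would \<pi>^M. Hence \<pi>^M would lie in
    (xs), and d - 1 elements would generate a proper ideal of finite colength.\<close>
  have "k \<le> M" if k: "k \<in> S" for k
  proof (rule ccontr)
    assume "\<not> k \<le> M"
    then have "?X <+> PIdl (\<pi> [^] k) \<subseteq> ?X <+> PIdl (\<pi> [^] Suc M)"
      by (intro add_ideal_mono order_refl PIdl_least PIdl_ideal \<pi>c pow_in_PIdl) simp
    then have "f \<in> ?X <+> PIdl (\<pi> [^] Suc M)" using k by (auto simp: S_def)
    then have "J \<subseteq> ?X <+> PIdl (\<pi> [^] Suc M)"
      unfolding J by (intro adj_least adj adj_upper X \<pi>c)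
    then have "\<pi> [^] M \<in> ?X <+> PIdl (\<pi> [^] Suc M)" using \<pi>M by blast
    then obtain x r where xr: "x \<in> ?X" "r \<in> carrier R" "\<pi> [^] M = x \<oplus> r \<otimes> \<pi> [^] Suc M"
      unfolding mem_adj_iff by blast
    have xc: "x \<in> carrier R" using ideal_mem(1)[OF X xr(1)] .
    have "(\<one> \<ominus> r \<otimes> \<pi>) \<otimes> \<pi> [^] M = \<pi> [^] M \<ominus> r \<otimes> \<pi> [^] Suc M"
      using xr(2) \<pi>c(1) \<pi>c(2)[of M] unfolding nat_pow_Suc by algebra
    also have "\<dots> = (x \<oplus> r \<otimes> \<pi> [^] Suc M) \<ominus> r \<otimes> \<pi> [^] Suc M" using xr(3) by metis
    also have "\<dots> = x" using xr(2) xc \<pi>c(2)[of "Suc M"] by algebra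
    finally have 1: "(\<one> \<ominus> r \<otimes> \<pi>) \<otimes> \<pi> [^] M \<in> ?X" using xr(1) by simp
    have "\<one> \<ominus> r \<otimes> \<pi> \<notin> \<mm>"
    proof
      assume "\<one> \<ominus> r \<otimes> \<pi> \<in> \<mm>"
      then have "(\<one> \<ominus> r \<otimes> \<pi>) \<oplus> r \<otimes> \<pi> \<in> \<mm>"
        using ideal_mem(3)[OF m_ideal _ ideal_mem(6)[OF m_ideal xr(2) \<pi>(1)]] by blast
      moreover have "(\<one> \<ominus> r \<otimes> \<pi>) \<oplus> r \<otimes> \<pi> = \<one>" using xr(2) \<pi>c(1) by algebra
      ultimately show False using one_notin_m by simp
    qed
    then have "\<pi> [^] M \<in> ?X" using unit_mult_mem[OF X _ _ \<pi>c(2) 1] xr(2) \<pi>c(1) by auto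
    then have "?X <+> PIdl (\<pi> [^] M) = ?X" by (rule adj_absorb[OF X])
    then have fin_len: "fin_len ?X" using len_adj_pow_le[OF X \<pi>c(1), of M] fin_len_m m by simp
    have "?X \<subseteq> \<mm>" using in_m by (intro Idl_least m_ideal) auto
    then have "\<one> \<notin> ?X" using one_notin_m by blast
    then show False using length_gens_ge[OF carr(2) fin_len] length_xs by simp
  qed
  then have "finite S" using finite_nat_set_iff_bounded_le by blast
  moreover have "?X <+> PIdl (\<pi> [^] (0::nat)) = carrier R"
    using adj_upper(2)[OF X \<pi>c(2)[of 0]] by (intro ideal_eq_carrier adj) simp
  then have "0 \<in> S" using carr(1) by (simp add: S_def)
  ultimately obtain N where N: "N \<in> S" "\<And>k. k \<in> S \<Longrightarrow> k \<le> N"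
    using Max_in[of S] Max_ge[of S] by blast
  have fN: "f \<in> ?X <+> PIdl (\<pi> [^] N)" using N(1) by (simp add: S_def)
  then obtain x u where xu: "x \<in> ?X" "u \<in> carrier R" "f = x \<oplus> u \<otimes> \<pi> [^] N" unfolding mem_adj_iff by blast
  have xc: "x \<in> carrier R" using ideal_mem(1)[OF X xu(1)] .
  \<comment> \<open>A coefficient in \<mm> would raise the exponent of \<pi> by one, against the
    choice of \<open>N\<close>.\<close>
  have um: "u \<notin> \<mm>"
  proof
    assume "u \<in> \<mm>"
    then obtain y r where yr: "y \<in> ?X" "r \<in> carrier R" "u = y \<oplus> r \<otimes> \<pi>" unfolding m mem_adj_iff by blast
    have yc: "y \<in> carrier R" using ideal_mem(1)[OF X yr(1)] .
    have "f = (x \<oplus> y \<otimes> \<pi> [^] N) \<oplus> r \<otimes> \<pi> [^] Suc N"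
      unfolding xu(3) yr(3) nat_pow_Suc using xc yc yr(2) \<pi>c(1) \<pi>c(2)[of N] by algebra
    then have "Suc N \<in> S"
      using ideal_mem(3)[OF X xu(1) ideal_mem(7)[OF X \<pi>c(2) yr(1)]] yr(2) unfolding S_def mem_Collect_eq mem_adj_iff by blast
    then show False using N(2) by fastforce
  qed
  have Neq: "J = ?X <+> PIdl (\<pi> [^] N)"
  proof
    show "J \<subseteq> ?X <+> PIdl (\<pi> [^] N)" unfolding J by (intro adj_least adj adj_upper X \<pi>c fN)
    have "u \<otimes> \<pi> [^] N = f \<ominus> x" unfolding xu(3) using xc xu(2) \<pi>c(2)[of N] by algebra
    moreover have "f \<in> J" "x \<in> J" using xu(1) adj_upper[OF X carr(1)] unfolding J by auto
    ultimately have "u \<otimes> \<pi> [^] N \<in> J" using ideal_mem(4)[OF J_ideal] by simp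
    then have "\<pi> [^] N \<in> J" by (rule unit_mult_mem[OF J_ideal xu(2) um \<pi>c(2)])
    then show "?X <+> PIdl (\<pi> [^] N) \<subseteq> J"
      using adj_upper(1)[OF X carr(1)] unfolding J by (intro adj_least adj_ideal X carr)
  qed
  have "N \<noteq> 0"
  proof
    assume "N = 0"
    then have "J = carrier R" using Neq \<open>?X <+> PIdl (\<pi> [^] (0::nat)) = carrier R\<close> by simp
    then show False using J_le_m one_notin_m by blast
  qed
  \<comment> \<open>The regular system of parameters (\<pi>, xs) with exponents (N, 1, ..., 1) gives
    length exactly \<open>N\<close>, the extremality required by
    \<open>gorenstein_adj_pow\<close>.\<close>
  have "len (Idl (pows (\<pi> # xs) (N # replicate (length xs) 1))) = len (Idl (set (\<pi> # xs))) * prod_list (N # replicate (length xs) 1)"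
  proof (rule len_box)
    show "set (\<pi> # xs) \<subseteq> carrier R" using \<pi>c carr by simp
    show "length (\<pi> # xs) = d" "length (N # replicate (length xs) 1) = d" using length_xs by auto
    show "fin_len (Idl (set (\<pi> # xs)))" using \<pi>(2) fin_len_m by simp
    show "k \<le> p ^ N" if "k \<in> set (N # replicate (length xs) 1)" for k
      using that le_p_power[of N] p_pos[of N] by (auto simp: in_set_replicate)
  qed
  moreover have "pows xs (replicate (length xs) 1) = set xs"
    using carr(2) by (force simp: zip_replicate2 image_iff subset_iff)
  then have "pows (\<pi> # xs) (N # replicate (length xs) 1) = insert (\<pi> [^] N) (set xs)" by simp
  ultimately have "len (?X <+> PIdl (\<pi> [^] N)) = N * len (?X <+> PIdl \<pi>)"
    using \<pi>(2) m Idl_insert[OF carr(2) \<pi>c(2), of N] len_m by (simp add: prod_list_replicate)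
  then have "gorenstein (?X <+> PIdl (\<pi> [^] N))"
    using gorenstein_m fin_len_m \<open>N \<noteq> 0\<close> by (intro gorenstein_adj_pow X \<pi>(1)) (auto simp: m[symmetric])
  then show ?thesis using Neq by simp
qed

end

section \<open>Multiplicity of the hypersurface\<close>

text \<open>A slack entry turns the bound on the sum into an exact sum, and lists of fixed length
  and sum are counted by stars and bars.\<close>

lemma card_lists_sum_less:
  assumes "0 < k"
  shows "finite {b :: nat list. length b = m \<and> sum_list b < k}"
    "card {b :: nat list. length b = m \<and> sum_list b < k} = (k - 1 + m) choose m"
proof -
  have bij: "bij_betw (\<lambda>b. (k - 1 - sum_list b) # b) {b :: nat list. length b = m \<and> sum_list b < k}
      {l. length l = Suc m \<and> sum_list l = k - 1}"
  proof (rule bij_betw_byWitness[where f' = tl])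
    show "tl ` {l. length l = Suc m \<and> sum_list l = k - 1} \<subseteq> {b. length b = m \<and> sum_list b < k}"
      using assms by (auto simp: length_Suc_conv)
  qed (use assms in \<open>auto simp: length_Suc_conv\<close>)
  have c: "card {l :: nat list. length l = Suc m \<and> sum_list l = k - 1} = (k - 1 + m) choose (k - 1)"
    using card_length_sum_list[of "Suc m" "k - 1"] by simp
  have sym: "(k - 1 + m) choose (k - 1) = (k - 1 + m) choose m"
    by (subst binomial_symmetric) auto
  show "card {b :: nat list. length b = m \<and> sum_list b < k} = (k - 1 + m) choose m"
    using bij_betw_same_card[OF bij] c sym by simp
  have "finite {l :: nat list. length l = Suc m \<and> sum_list l = k - 1}"
    by (rule card_ge_0_finite) (subst c, simp)
  then show "finite {b :: nat list. length b = m \<and> sum_list b < k}"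
    using bij_betw_finite[OF bij] by (simp only:)
qed

context reduction_system begin

text \<open>The corresponding monomial ideal in \<open>f # xs\<close> is (f) + (xs)^k: a monomial is
  a generator as soon as it involves \<open>f\<close> or has degree at least \<open>k\<close> in
  \<open>xs\<close>.\<close>

definition tails :: "nat \<Rightarrow> nat list set" where
  "tails k = (#) 0 ` {b. length b = length xs \<and> sum_list b < k}"

lemma tails_iff: "a0 # b \<in> tails k \<longleftrightarrow> a0 = 0 \<and> length b = length xs \<and> sum_list b < k"
  by (auto simp: tails_def)

lemma card_tails:
  assumes "0 < k"
  shows "finite (tails k)" "card (tails k) = (k - 1 + length xs) choose length xs"
  unfolding tails_def using card_lists_sum_less[OF assms] by (auto simp: card_image)

text \<open>All exponents in \<open>tails k\<close> are below k \<le> p^k, apart from the zero at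
  \<open>f\<close>, so this set fits into a cube whose length is known exactly.\<close>

lemma len_monomial_ideal_tails:
  assumes "0 < k"
  shows "fin_len (monomial_ideal (f # xs) (tails k))" "len (monomial_ideal (f # xs) (tails k)) = len J * ((k - 1 + length xs) choose length xs)"
proof -
  have sub: "tails k \<subseteq> {a. length a = length (f # xs)}" by (auto simp: tails_def)
  show "fin_len (monomial_ideal (f # xs) (tails k))"
    by (rule len_monomial_ideal_le(1)[OF carr(3) fin_len_J card_tails(1)[OF assms] sub])
  let ?B = "{a. list_all2 (<) a (replicate d (p ^ k))}"
  have B: "finite ?B" "card ?B = (p ^ k) ^ d" "?B \<subseteq> {a. length a = length (f # xs)}"
    using finite_card_box[of "replicate d (p ^ k)"] length_xs by (auto dest: list_all2_lengthD)
  have "len (monomial_ideal (f # xs) (tails k)) = len (Idl (set (f # xs))) * card (tails k)"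
  proof (rule len_monomial_ideal_eq[OF carr(3) fin_len_J B(1,3)])
    show "len (monomial_ideal (f # xs) ?B) = len (Idl (set (f # xs))) * card ?B"
      using bracket_eq_monomial_ideal[OF carr(3), of k, unfolded length_xs] len_bracket[OF fin_len_J, of k] B(2) by metis
    show "tails k \<subseteq> ?B"
    proof
      fix a assume "a \<in> tails k"
      then obtain b where b: "a = 0 # b" "length b = length xs" "sum_list b < k" by (auto simp: tails_def)
      have "b ! i < p ^ k" if "i < length b" for i
        using elem_le_sum_list[OF that] b(3) le_p_power[of k] by simp
      then show "a \<in> ?B" using b(1,2) length_xs p_pos[of k] by (auto simp: list_all2_conv_all_nth nth_Cons split: nat.split)
    qed
    fix a i assume ai: "length a = length (f # xs)" "i < length (f # xs)" "a[i := Suc (a ! i)] \<in> tails k"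
    obtain a0 b where a: "a = a0 # b" "length b = length xs" using ai(1) by (cases a) auto
    obtain j where j: "i = Suc j" using ai(3) a by (cases i) (auto simp: tails_iff)
    then have "a0 = 0" "sum_list (b[j := Suc (b ! j)]) < k" "j < length b" using ai a by (auto simp: tails_iff)
    then show "a \<in> tails k" using a by (simp add: tails_iff sum_list_update)
  qed
  then show "len (monomial_ideal (f # xs) (tails k)) = len J * ((k - 1 + length xs) choose length xs)"
    using card_tails(2)[OF assms] by (simp add: J_def)
qed

lemma f_ipow_ideal: "ideal (PIdl f <+> ipow \<mm> k) R"
  by (intro add_ideals PIdl_ideal carr ipow_ideal m_ideal)

lemma fin_len_f_ipow: "fin_len (PIdl f <+> ipow \<mm> k)"
  by (intro fin_len_add_ipow PIdl_ideal carr)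

lemma monomial_ideal_tails_le: "monomial_ideal (f # xs) (tails k) \<subseteq> PIdl f <+> ipow \<mm> k"
proof (rule monomial_ideal_least[OF f_ipow_ideal])
  fix a assume a: "length a = length (f # xs)" "a \<notin> tails k"
  then obtain a0 b where b: "a = a0 # b" "length b = length xs" by (cases a) auto
  note up = add_ideal_upper[OF PIdl_ideal[OF carr(1)] ipow_ideal[OF m_ideal], of k]
  show "monomial (f # xs) a \<in> PIdl f <+> ipow \<mm> k"
  proof (cases "a0 = 0")
    case True
    then have "k \<le> sum_list b" using a(2) b by (auto simp: tails_iff)
    then have "monomial xs b \<in> ipow \<mm> k"
      using monomial_ipow[of xs b] in_m b(2) ipow_antimono[OF m_ideal] by auto
    then show ?thesis using True b up(2) carr(2) by auto
  next
    case False
    then have "monomial (f # xs) a \<in> PIdl f"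
      using monomial_dvd[OF carr(3) a(1), of 0 1] b carr(1) by simp
    then show ?thesis using up(1) by blast
  qed
qed

lemma ipow_reduction: "ipow \<mm> (Suc n + k) \<subseteq> PIdl f <+> (Idl (set xs)) \<cdot> ipow \<mm> (n + k)"
proof (induction k)
  case 0
  then show ?case using red by simp
next
  case (Suc k)
  let ?P = "(Idl (set xs)) \<cdot> ipow \<mm> (n + k)" and ?Q = "(Idl (set xs)) \<cdot> ipow \<mm> (n + Suc k)"
  note P = ideal_prod_is_ideal[OF Idl_xs ipow_ideal[OF m_ideal, of "n + k"]]
  note Q = ideal_prod_is_ideal[OF Idl_xs ipow_ideal[OF m_ideal, of "n + Suc k"]]
  have F: "ideal (PIdl f) R" using PIdl_ideal carr by blast
  have T: "ideal (PIdl f <+> ?Q) R" by (intro add_ideals F Q)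
  have "\<mm> \<cdot> ipow \<mm> (Suc n + k) \<subseteq> PIdl f <+> ?Q"
  proof (rule ideal_prod_least[OF T])
    fix x y assume x: "x \<in> \<mm>" and "y \<in> ipow \<mm> (Suc n + k)"
    then have "y \<in> PIdl f <+> ?P" using Suc by blast
    then obtain u v where uv: "u \<in> PIdl f" "v \<in> ?P" "y = u \<oplus> v" unfolding mem_add_iff by blast
    have xc: "x \<in> carrier R" using ideal_mem(1)[OF m_ideal x] .
    have "x \<otimes> v \<in> ?Q" using uv(2)
    proof (induction rule: ideal_prod.induct)
      case (prod i j)
      have "i \<otimes> (x \<otimes> j) \<in> ?Q" using mult_mem_ipow_Suc[OF x prod(2)] prod(1) by (intro ideal_prod.prod) auto
      then show ?case
        using ideal_mem(1)[OF Idl_xs prod(1)] ideal_mem(1)[OF ipow_ideal[OF m_ideal] prod(2)] xc by (simp add: m_ac)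
    next
      case (sum s t)
      then show ?case using ideal_mem(3)[OF Q sum(3,4)] ideal_mem(1)[OF P] xc by (simp add: r_distr)
    qed
    moreover have "x \<otimes> u \<in> PIdl f" using ideal_mem(6)[OF F xc uv(1)] .
    moreover have "x \<otimes> y = x \<otimes> u \<oplus> x \<otimes> v"
      using uv ideal_mem(1)[OF F uv(1)] ideal_mem(1)[OF P uv(2)] xc by (simp add: r_distr)
    ultimately show "x \<otimes> y \<in> PIdl f <+> ?Q" unfolding mem_add_iff by blast
  qed
  then show ?case by simp
qed

text \<open>Each application of \<open>ipow_reduction\<close> trades one factor \<mm> for one factor
  (xs), modulo \<open>f\<close>; the initial \<open>n\<close> factors are the price.\<close>

lemma ipow_le_monomial_ideal_tails: "ipow \<mm> (n + k) \<subseteq> monomial_ideal (f # xs) (tails k)"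
proof (induction k)
  case 0
  have "tails 0 = {}" by (simp add: tails_def)
  then show ?case using ideal_mem(1)[OF ipow_ideal[OF m_ideal]] monomial_ideal_empty[OF carr(3)] by auto
next
  case (Suc k)
  let ?T = "\<lambda>k. monomial_ideal (f # xs) (tails k)"
  have T: "ideal (?T k) R" for k by (rule monomial_ideal_ideal[OF carr(3)])
  have xT: "?T k \<subseteq> colon_ideal R (?T (Suc k)) {x}" if x: "x \<in> set xs" for x
  proof (rule monomial_ideal_least)
    have xc: "x \<in> carrier R" using x carr(2) by blast
    then show "ideal (colon_ideal R (?T (Suc k)) {x}) R" by (intro colon_ideal_ideal T) simp
    fix a assume a: "length a = length (f # xs)" "a \<notin> tails k"
    obtain a0 b where b: "a = a0 # b" "length b = length xs" using a(1) by (cases a) auto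
    obtain i where i: "i < length xs" "x = xs ! i" using x by (auto simp: in_set_conv_nth)
    have "a[Suc i := Suc (a ! Suc i)] \<notin> tails (Suc k)"
      using a(2) b i by (auto simp: tails_iff sum_list_update)
    then have "monomial (f # xs) (a[Suc i := Suc (a ! Suc i)]) \<in> ?T (Suc k)"
      using a(1) by (intro monomial_ideal_mem carr) auto
    moreover have "monomial (f # xs) (a[Suc i := Suc (a ! Suc i)]) = x \<otimes> monomial (f # xs) a"
      using monomial_Suc[OF carr(3) a(1), of "Suc i"] i by simp
    ultimately show "monomial (f # xs) a \<in> colon_ideal R (?T (Suc k)) {x}"
      using xc monomial_closed[OF carr(3), of a] by (simp add: colon_iff m_comm)
  qed
  have "(Idl (set xs)) \<cdot> ipow \<mm> (n + k) \<subseteq> ?T (Suc k)"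
  proof (rule ideal_prod_least[OF T])
    fix x y assume x: "x \<in> Idl (set xs)" and "y \<in> ipow \<mm> (n + k)"
    then have y: "y \<in> ?T k" using Suc by blast
    then have yc: "y \<in> carrier R" using ideal_mem(1)[OF T] by blast
    have "set xs \<subseteq> colon_ideal R (?T (Suc k)) {y}"
    proof
      fix z assume z: "z \<in> set xs"
      then have "y \<in> colon_ideal R (?T (Suc k)) {z}" "z \<in> carrier R" using xT[OF z] y carr(2) by auto
      then show "z \<in> colon_ideal R (?T (Suc k)) {y}" by (simp add: colon_iff m_comm)
    qed
    then have "Idl (set xs) \<subseteq> colon_ideal R (?T (Suc k)) {y}" using yc by (intro Idl_least colon_ideal_ideal T) simp_all
    then show "x \<otimes> y \<in> ?T (Suc k)" using x by (auto simp: colon_iff)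
  qed
  moreover have "f \<in> ?T (Suc k)"
    using monomial_ideal_mem[OF carr(3), of "1 # replicate (length xs) 0" "tails (Suc k)"] carr(1)
    by (simp add: tails_iff monomial_replicate_0)
  ultimately have "PIdl f <+> (Idl (set xs)) \<cdot> ipow \<mm> (n + k) \<subseteq> ?T (Suc k)"
    by (intro add_ideal_least PIdl_least T)
  then show ?case using ipow_reduction[of k] by simp
qed

text \<open>The ideal (f) + (xs)^k lies between (f) + \<mm>^(n+k) and (f) + \<mm>^k.\<close>

lemma len_f_ipow:
  assumes "0 < k"
  shows "len (PIdl f <+> ipow \<mm> k) \<le> len J * ((k - 1 + length xs) choose length xs)"
    "len J * ((k - 1 + length xs) choose length xs) \<le> len (PIdl f <+> ipow \<mm> (n + k))"
proof -
  note T = len_monomial_ideal_tails[OF assms]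
  show "len (PIdl f <+> ipow \<mm> k) \<le> len J * ((k - 1 + length xs) choose length xs)"
    unfolding T(2)[symmetric] by (intro len_mono T f_ipow_ideal monomial_ideal_tails_le)
  obtain k' where k: "k = Suc k'" using assms by (cases k) auto
  have "f \<in> monomial_ideal (f # xs) (tails k)"
    using monomial_ideal_mem[OF carr(3), of "1 # replicate (length xs) 0" "tails k"] carr(1)
    by (simp add: tails_iff monomial_replicate_0)
  then have "PIdl f <+> ipow \<mm> (n + k) \<subseteq> monomial_ideal (f # xs) (tails k)"
    by (intro add_ideal_least PIdl_least monomial_ideal_ideal carr ipow_le_monomial_ideal_tails)
  then show "len J * ((k - 1 + length xs) choose length xs) \<le> len (PIdl f <+> ipow \<mm> (n + k))"
    unfolding T(2)[symmetric] by (intro len_mono fin_len_f_ipow monomial_ideal_ideal carr)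
qed

end

section \<open>Ideals of a quotient ring\<close>

context cring begin

lemma Union_quot_image: "\<Union>(quot_image R K I) = K <+> I"
  by (auto simp: quot_image_def a_r_coset_def' set_add_def')

lemma quot_image_ideal: "\<lbrakk>ideal K R; ideal I R\<rbrakk> \<Longrightarrow> ideal (quot_image R K I) (R Quot K)"
  unfolding quot_image_def by (rule ring_ideal_imp_quot_ideal)

lemma coset_simps:
  assumes "ideal K R" "x \<in> carrier R" "y \<in> carrier R"
  shows "(K +> x) \<otimes>\<^bsub>R Quot K\<^esub> (K +> y) = K +> (x \<otimes> y)" "(K +> x) \<oplus>\<^bsub>R Quot K\<^esub> (K +> y) = K +> (x \<oplus> y)"
    "(K +> x) [^]\<^bsub>R Quot K\<^esub> (k::nat) = K +> (x [^] k)"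
proof -
  interpret h: ring_hom_ring R "R Quot K" "(+>) K" by (rule ideal.rcos_ring_hom_ring[OF assms(1)])
  show "(K +> x) \<otimes>\<^bsub>R Quot K\<^esub> (K +> y) = K +> (x \<otimes> y)" "(K +> x) \<oplus>\<^bsub>R Quot K\<^esub> (K +> y) = K +> (x \<oplus> y)"
    "(K +> x) [^]\<^bsub>R Quot K\<^esub> k = K +> (x [^] k)"
    using assms h.hom_mult h.hom_add h.hom_nat_pow[of x k] by auto
qed

lemma quot_image_prod:
  assumes "ideal K R" "ideal I R" "ideal J R"
  shows "quot_image R K I \<cdot>\<^bsub>R Quot K\<^esub> quot_image R K J = quot_image R K (I \<cdot> J)"
proof
  note sub = coset_simps[OF assms(1)]
  have IJ: "x \<in> I \<cdot> J \<Longrightarrow> x \<in> carrier R" for x using ideal_prod_in_carrier assms by blast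
  show "quot_image R K I \<cdot>\<^bsub>R Quot K\<^esub> quot_image R K J \<subseteq> quot_image R K (I \<cdot> J)"
  proof
    fix s assume "s \<in> quot_image R K I \<cdot>\<^bsub>R Quot K\<^esub> quot_image R K J"
    then show "s \<in> quot_image R K (I \<cdot> J)"
    proof (induction rule: ideal_prod.induct)
      case (prod i j)
      then obtain x y where "x \<in> I" "y \<in> J" "i = K +> x" "j = K +> y" by (auto simp: quot_image_def)
      then show ?case
        using sub(1)[of x y] ideal_mem(1)[OF assms(2)] ideal_mem(1)[OF assms(3)] ideal_prod.prod[of x I y J R]
        by (auto simp: quot_image_def)
    next
      case (sum s t)
      then obtain x y where "x \<in> I \<cdot> J" "y \<in> I \<cdot> J" "s = K +> x" "t = K +> y" by (auto simp: quot_image_def)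
      then show ?case using sub(2)[of x y] IJ ideal_prod.sum[of x R I J y] by (auto simp: quot_image_def)
    qed
  qed
  show "quot_image R K (I \<cdot> J) \<subseteq> quot_image R K I \<cdot>\<^bsub>R Quot K\<^esub> quot_image R K J"
    unfolding quot_image_def
  proof (rule image_subsetI)
    fix s assume "s \<in> I \<cdot> J"
    then show "K +> s \<in> (\<lambda>x. K +> x) ` I \<cdot>\<^bsub>R Quot K\<^esub> (\<lambda>x. K +> x) ` J"
    proof (induction rule: ideal_prod.induct)
      case (prod i j)
      then show ?case
        using sub(1)[of i j] ideal_mem(1)[OF assms(2)] ideal_mem(1)[OF assms(3)]
          ideal_prod.prod[of "K +> i" _ "K +> j" _ "R Quot K"] by (metis image_eqI)
    next
      case (sum s t)
      then show ?case using sub(2)[of s t] IJ ideal_prod.sum by metis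
    qed
  qed
qed

lemma quot_image_pow:
  assumes "ideal K R" "ideal I R"
  shows "quot_image R K I [^]\<^bsub>ideals_set (R Quot K)\<^esub> (k::nat) = quot_image R K (ipow I k)"
proof (induction k)
  case 0
  show ?case by (simp add: nat_pow_def ideals_set_def quot_image_def carrier_Quot)
next
  case (Suc k)
  have "quot_image R K I [^]\<^bsub>ideals_set (R Quot K)\<^esub> Suc k
      = (quot_image R K I [^]\<^bsub>ideals_set (R Quot K)\<^esub> k) \<cdot>\<^bsub>R Quot K\<^esub> quot_image R K I"
    by (simp add: nat_pow_def ideals_set_def)
  also have "\<dots> = quot_image R K (ipow I k \<cdot> I)"
    unfolding Suc by (intro quot_image_prod assms ipow_ideal)
  finally show ?case using ideal_prod_commute[OF ipow_ideal[OF assms(2)] assms(2)] by simp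
qed

lemma quot_image_Idl:
  assumes "ideal K R" "S \<subseteq> carrier R"
  shows "Idl\<^bsub>R Quot K\<^esub> ((\<lambda>x. K +> x) ` S) = quot_image R K (Idl S)"
proof
  interpret Q: cring "R Quot K" by (rule ideal.quotient_is_cring[OF assms(1) is_cring])
  interpret h: ring_hom_ring R "R Quot K" "(+>) K" by (rule ideal.rcos_ring_hom_ring[OF assms(1)])
  have c: "(\<lambda>x. K +> x) ` S \<subseteq> carrier (R Quot K)" using assms(2) by (auto simp: carrier_Quot)
  note I = genideal_ideal[OF assms(2)]
  show "Idl\<^bsub>R Quot K\<^esub> ((\<lambda>x. K +> x) ` S) \<subseteq> quot_image R K (Idl S)"
    using genideal_self[OF assms(2)] by (intro Q.Idl_least quot_image_ideal assms I) (auto simp: quot_image_def)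
  have "ideal {r \<in> carrier R. K +> r \<in> Idl\<^bsub>R Quot K\<^esub> ((\<lambda>x. K +> x) ` S)} R"
    by (rule h.ideal_vimage[OF Q.genideal_ideal[OF c]])
  then have "Idl S \<subseteq> {r \<in> carrier R. K +> r \<in> Idl\<^bsub>R Quot K\<^esub> ((\<lambda>x. K +> x) ` S)}"
    using Q.genideal_self[OF c] assms(2) by (intro Idl_least) auto
  then show "quot_image R K (Idl S) \<subseteq> Idl\<^bsub>R Quot K\<^esub> ((\<lambda>x. K +> x) ` S)"
    by (auto simp: quot_image_def)
qed

lemma prime_Union:
  assumes "ideal K R" "primeideal P (R Quot K)"
  shows "primeideal (\<Union>P) R"
proof -
  interpret P: primeideal P "R Quot K" by fact
  have Pc: "P \<subseteq> carrier (R Quot K)" using P.a_subset .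
  note mem = canonical_proj_vimage_mem_iff[OF assms(1) Pc]
  show ?thesis
  proof (rule primeidealI)
    show "ideal (\<Union>P) R" by (rule quot_ideal_imp_ring_ideal[OF assms(1) P.is_ideal])
    show "cring R" by (rule is_cring)
    show "carrier R \<noteq> \<Union>P"
    proof
      assume "carrier R = \<Union>P"
      then have "carrier (R Quot K) \<subseteq> P" using mem by (auto simp: carrier_Quot)
      then show False using P.I_notcarr Pc by blast
    qed
    fix a b assume ab: "a \<in> carrier R" "b \<in> carrier R" "a \<otimes> b \<in> \<Union>P"
    then have "(K +> a) \<otimes>\<^bsub>R Quot K\<^esub> (K +> b) \<in> P" using mem[of "a \<otimes> b"] coset_simps(1)[OF assms(1)] by auto
    then show "a \<in> \<Union>P \<or> b \<in> \<Union>P"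
      using P.I_prime[of "K +> a" "K +> b"] mem ab by (auto simp: carrier_Quot)
  qed
qed

end

section \<open>Limits\<close>

text \<open>For large \<open>k\<close> the binomial coefficient is a polynomial of degree
  \<open>m\<close> with leading coefficient 1/m!. The shift \<open>n\<close> is arbitrary so that
  both sides of the sandwich for the multiplicity are covered.\<close>

lemma binomial_div_power_tendsto:
  "(\<lambda>k. real ((k - n - 1 + m) choose m) / real k ^ m) \<longlonglongrightarrow> 1 / fact m"
proof -
  have 1: "(\<lambda>k. (real k + c) / real k) \<longlonglongrightarrow> 1" for c :: real
  proof -
    have "(\<lambda>k. 1 + c / real k) \<longlonglongrightarrow> 1 + 0"
      by (intro tendsto_intros lim_const_over_n)
    moreover have "eventually (\<lambda>k. 1 + c / real k = (real k + c) / real k) sequentially"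
      using eventually_gt_at_top[of 0] by eventually_elim (simp add: field_simps)
    ultimately show ?thesis by (auto elim: Lim_transform_eventually)
  qed
  have "(\<lambda>k. (\<Prod>i=0..<m. (real k + (real m - real n - 1 - real i)) / real k) / fact m) \<longlonglongrightarrow> (\<Prod>i=0..<m. 1) / fact m"
    by (intro tendsto_divide tendsto_prod 1 tendsto_const) simp
  moreover have "eventually (\<lambda>k. (\<Prod>i=0..<m. (real k + (real m - real n - 1 - real i)) / real k) / fact m
      = real ((k - n - 1 + m) choose m) / real k ^ m) sequentially"
    using eventually_gt_at_top[of n]
  proof eventually_elim
    case (elim k)
    then have km: "real (k - n - 1 + m) = real k + (real m - real n - 1)" by (simp add: of_nat_diff)
    have "real ((k - n - 1 + m) choose m) = (\<Prod>i=0..<m. real k + (real m - real n - 1) - real i) / fact m"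
      by (simp only: binomial_gbinomial gbinomial_prod_rev km)
    then show ?case by (simp add: prod_dividef algebra_simps)
  qed
  ultimately show ?thesis by (auto elim: Lim_transform_eventually)
qed

context reduction_system begin

lemma hs_multiplicity_quotient:
  assumes "krull_dim (R Quot PIdl f) = enat (length xs)"
  shows "hs_multiplicity (R Quot PIdl f) (quot_image R (PIdl f) \<mm>) = real (len J)"
proof -
  let ?m = "length xs" and ?F = "PIdl f"
  let ?c = "\<lambda>n k. real ((k - n - 1 + ?m) choose ?m) / real k ^ ?m"
  have F: "ideal ?F R" using PIdl_ideal carr by blast
  have col: "colength (R Quot ?F) (quot_image R ?F \<mm> [^]\<^bsub>ideals_set (R Quot ?F)\<^esub> k) = len (?F <+> ipow \<mm> k)" for k :: nat
  proof -
    have "colength (R Quot ?F) (quot_image R ?F (ipow \<mm> k)) = len (\<Union>(quot_image R ?F (ipow \<mm> k)))"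
      by (intro colength_quot_eq_len F quot_image_ideal ipow_ideal m_ideal) (simp add: Union_quot_image fin_len_f_ipow)
    then show ?thesis by (simp add: quot_image_pow F m_ideal Union_quot_image)
  qed
  have "(\<lambda>k. real (len (?F <+> ipow \<mm> k)) / real k ^ ?m) \<longlonglongrightarrow> real (len J) * (1 / fact ?m)"
  proof (rule tendsto_sandwich)
    show "(\<lambda>k. real (len J) * ?c n k) \<longlonglongrightarrow> real (len J) * (1 / fact ?m)"
      by (intro tendsto_mult tendsto_const binomial_div_power_tendsto)
    show "(\<lambda>k. real (len J) * ?c 0 k) \<longlonglongrightarrow> real (len J) * (1 / fact ?m)"
      by (intro tendsto_mult tendsto_const binomial_div_power_tendsto)
    show "eventually (\<lambda>k. real (len J) * ?c n k \<le> real (len (?F <+> ipow \<mm> k)) / real k ^ ?m) sequentially"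
      using eventually_gt_at_top[of n]
    proof eventually_elim
      case (elim k)
      then have "len J * ((k - n - 1 + ?m) choose ?m) \<le> len (?F <+> ipow \<mm> k)"
        using len_f_ipow(2)[of "k - n"] by simp
      then have "real (len J) * real ((k - n - 1 + ?m) choose ?m) \<le> real (len (?F <+> ipow \<mm> k))"
        by (metis of_nat_le_iff of_nat_mult)
      then show ?case by (simp add: divide_right_mono)
    qed
    show "eventually (\<lambda>k. real (len (?F <+> ipow \<mm> k)) / real k ^ ?m \<le> real (len J) * ?c 0 k) sequentially"
      using eventually_gt_at_top[of 0]
    proof eventually_elim
      case (elim k)
      then have "len (?F <+> ipow \<mm> k) \<le> len J * ((k - 0 - 1 + ?m) choose ?m)"
        using len_f_ipow(1)[of k] by simp
      then have "real (len (?F <+> ipow \<mm> k)) \<le> real (len J) * real ((k - 0 - 1 + ?m) choose ?m)"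
        by (metis of_nat_le_iff of_nat_mult)
      then show ?case unfolding times_divide_eq_right by (rule divide_right_mono) simp
    qed
  qed
  then show ?thesis by (simp add: hs_multiplicity_def assms col limI)
qed

end

section \<open>The functions attached to the maximal ideal\<close>

context regular_char_p_ring begin

lemma p0: "0 < p" using p_pos[of 1] by simp

lemma fin_len_PIdl_add: "\<lbrakk>fin_len B; u \<in> carrier R\<rbrakk> \<Longrightarrow> fin_len (PIdl u <+> B)"
  using fin_len_sup add_ideal_upper(2)[OF PIdl_ideal] add_ideals[OF PIdl_ideal] fin_len_ideal by blast

definition hseq :: "'a \<Rightarrow> real \<Rightarrow> nat \<Rightarrow> real" where
  "hseq f t e = real (len (PIdl (f [^] nat \<lceil>t * real (p ^ e)\<rceil>) <+> mq e)) / real (p ^ (e * d))"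

lemma h_fun_m: "f \<in> carrier R \<Longrightarrow> h_fun R p d f \<mm> t = lim (hseq f t)"
  unfolding h_fun_def hseq_def[abs_def] by (simp add: colength_eq_len fin_len_PIdl_add fin_len_mq)

text \<open>\<open>(f\<^sup>a, \<mm>\<^sup>[\<^sup>q\<^sup>])\<^sup>[\<^sup>p\<^sup>] \<subseteq> (f\<^sup>a\<^sup>', \<mm>\<^sup>[\<^sup>p\<^sup>q\<^sup>])\<close> for \<open>a' = \<lceil>tpq\<rceil> \<le> p\<lceil>tq\<rceil> = pa\<close>, so Kunz makes the
  sequence decreasing.\<close>

lemma hseq_decreasing:
  assumes "f \<in> carrier R"
  shows "hseq f t (Suc e) \<le> hseq f t e"
proof -
  define a where "a = nat \<lceil>t * real (p ^ e)\<rceil>"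
  define a' where "a' = nat \<lceil>t * real (p ^ Suc e)\<rceil>"
  have fp: "f [^] k \<in> carrier R" for k :: nat using assms by simp
  have "a' \<le> a * p"
  proof -
    have "t * real (p ^ e) \<le> real a" unfolding a_def by linarith
    then have "t * real (p ^ e) * real p \<le> real a * real p" by (rule mult_right_mono) simp
    then have "t * real (p ^ Suc e) \<le> real_of_int (int (a * p))" by (simp add: mult_ac)
    then have "\<lceil>t * real (p ^ Suc e)\<rceil> \<le> int (a * p)" by (simp only: ceiling_le_iff)
    then show ?thesis unfolding a'_def by (simp only: nat_le_iff)
  qed
  let ?A = "PIdl (f [^] a) <+> mq e" and ?A' = "PIdl (f [^] a') <+> mq (Suc e)"
  have A: "fin_len ?A" by (intro fin_len_PIdl_add fin_len_mq fp)
  have A': "ideal ?A' R" by (intro add_ideals PIdl_ideal fp mq_ideal)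
  have "bracket_power R ?A (p ^ 1) = PIdl ((f [^] a) [^] (p ^ 1)) <+> mq (e + 1)"
    unfolding PIdl_add_comm[OF mq_ideal fp] bracket_adj[OF mq_ideal fp] bracket_bracket[OF m_ideal]
    by (rule PIdl_add_comm[OF mq_ideal, symmetric]) (use fp in simp)
  also have "\<dots> = PIdl (f [^] (a * p)) <+> mq (Suc e)" using assms by (simp add: nat_pow_pow)
  also have "\<dots> \<subseteq> ?A'"
    using \<open>a' \<le> a * p\<close> assms by (intro add_ideal_mono order_refl PIdl_least PIdl_ideal fp pow_in_PIdl)
  finally have "len ?A' \<le> len (bracket_power R ?A (p ^ 1))" by (intro len_mono fin_len_bracket A A')
  also have "\<dots> = len ?A * p ^ d" using len_bracket[OF A, of 1] by simp
  finally have "real (len ?A') \<le> real (len ?A) * real (p ^ d)" by (metis of_nat_le_iff of_nat_mult)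
  then have "real (len ?A') / real (p ^ (Suc e * d)) \<le> real (len ?A) * real (p ^ d) / real (p ^ (Suc e * d))"
    by (rule divide_right_mono) simp
  also have "\<dots> = real (len ?A) / real (p ^ (e * d))"
    using p_pos[of 1] by (simp add: power_add)
  finally show ?thesis unfolding hseq_def a_def a'_def .
qed

lemma hseq_tendsto:
  assumes "f \<in> carrier R"
  shows "hseq f t \<longlonglongrightarrow> h_fun R p d f \<mm> t"
proof -
  have "decseq (hseq f t)" by (rule decseq_SucI) (rule hseq_decreasing[OF assms])
  moreover have "0 \<le> hseq f t e" for e by (simp add: hseq_def)
  ultimately obtain l where "hseq f t \<longlonglongrightarrow> l" using decseq_convergent by blast
  then show ?thesis by (simp add: h_fun_m[OF assms] limI)
qed

text \<open>The length q^d of R/\<mm>^[q] splits into the colengths of (f^k) + \<mm>^[q] and of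
  \<mm>^[q] : f^k.\<close>

lemma F_signature_eq:
  assumes "f \<in> carrier R"
  shows "F_signature R p d \<mm> f t = 1 - h_fun R p d f \<mm> t"
proof -
  have "real (colength R (colon_ideal R (mq e) {f [^] nat \<lceil>t * real (p ^ e)\<rceil>})) / real (p ^ (e * d)) = 1 - hseq f t e" for e
  proof -
    define k where "k = nat \<lceil>t * real (p ^ e)\<rceil>"
    have fp: "f [^] k \<in> carrier R" using assms by simp
    have "fin_len (colon_ideal R (mq e) {f [^] k})"
      using fin_len_sup[OF fin_len_mq colon_ideal_ideal colon_upper] mq_ideal fp by blast
    moreover have "len_mq e = len (PIdl (f [^] k) <+> mq e) + len (colon_ideal R (mq e) {f [^] k})"
      unfolding len_mq_def PIdl_add_comm[OF mq_ideal fp] by (rule len_adj_colon'[OF fin_len_mq fp])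
    then have "real (len_mq e) = real (len (PIdl (f [^] k) <+> mq e)) + real (len (colon_ideal R (mq e) {f [^] k}))"
      by (metis of_nat_add)
    moreover have "real (len_mq e) = real (p ^ (e * d))" by (simp add: len_mq_eq power_mult)
    moreover have "real (p ^ (e * d)) > 0" using p_pos by (simp only: of_nat_0_less_iff)
    ultimately show ?thesis unfolding hseq_def k_def[symmetric] by (simp add: colength_eq_len field_simps)
  qed
  then have "F_signature R p d \<mm> f t = lim (\<lambda>e. 1 - hseq f t e)" by (simp add: F_signature_def)
  also have "\<dots> = 1 - h_fun R p d f \<mm> t"
    by (intro limI tendsto_diff tendsto_const hseq_tendsto assms)
  finally show ?thesis .
qed

text \<open>Replacing (a, e) by (a p^k, e + k) multiplies the length by p^(k d), by Kunz. So the
  quotient does not depend on how the argument is written, and the description in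
  \<open>phi_fun\<close> has a unique solution.\<close>

lemma phi_fun_eq:
  assumes "f \<in> carrier R" "a \<le> p ^ e"
  shows "phi_fun R p d \<mm> f (real a / real (p ^ e)) = real (len (PIdl (f [^] a) <+> mq e)) / real (p ^ (e * d))"
proof -
  have fp: "f [^] k \<in> carrier R" for k :: nat using assms by simp
  let ?g = "\<lambda>a e. real (len (PIdl (f [^] a) <+> mq e)) / real (p ^ (e * d))"
  have col: "colength R (mq e <+> PIdl (f [^] a)) = len (PIdl (f [^] a) <+> mq e)" for a e :: nat
    using colength_eq_len[OF fin_len_PIdl_add[OF fin_len_mq fp]] PIdl_add_comm[OF mq_ideal fp] by metis
  have scale: "?g (a * p ^ k) (e + k) = ?g a e" for a e k :: nat
  proof -
    have A: "fin_len (PIdl (f [^] a) <+> mq e)" by (intro fin_len_PIdl_add fin_len_mq fp)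
    have "bracket_power R (PIdl (f [^] a) <+> mq e) (p ^ k) = PIdl ((f [^] a) [^] (p ^ k)) <+> mq (e + k)"
      unfolding PIdl_add_comm[OF mq_ideal fp] bracket_adj[OF mq_ideal fp] bracket_bracket[OF m_ideal]
      by (rule PIdl_add_comm[OF mq_ideal, symmetric]) (use fp in simp)
    then have "len (PIdl (f [^] (a * p ^ k)) <+> mq (e + k)) = len (PIdl (f [^] a) <+> mq e) * (p ^ k) ^ d"
      using len_bracket[OF A, of k] assms(1) by (simp add: nat_pow_pow)
    moreover have "p ^ ((e + k) * d) = p ^ (e * d) * (p ^ k) ^ d"
      by (simp add: power_add power_mult add_mult_distrib)
    moreover have "real ((p ^ k) ^ d) > 0" using p_pos[of k] by (simp only: of_nat_0_less_iff zero_less_power)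
    ultimately show ?thesis using p0 by (simp only: of_nat_mult) (simp add: field_simps)
  qed
  have "?g a' e' = ?g a e" if eq: "real a / real (p ^ e) = real a' / real (p ^ e')" for a' e'
  proof -
    have pos: "real (p ^ e) > 0" "real (p ^ e') > 0" using p_pos by (simp_all only: of_nat_0_less_iff)
    then have "real a * real (p ^ e') = real a' * real (p ^ e)" using eq by (simp add: frac_eq_eq)
    then have "real (a * p ^ e') = real (a' * p ^ e)" by (simp only: of_nat_mult)
    then have "a * p ^ e' = a' * p ^ e" by (simp only: of_nat_eq_iff)
    then show ?thesis using scale[of a e' e] scale[of a' e e'] by (simp only: add.commute)
  qed
  then show ?thesis
    unfolding phi_fun_def col using assms(2) by (intro the_equality) (metis, blast)
qed

end

section \<open>Passage to the limit\<close>

context parameter_system begin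

text \<open>Modulo \<mm>^[q], the factor of f^b R by f^(b+1) R is a quotient of R/(f, \<mm>^[q]).
  Its length is of order q^(d-1), so exponents that differ by one give the same limit.\<close>

lemma len_f_pow_Suc:
  "len (PIdl (f [^] Suc b) <+> mq e) \<le> len (PIdl (f [^] b) <+> mq e) + (p ^ e) ^ length xs * len J"
proof -
  have fp: "f [^] k \<in> carrier R" for k :: nat using carr by simp
  let ?X = "mq e <+> PIdl (f [^] Suc b)"
  have X: "fin_len ?X" using fin_len_PIdl_add[OF fin_len_mq fp] PIdl_add_comm[OF mq_ideal fp] by metis
  have "mq e <+> PIdl f \<subseteq> colon_ideal R ?X {f [^] b}"
    using adj_colon_pow[OF mq_ideal carr(1), of b "Suc b" e] carr by simp
  moreover have "ideal (colon_ideal R ?X {f [^] b}) R" using fin_len_ideal[OF X] fp by (intro colon_ideal_ideal) auto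
  moreover have "fin_len (mq e <+> PIdl f)" using fin_len_PIdl_add[OF fin_len_mq carr(1)] PIdl_add_comm[OF mq_ideal carr(1)] by metis
  ultimately have "len (colon_ideal R ?X {f [^] b}) \<le> len (mq e <+> PIdl f)" by (intro len_mono)
  moreover have "len ?X = len (mq e <+> PIdl (f [^] b)) + len (colon_ideal R ?X {f [^] b})"
    using len_adj_colon'[OF X fp[of b]] adj_pow_adj[OF mq_ideal carr(1), of b "Suc b" e] by simp
  ultimately show ?thesis
    using len_f_mq_le[of e] unfolding PIdl_add_comm[OF mq_ideal fp] PIdl_add_comm[OF mq_ideal carr(1)] by simp
qed

lemma inverse_p_power_tendsto: "(\<lambda>e. c / real (p ^ e)) \<longlonglongrightarrow> 0"
proof -
  have "1 < real p" using prime_gt_1_nat[OF p_prime] by simp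
  then have "(\<lambda>e. c * inverse (real p ^ e)) \<longlonglongrightarrow> c * 0"
    by (intro tendsto_mult tendsto_const LIMSEQ_inverse_realpow_zero)
  then show ?thesis by (simp add: divide_inverse)
qed

lemma h_fun_reflection:
  assumes g: "gorenstein J" and t: "0 \<le> t" "t \<le> 1"
  shows "h_fun R p d f (colon_ideal R J \<mm>) (1 - t) = h_fun R p d f \<mm> t - real (len J) * (t - 1) - 1"
proof -
  let ?q = "\<lambda>e. real (p ^ e)"
  define b where "b e = nat \<lfloor>t * ?q e\<rfloor>" for e
  define r where "r e = real (len (PIdl (f [^] b e) <+> mq e)) / real (p ^ (e * d))" for e
  have fp: "f [^] k \<in> carrier R" for k :: nat using carr by simp
  have qpos: "?q e > 0" for e using p_pos by (simp only: of_nat_0_less_iff)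
  have qd: "real (p ^ (e * d)) = ?q e * ?q e ^ length xs" for e
    using length_xs by (simp add: power_mult flip: power_Suc)
  have bq: "b e \<le> p ^ e" "real (b e) \<le> t * ?q e" "t * ?q e < real (b e) + 1" for e
  proof -
    have tq: "0 \<le> t * ?q e" "t * ?q e \<le> ?q e" using t qpos[of e] by (auto simp: mult_left_le_one_le)
    then show *: "real (b e) \<le> t * ?q e" "t * ?q e < real (b e) + 1" unfolding b_def by linarith+
    have "real (b e) \<le> ?q e" using * tq by linarith
    then show "b e \<le> p ^ e" by (simp only: of_nat_le_iff)
  qed
  have ceil: "nat \<lceil>(1 - t) * ?q e\<rceil> = p ^ e - b e" for e
  proof -
    have "\<lceil>(1 - t) * ?q e\<rceil> = int (p ^ e - b e)"
      using bq[of e] by (intro ceiling_unique) (auto simp: of_nat_diff algebra_simps)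
    then show ?thesis by simp
  qed
  \<comment> \<open>Reflection with exponent q - b, divided by q^d: the term b q^(d-1) len J becomes
    len J times b/q.\<close>
  have summand: "real (colength R (PIdl (f [^] nat \<lceil>(1 - t) * ?q e\<rceil>) <+> bracket_power R (colon_ideal R J \<mm>) (p ^ e)))
      / real (p ^ (e * d)) = real (len J) - real (len J) * (real (b e) / ?q e) - 1 + r e" for e
  proof -
    let ?X = "PIdl (f [^] (p ^ e - b e)) <+> bracket_power R (colon_ideal R J \<mm>) (p ^ e)"
    have "fin_len ?X" by (intro fin_len_PIdl_add fin_len_bracket fin_len_colon_J fp)
    then have col: "colength R ?X = len ?X" by (rule colength_eq_len)
    have "len ?X + b e * ((p ^ e) ^ length xs * len J) + (p ^ e) ^ d
        = len J * (p ^ e) ^ d + len (PIdl (f [^] b e) <+> mq e)"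
      using colength_reflection[OF g, of "p ^ e - b e" e] bq(1)[of e] by simp
    then have "real (len ?X) + real (b e) * (?q e ^ length xs * real (len J)) + real (p ^ (e * d))
        = real (len J) * real (p ^ (e * d)) + real (len (PIdl (f [^] b e) <+> mq e))"
      by (simp only: power_mult of_nat_add[symmetric] of_nat_mult[symmetric] of_nat_power[symmetric])
    then have "real (len ?X) = real (len J) * real (p ^ (e * d)) + real (len (PIdl (f [^] b e) <+> mq e))
        - real (b e) * (?q e ^ length xs * real (len J)) - real (p ^ (e * d))" by linarith
    then show ?thesis
      unfolding ceil col r_def qd using p0 by (simp add: field_simps)
  qed
  have rlim: "r \<longlonglongrightarrow> h_fun R p d f \<mm> t"
  proof (rule tendsto_sandwich)
    \<comment> \<open>\<open>r\<close> rounds down and \<open>hseq\<close> rounds up, so they agree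
      up to one power of \<open>f\<close>.\<close>
    have diff: "r e \<le> hseq f t e \<and> hseq f t e \<le> r e + real (len J) / ?q e" for e
    proof -
      let ?l = "\<lambda>k. len (PIdl (f [^] k) <+> mq e)"
      define c where "c = nat \<lceil>t * ?q e\<rceil>"
      have c: "c = b e \<or> c = Suc (b e)" using bq(2,3)[of e] unfolding c_def by linarith
      have "?l (b e) \<le> ?l (Suc (b e))"
        by (intro len_mono fin_len_PIdl_add fin_len_mq fp add_ideals PIdl_ideal mq_ideal add_ideal_mono order_refl
            PIdl_least pow_in_PIdl carr) simp
      then have "?l (b e) \<le> ?l c \<and> ?l c \<le> ?l (b e) + (p ^ e) ^ length xs * len J"
        using c len_f_pow_Suc[of "b e" e] by auto
      then have le: "real (?l (b e)) \<le> real (?l c)" "real (?l c) \<le> real (?l (b e)) + ?q e ^ length xs * real (len J)"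
        by (simp_all only: of_nat_le_iff of_nat_add[symmetric] of_nat_mult[symmetric] of_nat_power[symmetric])
      have D: "real (p ^ (e * d)) > 0" using p_pos by (simp only: of_nat_0_less_iff)
      have "hseq f t e \<le> (real (?l (b e)) + ?q e ^ length xs * real (len J)) / real (p ^ (e * d))"
        unfolding hseq_def c_def[symmetric] using le(2) D by (intro divide_right_mono) auto
      also have "\<dots> = r e + real (len J) / ?q e"
        unfolding r_def qd using p0 by (simp add: field_simps)
      finally show ?thesis
        unfolding r_def hseq_def c_def[symmetric] using le(1) D by (simp add: divide_right_mono)
    qed
    show "eventually (\<lambda>e. hseq f t e - real (len J) / ?q e \<le> r e) sequentially"
      "eventually (\<lambda>e. r e \<le> hseq f t e) sequentially"
      using diff by (auto simp: algebra_simps)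
    show "(\<lambda>e. hseq f t e - real (len J) / ?q e) \<longlonglongrightarrow> h_fun R p d f \<mm> t"
      using tendsto_diff[OF hseq_tendsto[OF carr(1)] inverse_p_power_tendsto] by simp
  qed (rule hseq_tendsto[OF carr(1)])
  have blim: "(\<lambda>e. real (b e) / ?q e) \<longlonglongrightarrow> t"
  proof (rule tendsto_sandwich)
    have "t \<le> (real (b e) + 1) / ?q e" "real (b e) / ?q e \<le> t" for e
      using bq(2,3)[of e] qpos[of e] by (simp_all only: pos_le_divide_eq pos_divide_le_eq less_imp_le)
    then show "eventually (\<lambda>e. t - 1 / ?q e \<le> real (b e) / ?q e) sequentially"
      "eventually (\<lambda>e. real (b e) / ?q e \<le> t) sequentially"
      by (auto simp: add_divide_distrib diff_le_eq)
    show "(\<lambda>e. t - 1 / ?q e) \<longlonglongrightarrow> t"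
      using tendsto_diff[OF tendsto_const inverse_p_power_tendsto, of t 1] by simp
  qed (rule tendsto_const)
  have "(\<lambda>e. real (len J) - real (len J) * (real (b e) / ?q e) - 1 + r e)
      \<longlonglongrightarrow> real (len J) - real (len J) * t - 1 + h_fun R p d f \<mm> t"
    by (intro tendsto_intros blim rlim)
  then show ?thesis
    unfolding h_fun_def[of R p d f "colon_ideal R J \<mm>"] summand by (simp add: limI algebra_simps)
qed

text \<open>By duality J : \<mm> has colength 2 - 1, and the only ideal of colength one is
  \<mm>.\<close>

lemma colon_J_eq_m:
  assumes "gorenstein J" "len J = 2"
  shows "colon_ideal R J \<mm> = \<mm>"
proof -
  have C: "fin_len (colon_ideal R J \<mm>)" "len (colon_ideal R J \<mm>) = 1"
    using fin_len_colon_J len_colon_J[OF assms(1)] assms(2) by auto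
  have "\<one> \<notin> colon_ideal R J \<mm>"
  proof
    assume "\<one> \<in> colon_ideal R J \<mm>"
    then have "colon_ideal R J \<mm> = carrier R" by (rule ideal_eq_carrier[OF fin_len_ideal[OF C(1)]])
    then show False using C(2) by simp
  qed
  then have "colon_ideal R J \<mm> \<subseteq> \<mm>" by (rule proper_ideal_le_m[OF fin_len_ideal[OF C(1)]])
  then show ?thesis using len_eq_imp_eq[OF C(1) m_ideal] C(2) by simp
qed

text \<open>No limit is involved: for t = a/q the exponents are integers, and one reflection,
  divided by q^d, is the whole formula.\<close>

lemma phi_fun_reflection:
  assumes g: "gorenstein J" and J2: "len J = 2" and t: "t \<in> {0..1} \<inter> Z_inv p"
  shows "phi_fun R p d \<mm> f (1 - t) = phi_fun R p d \<mm> f t - 2 * t + 1"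
proof -
  obtain z e where z: "t = of_int z / real (p ^ e)" using t by (auto simp: Z_inv_def)
  have qpos: "real (p ^ e) > 0" using p_pos by (simp only: of_nat_0_less_iff)
  have "0 \<le> real_of_int z" using t qpos unfolding z by (simp only: Int_iff atLeastAtMost_iff zero_le_divide_iff) linarith
  then have "0 \<le> z" by simp
  then obtain a where a: "z = int a" by (metis nonneg_int_cases)
  have ta: "t = real a / real (p ^ e)" using z a by simp
  then have "real a \<le> real (p ^ e)" using t qpos unfolding ta by (simp only: Int_iff atLeastAtMost_iff divide_le_eq_1_pos)
  then have ale: "a \<le> p ^ e" by (simp only: of_nat_le_iff)
  then have t1: "1 - t = real (p ^ e - a) / real (p ^ e)" using qpos ta by (simp add: of_nat_diff field_simps)
  have phi: "phi_fun R p d \<mm> f (1 - t) = real (len (PIdl (f [^] (p ^ e - a)) <+> mq e)) / real (p ^ (e * d))"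
    "phi_fun R p d \<mm> f t = real (len (PIdl (f [^] a) <+> mq e)) / real (p ^ (e * d))"
    using phi_fun_eq[OF carr(1) diff_le_self, of e a] phi_fun_eq[OF carr(1) ale]
    by (simp_all only: t1[symmetric] ta[symmetric])
  have "len (PIdl (f [^] (p ^ e - a)) <+> mq e) + a * ((p ^ e) ^ length xs * 2) + (p ^ e) ^ d
      = 2 * (p ^ e) ^ d + len (PIdl (f [^] a) <+> mq e)"
    using colength_reflection[OF g, of "p ^ e - a" e] ale J2 colon_J_eq_m[OF g J2] by simp
  then have "real (len (PIdl (f [^] (p ^ e - a)) <+> mq e)) + real a * (real (p ^ e) ^ length xs * 2) + real (p ^ (e * d))
      = 2 * real (p ^ (e * d)) + real (len (PIdl (f [^] a) <+> mq e))"
    by (drule_tac arg_cong[where f = real]) (simp add: power_mult)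
  then have eq: "real (len (PIdl (f [^] (p ^ e - a)) <+> mq e)) = real (p ^ (e * d))
      + real (len (PIdl (f [^] a) <+> mq e)) - real a * (real (p ^ e) ^ length xs * 2)" by linarith
  have qd: "real (p ^ (e * d)) = real (p ^ e) * real (p ^ e) ^ length xs"
    using length_xs by (simp add: power_mult flip: power_Suc)
  show ?thesis
    unfolding phi unfolding eq ta unfolding qd using p0 by (simp add: field_simps)
qed

end

section \<open>The reflection formula\<close>

lemma (in domain) ring_char_prime:
  assumes "ring_char R = p" "0 < p"
  shows "Factorial_Ring.prime p" "add_pow R p \<one> = \<zero>"
proof -
  have dvd: "add_pow R n \<one> = \<zero> \<longleftrightarrow> p dvd n" for n :: nat
    using group.pow_eq_id[OF a_group, of \<one> n] assms(1) by (simp add: ring_char_def add_pow_def)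
  then show "add_pow R p \<one> = \<zero>" by simp
  have "p \<noteq> 1" using dvd[of 1] by auto
  moreover have "p dvd a \<or> p dvd b" if "p dvd a * b" for a b
  proof -
    have "add_pow R a \<one> \<otimes> add_pow R b \<one> = add_pow R b (add_pow R a \<one>)"
      using add_pow_rdistr[of "add_pow R a \<one>" \<one> b] by simp
    also have "\<dots> = add_pow R (a * b) \<one>" by (simp add: add.nat_pow_pow)
    also have "\<dots> = \<zero>" using dvd that by blast
    finally show ?thesis using integral[of "add_pow R a \<one>" "add_pow R b \<one>"] dvd by auto
  qed
  ultimately show "Factorial_Ring.prime p"
    using assms(2) by (intro normalization_semidom_class.primeI prime_elemI) auto
qed

section \<open>From the hypotheses on I to parameters in R\<close>

context regular_char_p_ring begin

text \<open>Each of the finitely many generators of \<mm> has a power in the preimage of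
  \<open>I\<close>, and a common Frobenius power suffices for all of them.\<close>

lemma primary_fl:
  assumes K: "ideal K R" "K \<subseteq> \<mm>" and I: "ideal I (R Quot K)"
    and prim: "primary_to (R Quot K) (quot_image R K \<mm>) I"
  shows "fin_len (\<Union>I)"
proof -
  have Un: "ideal (\<Union>I) R" by (rule quot_ideal_imp_ring_ideal[OF K(1) I])
  have Ic: "I \<subseteq> carrier (R Quot K)" using additive_subgroup.a_subset[OF ideal.axioms(1)[OF I]] .
  obtain zs where zs: "set zs \<subseteq> carrier R" "\<mm> = Idl (set zs)" using m_gens by blast
  have "\<exists>k::nat. z [^] k \<in> \<Union>I" if z: "z \<in> set zs" for z
  proof -
    have zc: "z \<in> carrier R" "z \<in> \<mm>" using zs z genideal_self[OF zs(1)] by auto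
    then have "K +> z \<in> quot_image R K \<mm>" by (auto simp: quot_image_def)
    then obtain k :: nat where "(K +> z) [^]\<^bsub>R Quot K\<^esub> k \<in> I"
      using prim unfolding primary_to_def by blast
    then have "K +> (z [^] k) \<in> I" using coset_simps(3)[OF K(1) zc(1) zc(1)] by simp
    then show ?thesis using canonical_proj_vimage_mem_iff[OF K(1) Ic, of "z [^] k"] zc(1) by blast
  qed
  then obtain k :: "'a \<Rightarrow> nat" where k: "\<And>z. z \<in> set zs \<Longrightarrow> z [^] k z \<in> \<Union>I" by metis
  define e where "e = Max (insert 0 (k ` set zs))"
  have "z [^] (p ^ e) \<in> \<Union>I" if z: "z \<in> set zs" for z
  proof -
    have "k z \<le> e" unfolding e_def using z by (intro Max_ge) auto
    also have "e \<le> p ^ e" by (rule le_p_power)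
    finally have "z [^] (p ^ e) \<in> PIdl (z [^] k z)" using zs(1) z by (intro pow_in_PIdl) auto
    then show ?thesis using PIdl_least[OF Un k[OF z]] by blast
  qed
  then have "mq e \<subseteq> \<Union>I" unfolding zs(2) bracket_Idl[OF zs(1)] by (intro Idl_least Un) auto
  then show ?thesis by (rule fin_len_sup[OF fin_len_mq Un])
qed

text \<open>Primes of R/fR lift to primes containing \<open>f\<close>; in a domain the zero ideal
  lies strictly below them and lengthens the chain by one.\<close>

lemma krull_dim_hypersurface_le:
  assumes "domain R" "f \<in> \<mm>" "f \<noteq> \<zero>" "krull_dim (R Quot PIdl f) = enat m"
  shows "Suc m \<le> d"
proof -
  interpret domain R by fact
  have fc: "f \<in> carrier R" using assms(2) m_carrier by blast
  have F: "ideal (PIdl f) R" using PIdl_ideal fc by blast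
  have "\<exists>Q. (\<forall>i\<le>m. primeideal (Q i) R \<and> f \<in> Q i) \<and> (\<forall>i<m. Q i \<subset> Q (Suc i))"
  proof (cases "m = 0")
    \<comment> \<open>The value 0 of the dimension does not supply a chain through
      \<open>chain_sup_attained\<close>, so the single prime \<mm> is taken.\<close>
    case True
    have "primeideal \<mm> R" by (rule maximalideal_prime) (rule is_maximalideal)
    then show ?thesis using True assms(2) by (intro exI[of _ "\<lambda>_. \<mm>"]) auto
  next
    case False
    then obtain P where P: "\<forall>i\<le>m. primeideal (P i) (R Quot PIdl f)" "\<forall>i<m. P i \<subset> P (Suc i)"
      using chain_sup_attained[of "{P. primeideal P (R Quot PIdl f)}" m] assms(4) by (auto simp: krull_dim_eq_chain_sup)
    have Pid: "ideal (P i) (R Quot PIdl f)" if "i \<le> m" for i using P(1) that primeideal.axioms(1) by blast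
    have Pc: "P i \<subseteq> carrier (R Quot PIdl f)" if "i \<le> m" for i
      using additive_subgroup.a_subset[OF ideal.axioms(1)[OF Pid[OF that]]] .
    note mem = canonical_proj_vimage_mem_iff[OF F Pc]
    have "f \<in> \<Union>(P i)" if "i \<le> m" for i
    proof -
      have "PIdl f \<in> P i"
        using additive_subgroup.zero_closed[OF ideal.axioms(1)[OF Pid[OF that]]] by (simp add: FactRing_def)
      then show ?thesis using PIdl_self[OF fc] by blast
    qed
    moreover have "\<Union>(P i) \<subset> \<Union>(P (Suc i))" if i: "i < m" for i
    proof -
      have "P i \<subset> P (Suc i)" using P(2) i by blast
      then obtain y where y: "y \<in> P (Suc i)" "y \<notin> P i" by blast
      then obtain x where x: "x \<in> carrier R" "y = PIdl f +> x" using Pc[of "Suc i"] i by (auto simp: carrier_Quot)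
      then have "x \<in> \<Union>(P (Suc i))" "x \<notin> \<Union>(P i)" using mem[of "Suc i" x] mem[of i x] i y by auto
      then show ?thesis using Union_mono[of "P i" "P (Suc i)"] \<open>P i \<subset> P (Suc i)\<close> by blast
    qed
    ultimately show ?thesis using P(1) prime_Union[OF F] by (intro exI[of _ "\<lambda>i. \<Union>(P i)"]) auto
  qed
  then obtain Q where Q: "\<And>i. i \<le> m \<Longrightarrow> primeideal (Q i) R \<and> f \<in> Q i" "\<And>i. i < m \<Longrightarrow> Q i \<subset> Q (Suc i)" by blast
  let ?N = "\<lambda>i. case i of 0 \<Rightarrow> {\<zero>} | Suc j \<Rightarrow> Q j"
  have "\<zero> \<in> Q 0" using Q(1)[of 0] ideal_mem(2) primeideal.axioms(1) by blast
  then have "{\<zero>} \<subset> Q 0" using Q(1)[of 0] assms(3) by auto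
  then have "\<forall>i<Suc m. ?N i \<subset> ?N (Suc i)" using Q(2) by (auto split: nat.split)
  moreover have "\<forall>i\<le>Suc m. ?N i \<in> {P. primeideal P R}"
    using Q(1) zeroprimeideal by (auto split: nat.split)
  ultimately have "enat (Suc m) \<le> krull_dim R"
    unfolding krull_dim_eq_chain_sup chain_sup_def by (intro Sup_upper) blast
  then show ?thesis using dim by simp
qed

text \<open>The number of lifts is pinned from two sides: \<open>length_gens_ge\<close> requires at
  least \<open>d\<close> generators for (f, xs), and the dimension of R/fR allows at most d - 1
  elements \<open>xs\<close>.\<close>

lemma reduction_system_exists:
  assumes "domain R" "f \<in> \<mm>" "f \<noteq> \<zero>"
    and red: "reduction (R Quot PIdl f) (quot_image R (PIdl f) \<mm>) I"
    and par: "parameter_ideal (R Quot PIdl f) (quot_image R (PIdl f) \<mm>) I"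
  shows "\<exists>xs n. reduction_system R \<mm> p d f xs n \<and> quot_preimage R (PIdl f) I = Idl (set (f # xs))
    \<and> krull_dim (R Quot PIdl f) = enat (length xs)"
proof -
  let ?K = "PIdl f" and ?A = "R Quot PIdl f"
  have fc: "f \<in> carrier R" using assms(2) m_carrier by blast
  have K: "ideal ?K R" using PIdl_ideal fc by blast
  have Km: "?K \<subseteq> \<mm>" by (rule PIdl_least[OF m_ideal assms(2)])
  have I: "ideal I ?A" and Im: "I \<subseteq> quot_image R ?K \<mm>" using red by (auto simp: reduction_def)
  obtain n :: nat where n: "I \<cdot>\<^bsub>?A\<^esub> (quot_image R ?K \<mm> [^]\<^bsub>ideals_set ?A\<^esub> n) = quot_image R ?K \<mm> [^]\<^bsub>ideals_set ?A\<^esub> (Suc n)"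
    using red unfolding reduction_def by blast
  obtain ys where ys: "set ys \<subseteq> carrier ?A" "krull_dim ?A = enat (length ys)" "I = Idl\<^bsub>?A\<^esub> (set ys)"
    using par unfolding parameter_ideal_def by blast
  have "\<exists>xs. set xs \<subseteq> carrier R \<and> ys = map (\<lambda>x. ?K +> x) xs"
    using ys(1)
  proof (induction ys)
    case (Cons y ys)
    then obtain xs where "set xs \<subseteq> carrier R" "ys = map (\<lambda>x. ?K +> x) xs" by auto
    moreover obtain x where "x \<in> carrier R" "y = ?K +> x" using Cons.prems by (auto simp: carrier_Quot)
    ultimately show ?case by (intro exI[of _ "x # xs"]) auto
  qed simp
  then obtain xs where xs: "set xs \<subseteq> carrier R" "ys = map (\<lambda>x. ?K +> x) xs" by blast
  have X: "ideal (Idl (set xs)) R" by (rule genideal_ideal[OF xs(1)])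
  have Ieq: "I = quot_image R ?K (Idl (set xs))" using ys(3) xs quot_image_Idl[OF K xs(1)] by simp
  have fxc: "set (f # xs) \<subseteq> carrier R" using fc xs(1) by simp
  have UI: "\<Union>I = Idl (set (f # xs))"
    unfolding Ieq Union_quot_image using Idl_insert[OF xs(1) fc] PIdl_add_comm[OF X fc] by simp
  have Ic: "I \<subseteq> carrier ?A" using additive_subgroup.a_subset[OF ideal.axioms(1)[OF I]] .
  have fin_len: "fin_len (Idl (set (f # xs)))"
    using primary_fl[OF K Km I] par unfolding UI parameter_ideal_def by blast
  have "\<Union>I \<subseteq> \<Union>(quot_image R ?K \<mm>)" using Im by (rule Union_mono)
  also have "\<dots> \<subseteq> \<mm>" unfolding Union_quot_image by (intro add_ideal_least m_ideal Km order_refl)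
  finally have "Idl (set (f # xs)) \<subseteq> \<mm>" unfolding UI .
  then have in_m: "set (f # xs) \<subseteq> \<mm>" and "\<one> \<notin> Idl (set (f # xs))"
    using genideal_self[OF fxc] one_notin_m by blast+
  then have "d \<le> length (f # xs)" using length_gens_ge[OF fxc fin_len] by blast
  moreover have "Suc (length xs) \<le> d"
    using krull_dim_hypersurface_le[OF assms(1-3)] ys(2) xs(2) by simp
  ultimately have len: "length (f # xs) = d" by simp
  have "quot_image R ?K ((Idl (set xs)) \<cdot> ipow \<mm> n) = quot_image R ?K (ipow \<mm> (Suc n))"
    using n unfolding quot_image_pow[OF K m_ideal] Ieq
    by (simp only: quot_image_prod[OF K X ipow_ideal[OF m_ideal]])
  then have "?K <+> (Idl (set xs)) \<cdot> ipow \<mm> n = ?K <+> ipow \<mm> (Suc n)"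
    by (metis Union_quot_image)
  then have "ipow \<mm> (Suc n) \<subseteq> ?K <+> (Idl (set xs)) \<cdot> ipow \<mm> n"
    using add_ideal_upper(2)[OF K ipow_ideal[OF m_ideal], of "Suc n"] by simp
  then have "reduction_system R \<mm> p d f xs n"
    using in_m len fin_len by unfold_locales
  moreover have "quot_preimage R ?K I = Idl (set (f # xs))"
    using quot_preimage_eq_Union[OF K Ic] UI by simp
  ultimately show ?thesis using ys(2) xs(2) by auto
qed

end

theorem theorem1p6:
  fixes R :: "('a, 'b) ring_scheme" and \<mm> :: "'a set" and f :: 'a
    and I :: "'a set set" and p d :: nat
  assumes "regular_local_ring R \<mm>"
    and "domain R"
    and "ring_char R = p" and "p > 0"
    and "krull_dim R = enat d"
    and "f \<in> \<mm>" and "f \<noteq> \<zero>\<^bsub>R\<^esub>"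
    and "minimal_reduction (R Quot PIdl\<^bsub>R\<^esub> f) (quot_image R (PIdl\<^bsub>R\<^esub> f) \<mm>) I"
    and "parameter_ideal (R Quot PIdl\<^bsub>R\<^esub> f) (quot_image R (PIdl\<^bsub>R\<^esub> f) \<mm>) I"
  shows "(\<forall>t\<in>{0..1}.
            h_fun R p d f (colon_ideal R (quot_preimage R (PIdl\<^bsub>R\<^esub> f) I) \<mm>) (1 - t)
              = h_fun R p d f \<mm> t
                - hs_multiplicity (R Quot PIdl\<^bsub>R\<^esub> f) (quot_image R (PIdl\<^bsub>R\<^esub> f) \<mm>) * (t - 1) - 1)
       \<and> (hs_multiplicity (R Quot PIdl\<^bsub>R\<^esub> f) (quot_image R (PIdl\<^bsub>R\<^esub> f) \<mm>) = 2 \<longrightarrow>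
            (\<forall>t\<in>{0..1}. h_fun R p d f \<mm> (1 - t) = h_fun R p d f \<mm> t - 2 * t + 1)
          \<and> (F_finite R p \<longrightarrow>
               (\<forall>t\<in>{0..1}. F_signature R p d \<mm> f (1 - t) = F_signature R p d \<mm> f t + 2 * t - 1))
          \<and> (\<forall>t\<in>{0..1} \<inter> Z_inv p. phi_fun R p d \<mm> f (1 - t) = phi_fun R p d \<mm> f t - 2 * t + 1))"
proof -
  interpret regular_local_ring R \<mm> by fact
  interpret regular_char_p_ring R \<mm> p d
    using domain.ring_char_prime[OF assms(2-4)] assms(5) by unfold_locales
  obtain xs n where sys: "reduction_system R \<mm> p d f xs n"
    and pre: "quot_preimage R (PIdl\<^bsub>R\<^esub> f) I = Idl\<^bsub>R\<^esub> (set (f # xs))"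
    and kd: "krull_dim (R Quot PIdl\<^bsub>R\<^esub> f) = enat (length xs)"
    using reduction_system_exists[OF assms(2,6,7) conjunct1[OF assms(8)[unfolded minimal_reduction_def]] assms(9)]
    by (elim exE conjE)
  interpret reduction_system R \<mm> p d f xs n by (rule sys)
  have hs: "hs_multiplicity (R Quot PIdl\<^bsub>R\<^esub> f) (quot_image R (PIdl\<^bsub>R\<^esub> f) \<mm>) = real (len J)"
    by (rule hs_multiplicity_quotient[OF kd])
  have pre: "quot_preimage R (PIdl\<^bsub>R\<^esub> f) I = J" using pre by (simp add: J_def)
  have h: "h_fun R p d f (colon_ideal R J \<mm>) (1 - t) = h_fun R p d f \<mm> t - real (len J) * (t - 1) - 1"
    if "t \<in> {0..1}" for t
    using h_fun_reflection[OF gorenstein_J] that by simp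
  have double: "h_fun R p d f \<mm> (1 - t) = h_fun R p d f \<mm> t - 2 * t + 1" if "len J = 2" "t \<in> {0..1}" for t
    using h[OF that(2)] colon_J_eq_m[OF gorenstein_J that(1)] that(1) by simp
  show ?thesis
    unfolding hs pre
  proof (intro conjI impI ballI)
    show "h_fun R p d f (colon_ideal R J \<mm>) (1 - t) = h_fun R p d f \<mm> t - real (len J) * (t - 1) - 1"
      if "t \<in> {0..1}" for t by (rule h[OF that])
    assume "real (len J) = 2"
    then have J2: "len J = 2" by simp
    show "h_fun R p d f \<mm> (1 - t) = h_fun R p d f \<mm> t - 2 * t + 1" if "t \<in> {0..1}" for t
      by (rule double[OF J2 that])
    show "F_signature R p d \<mm> f (1 - t) = F_signature R p d \<mm> f t + 2 * t - 1" if "t \<in> {0..1}" for t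
      using double[OF J2 that] by (simp add: F_signature_eq[OF carr(1)])
    show "phi_fun R p d \<mm> f (1 - t) = phi_fun R p d \<mm> f t - 2 * t + 1" if "t \<in> {0..1} \<inter> Z_inv p" for t
      by (rule phi_fun_reflection[OF gorenstein_J J2 that])
  qed
qed

end
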